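(* There is an absolute constant $c>0$ such that the following holds. Let $\epsilon>0$, let $\mathcal{I}$ be a Max-2-CSP instance with alphabet size $k$, regular constraint graph $G_{\mathcal I}$, and objective value $v$, and let $\tau=(\epsilon/k)^{c}$. If $r \ge k\cdot \mathrm{rank}_{\ge\tau}(\mathcal I)/\epsilon^{c}$, then the optimal value $\mathrm{sdpopt}(\mathcal I)$ of the $r$-round Lasserre relaxation of $\mathcal I$ satisfies $\mathrm{sdpopt}(\mathcal I)\le v+\epsilon$. Moreover, there is a polynomial-time rounding scheme that, given an optimal $r$-round Lasserre solution as input, finds an assignment $x$ with $\mathrm{val}_{\mathcal I}(x)>v-\epsilon$.
   Context: A Max-2-CSP instance $\mathcal I$ on variable set $V=[n]$ with alphabet $[k]$ is a probability distribution over triples $(i,j,\Pi)$ with $i,j\in V$ and $\Pi\subseteq[k]\times[k]$. For $x\in[k]^n$, $\mathrm{val}_{\mathcal I}(x)=\Pr_{(i,j,\Pi)\sim\mathcal I}[(x_i,x_j)\in\Pi]$; the objective value of $\mathcal I$ is $\max_x \mathrm{val}_{\mathcal I}(x)$. The constraint graph $G_{\mathcal I}$ is the weighted graph on $V$ whose weight on $\{i,j\}$ is the total probability of constraints on $i,j$; it is assumed regular (every vertex has the same total incident weight). A regular graph is identified with its normalized adjacency matrix (symmetric, nonnegative, row sums $1$), and $\mathrm{rank}_{\ge\tau}(\mathcal I)=\mathrm{rank}_{\ge\tau}(G_{\mathcal I})$ is the number of eigenvalues of this matrix that are larger than $\tau$. An $r$-round Lasserre solution consists of a consistent family of distributions $\mu_T$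 on $[k]^T$ for all $T\subseteq V$ with $|T|\le r+2$ (consistent meaning $\mu_T,\mu_{T'}$ have the same marginal on $T\cap T'$), viewed as local random variables $X_1,\dots,X_n$, together with vectors $v_{S,\alpha}$ for all $S\subseteq V$, $|S|\le r+2$, $\alpha\in[k]^S$, such that $\langle v_{S,\alpha},v_{T,\beta}\rangle=\Pr[X_S=\alpha,X_T=\beta]$ whenever $|S\cup T|\le r+2$. Its value is $\mathbb E_{(i,j,\Pi)\sim\mathcal I}\Pr[(X_i,X_j)\in\Pi]$, and $\mathrm{sdpopt}(\mathcal I)$ is the maximum value over all such solutions. *)

theory Defs
  imports
    "HOL-Probability.Probability_Mass_Function"
    "Jordan_Normal_Form.Char_Poly"
begin

section \<open>Max-2-CSP instances\<close>

text \<open>The variable set is \<open>{..<n}\<close> and the alphabet is \<open>{..<k}\<close>; an instance is a distribution over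
  triples \<open>(i, j, R)\<close>. Constraints with \<open>i = j\<close> are allowed.\<close>

type_synonym constraint = "nat \<times> nat \<times> (nat \<times> nat) set"

definition max2csp :: "nat \<Rightarrow> nat \<Rightarrow> constraint pmf \<Rightarrow> bool" where
  "max2csp n k I \<longleftrightarrow> k \<ge> 1 \<and>
     set_pmf I \<subseteq> {..<n} \<times> {..<n} \<times> Pow ({..<k} \<times> {..<k})"

definition assignments :: "nat set \<Rightarrow> nat \<Rightarrow> (nat \<Rightarrow> nat) set" where
  "assignments T k = T \<rightarrow>\<^sub>E {..<k}"

definition val :: "constraint pmf \<Rightarrow> (nat \<Rightarrow> nat) \<Rightarrow> real" where
  "val I x = measure_pmf.prob I {(i, j, R). (x i, x j) \<in> R}"

definition objective_value :: "nat \<Rightarrow> nat \<Rightarrow> constraint pmf \<Rightarrow> real" where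
  "objective_value n k I = Max (val I ` assignments {..<n} k)"


section \<open>Constraint graph and threshold rank\<close>

text \<open>A constraint \<open>(i, j, R)\<close> contributes to the unordered pair \<open>{i, j}\<close>. A loop \<open>{i, i}\<close>
  contributes its weight once to the weight incident to \<open>i\<close>.\<close>

definition edge_weight :: "constraint pmf \<Rightarrow> nat \<Rightarrow> nat \<Rightarrow> real" where
  "edge_weight I i j = measure_pmf.prob I {(a, b, R). {a, b} = {i, j}}"

definition incident_weight :: "nat \<Rightarrow> constraint pmf \<Rightarrow> nat \<Rightarrow> real" where
  "incident_weight n I i = (\<Sum>j<n. edge_weight I i j)"

definition regular_constraint_graph :: "nat \<Rightarrow> constraint pmf \<Rightarrow> bool" where
  "regular_constraint_graph n I \<longleftrightarrow> (\<exists>d. \<forall>i<n. incident_weight n I i = d)"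

definition normalized_adjacency :: "nat \<Rightarrow> constraint pmf \<Rightarrow> real mat" where
  "normalized_adjacency n I =
     mat n n (\<lambda>(i, j). edge_weight I i j / incident_weight n I i)"

text \<open>Eigenvalues are counted with multiplicity. Following the definition of the notation
  \<open>rank\<^sub>\<ge>\<^sub>\<tau>\<close>, only eigenvalues strictly larger than \<open>\<tau>\<close> are counted.\<close>

definition threshold_rank :: "real mat \<Rightarrow> real \<Rightarrow> nat" where
  "threshold_rank A \<tau> = size {#z \<in># proots (char_poly A). z > \<tau>#}"

definition csp_threshold_rank :: "nat \<Rightarrow> constraint pmf \<Rightarrow> real \<Rightarrow> nat" where
  "csp_threshold_rank n I \<tau> = threshold_rank (normalized_adjacency n I) \<tau>"


section \<open>Lasserre solutions\<close>

text \<open>A solution is a family of local distributions together with vectors in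
  \<open>\<real>\<^sup>d\<close>, where the dimension \<open>d\<close> is part of the solution.\<close>

record lasserre =
  local_dist :: "nat set \<Rightarrow> (nat \<Rightarrow> nat) pmf"
  vec_dim :: nat
  lvec :: "nat set \<Rightarrow> (nat \<Rightarrow> nat) \<Rightarrow> real vec"

definition small_sets :: "nat \<Rightarrow> nat \<Rightarrow> nat set set" where
  "small_sets n r = {T. T \<subseteq> {..<n} \<and> card T \<le> r + 2}"

definition lasserre_solution :: "nat \<Rightarrow> nat \<Rightarrow> nat \<Rightarrow> lasserre \<Rightarrow> bool" where
  "lasserre_solution n k r L \<longleftrightarrow>
     (\<forall>T \<in> small_sets n r. set_pmf (local_dist L T) \<subseteq> assignments T k) \<and>
     (\<forall>T \<in> small_sets n r. \<forall>T' \<in> small_sets n r.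
        map_pmf (\<lambda>x. restrict x (T \<inter> T')) (local_dist L T) =
        map_pmf (\<lambda>x. restrict x (T \<inter> T')) (local_dist L T')) \<and>
     (\<forall>S \<in> small_sets n r. \<forall>\<alpha> \<in> assignments S k. lvec L S \<alpha> \<in> carrier_vec (vec_dim L)) \<and>
     (\<forall>S \<in> small_sets n r. \<forall>T \<in> small_sets n r. S \<union> T \<in> small_sets n r \<longrightarrow>
        (\<forall>\<alpha> \<in> assignments S k. \<forall>\<beta> \<in> assignments T k.
           scalar_prod (lvec L S \<alpha>) (lvec L T \<beta>) =
           measure_pmf.prob (local_dist L (S \<union> T))
             {x. restrict x S = \<alpha> \<and> restrict x T = \<beta>}))"

definition lasserre_value :: "constraint pmf \<Rightarrow> lasserre \<Rightarrow> real" where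
  "lasserre_value I L = measure_pmf.expectation I
     (\<lambda>(i, j, R). measure_pmf.prob (local_dist L {i, j}) {x. (x i, x j) \<in> R})"

definition sdpopt :: "nat \<Rightarrow> nat \<Rightarrow> nat \<Rightarrow> constraint pmf \<Rightarrow> real" where
  "sdpopt n k r I = (SUP L \<in> {L. lasserre_solution n k r L}. lasserre_value I L)"

definition optimal_lasserre_solution ::
  "nat \<Rightarrow> nat \<Rightarrow> nat \<Rightarrow> constraint pmf \<Rightarrow> lasserre \<Rightarrow> bool" where
  "optimal_lasserre_solution n k r I L \<longleftrightarrow>
     lasserre_solution n k r L \<and> lasserre_value I L = sdpopt n k r I"


section \<open>Real RAM programs\<close>

text \<open>Lasserre solutions consist of real numbers, so running time is measured on a unit-cost real RAM,
  presented as a structured while language over arrays of naturals and arrays of reals. A program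
  mentions only finitely many arrays, and an array index is computed at run time (indirect
  addressing). The model is uniform: the only constants are natural numbers. There is no
  multiplication on naturals and no rounding from reals to naturals, so bit lengths of
  naturals grow at most linearly with time. Each assignment or test costs one unit;
  the expressions in it have fixed size.\<close>

datatype nexp =
    NConst nat
  | NCell nat nexp
  | NAdd nexp nexp
  | NSub nexp nexp

datatype rexp =
    RNat nexp
  | RCell nat nexp
  | RAdd rexp rexp
  | RSub rexp rexp
  | RMul rexp rexp
  | RDiv rexp rexp

datatype test =
    NLess nexp nexp
  | RLess rexp rexp
  | TNot test
  | TAnd test test

datatype prog =
    Skip
  | NAssign nat nexp nexp
  | RAssign nat nexp rexp
  | Seq prog prog
  | Cond test prog prog
  | While test prog

type_synonym state = "(nat \<Rightarrow> nat \<Rightarrow> nat) \<times> (nat \<Rightarrow> nat \<Rightarrow> real)"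

primrec nval :: "nexp \<Rightarrow> state \<Rightarrow> nat" where
  "nval (NConst m) s = m"
| "nval (NCell a e) s = fst s a (nval e s)"
| "nval (NAdd e f) s = nval e s + nval f s"
| "nval (NSub e f) s = nval e s - nval f s"

primrec rval :: "rexp \<Rightarrow> state \<Rightarrow> real" where
  "rval (RNat e) s = real (nval e s)"
| "rval (RCell a e) s = snd s a (nval e s)"
| "rval (RAdd e f) s = rval e s + rval f s"
| "rval (RSub e f) s = rval e s - rval f s"
| "rval (RMul e f) s = rval e s * rval f s"
| "rval (RDiv e f) s = rval e s / rval f s"

primrec tval :: "test \<Rightarrow> state \<Rightarrow> bool" where
  "tval (NLess e f) s = (nval e s < nval f s)"
| "tval (RLess e f) s = (rval e s < rval f s)"
| "tval (TNot b) s = (\<not> tval b s)"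
| "tval (TAnd b c) s = (tval b s \<and> tval c s)"

definition store :: "(nat \<Rightarrow> nat \<Rightarrow> 'a) \<Rightarrow> nat \<Rightarrow> nat \<Rightarrow> 'a \<Rightarrow> (nat \<Rightarrow> nat \<Rightarrow> 'a)" where
  "store M a i y = M(a := (M a)(i := y))"

text \<open>\<open>exec p s t s'\<close>: started in \<open>s\<close>, the program \<open>p\<close> halts in \<open>s'\<close> after \<open>t\<close> steps.\<close>

inductive exec :: "prog \<Rightarrow> state \<Rightarrow> nat \<Rightarrow> state \<Rightarrow> bool" where
  Skip: "exec Skip s 1 s"
| NAssign: "exec (NAssign a e f) s 1 (store (fst s) a (nval e s) (nval f s), snd s)"
| RAssign: "exec (RAssign a e f) s 1 (fst s, store (snd s) a (nval e s) (rval f s))"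
| Seq: "exec p s t s' \<Longrightarrow> exec q s' t' s'' \<Longrightarrow> exec (Seq p q) s (t + t') s''"
| CondTrue: "tval b s \<Longrightarrow> exec p s t s' \<Longrightarrow> exec (Cond b p q) s (t + 1) s'"
| CondFalse: "\<not> tval b s \<Longrightarrow> exec q s t s' \<Longrightarrow> exec (Cond b p q) s (t + 1) s'"
| WhileFalse: "\<not> tval b s \<Longrightarrow> exec (While b p) s 1 s"
| WhileTrue: "tval b s \<Longrightarrow> exec p s t s' \<Longrightarrow> exec (While b p) s' t' s'' \<Longrightarrow>
    exec (While b p) s (t + t' + 1) s''"

text \<open>An input is a list of arrays of naturals and a list of arrays of reals; all remaining memory
  is zero. The output is read from array 0 of naturals.\<close>

type_synonym input = "nat list list \<times> real list list"

definition load :: "'a::zero list list \<Rightarrow> nat \<Rightarrow> nat \<Rightarrow> 'a" where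
  "load xss a i = (if a < length xss \<and> i < length (xss ! a) then xss ! a ! i else 0)"

definition initial_state :: "input \<Rightarrow> state" where
  "initial_state inp = (load (fst inp), load (snd inp))"

definition input_size :: "input \<Rightarrow> nat" where
  "input_size inp = sum_list (map length (fst inp)) + sum_list (map length (snd inp))"

definition output_assignment :: "nat \<Rightarrow> state \<Rightarrow> (nat \<Rightarrow> nat)" where
  "output_assignment n s = restrict (fst s 0) {..<n}"


section \<open>Input of the rounding scheme\<close>

text \<open>The input lists the constraints in the support of the instance and the index pairs \<open>(S, \<alpha>)\<close>
  of the Lasserre solution, each in an arbitrary order.\<close>

definition lists_constraints :: "constraint pmf \<Rightarrow> constraint list \<Rightarrow> bool" where
  "lists_constraints I cs \<longleftrightarrow> distinct cs \<and> set cs = set_pmf I"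

definition lists_indices ::
  "nat \<Rightarrow> nat \<Rightarrow> nat \<Rightarrow> (nat set \<times> (nat \<Rightarrow> nat)) list \<Rightarrow> bool" where
  "lists_indices n k r es \<longleftrightarrow> distinct es \<and>
     set es = (SIGMA S : small_sets n r. assignments S k)"

text \<open>A predicate is a row-major \<open>k \<times> k\<close> table of bits.\<close>

definition predicate_bits :: "nat \<Rightarrow> constraint \<Rightarrow> nat list" where
  "predicate_bits k c = (case c of (i, j, R) \<Rightarrow>
     concat (map (\<lambda>a. map (\<lambda>b. of_bool ((a, b) \<in> R)) [0..<k]) [0..<k]))"

text \<open>A partial assignment is a row of length \<open>n\<close>, with \<open>0\<close> marking the variables outside \<open>S\<close>.\<close>

definition index_row :: "nat \<Rightarrow> nat set \<times> (nat \<Rightarrow> nat) \<Rightarrow> nat list" where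
  "index_row n e = (case e of (S, \<alpha>) \<Rightarrow> map (\<lambda>i. if i \<in> S then \<alpha> i + 1 else 0) [0..<n])"

text \<open>The first array of naturals is left empty for the output.\<close>

definition encode ::
  "nat \<Rightarrow> nat \<Rightarrow> nat \<Rightarrow> constraint pmf \<Rightarrow> lasserre \<Rightarrow>
   constraint list \<Rightarrow> (nat set \<times> (nat \<Rightarrow> nat)) list \<Rightarrow> input" where
  "encode n k r I L cs es =
     ([[],
       [n, k, r, vec_dim L, length cs, length es],
       concat (map (\<lambda>(i, j, R). [i, j]) cs),
       concat (map (predicate_bits k) cs),
       concat (map (index_row n) es)],
      [map (pmf I) cs,
       map (\<lambda>(S, \<alpha>). pmf (local_dist L S) \<alpha>) es,
       concat (map (\<lambda>(S, \<alpha>). list_of_vec (lvec L S \<alpha>)) es)])"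

end

theory Submission
  imports Defs "Jordan_Normal_Form.Spectral_Radius"
begin

unbundle no vec_syntax
unbundle no inner_syntax

text \<open>Condition the Lasserre solution on the values of a set \<open>S\<close> of at most \<open>r\<close> variables and sample all
  variables independently from the conditional marginals. The loss is controlled by the covariances
  along the edges of the constraint graph. By Cauchy-Schwarz it is at most \<open>sqrt (k * M i j) / 2\<close> on an
  edge, where \<open>M\<close> is a positive semidefinite matrix of squared covariances. Splitting the
  adjacency matrix at \<open>\<tau>\<close> and reweighting the vertices by leverage scores bounds the edge
  average of this quantity by the average of \<open>M\<close> over all pairs of vertices, times the threshold rank.
  The average over pairs is in turn at most the expected drop of the total variance when one more
  random variable joins \<open>S\<close>. Variances are bounded, so some \<open>S\<close> has drop at most \<open>1 / (r + 1)\<close>.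

  The rounding is derandomised by trying every pair \<open>(S, \<alpha>)\<close>, fixing the variables one by one by
  the method of conditional expectations, and keeping the best assignment found. The exponent is \<open>c = 3\<close>.\<close>

section \<open>Spectral decomposition of real symmetric matrices\<close>

text \<open>Two steps make different demands. The spectral step needs a positive semidefinite
  matrix, and this is where the Lasserre vectors enter: conditional covariances are inner products
  of projected vectors, and their squares are inner products of tensor squares. The averaging step
  needs a quantity that telescopes as variables join \<open>S\<close>, which a variance does by the
  law of total variance. Hence two matrices, compared by AM-GM. The square root in the loss is
  replaced by a weighted arithmetic mean with a free weight \<open>\<theta>\<close>. That bound is
  linear in the matrix, so it can be averaged over \<open>\<alpha>\<close> before
  \<open>\<theta>\<close> is fixed. The exponent serves the threshold and the number of rounds at
  once: for \<open>\<epsilon> \<le> 1\<close> their terms together cost at most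
  \<open>3/8 * \<epsilon>^2\<close>, and the choice of \<open>\<theta>\<close> adds
  \<open>\<epsilon> / 2\<close>. For larger \<open>\<epsilon>\<close> the claims follow from values
  lying between 0 and 1. The program never sees \<open>\<epsilon>\<close>: a good pair exists by
  averaging, and since the input lists all pairs, exhaustive search is polynomial in its
  length.\<close>

lemma householder_completion:
  fixes v :: "real vec"
  assumes v: "v \<in> carrier_vec n" and unit: "v \<bullet> v = 1"
  shows "\<exists>W \<in> carrier_mat n n. transpose_mat W * W = 1\<^sub>m n \<and> col W 0 = v"
proof -
  have n: "0 < n" using v unit by (cases n) (auto simp: scalar_prod_def)
  \<comment> \<open>Direction of the Householder reflection that exchanges \<open>v\<close> with the
    first unit vector; its squared length is \<open>2 * c\<close>.\<close>
  define w where "w i = v $ i - of_bool (i = 0)" for i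
  have ss: "(\<Sum>i<n. (v $ i)^2) = 1"
    using unit v by (simp add: scalar_prod_def power2_eq_square lessThan_atLeast0)
  have v0: "(\<Sum>i<n. v $ i * of_bool (i = 0)) = v $ 0"
    using n by (simp add: of_bool_def if_distrib[of "\<lambda>x. _ * x"] cong: if_cong)
  define c where "c = 1 - v $ 0"
  have ww: "(\<Sum>i<n. w i * w i) = 2 * c"
  proof -
    have "(\<Sum>i<n. w i * w i) = (\<Sum>i<n. (v $ i)^2 - 2 * (v $ i * of_bool (i = 0)) + of_bool (i = 0))"
      by (rule sum.cong) (auto simp: w_def power2_eq_square algebra_simps)
    also have "\<dots> = 1 - 2 * v $ 0 + 1"
      unfolding sum.distrib sum_subtractf sum_distrib_left[symmetric] ss v0
      using n by (simp add: of_bool_def)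
    finally show ?thesis by (simp add: c_def)
  qed
  show ?thesis
  \<comment> \<open>If \<open>c = 0\<close> then \<open>v\<close> is the first unit vector itself
    and the reflection is undefined; the identity serves instead.\<close>
  proof (cases "c = 0")
    case True
    have w0: "w i = 0" if "i < n" for i
    proof -
      have "(\<Sum>i<n. (w i)^2) = 0" using ww True by (simp add: power2_eq_square)
      then show ?thesis using that by (subst (asm) sum_nonneg_eq_0_iff) auto
    qed
    have "col (1\<^sub>m n) 0 = v"
    proof (rule eq_vecI)
      fix i assume "i < dim_vec v"
      with v have "i < n" by simp
      with w0[of i] n show "col (1\<^sub>m n) 0 $ i = v $ i" by (auto simp: w_def split: if_splits)
    qed (use v in auto)
    then show ?thesis by (intro bexI[of _ "1\<^sub>m n"]) auto
  next
    case False
    \<comment> \<open>Since \<open>w\<close> has squared length \<open>2 * c\<close>, this is the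
      reflection \<open>1 - 2 w w^T / |w|^2\<close>.\<close>
    define W where "W = mat n n (\<lambda>(i, j). of_bool (i = j) - w i * w j / c)"
    have W: "W \<in> carrier_mat n n" by (simp add: W_def)
    have "transpose_mat W * W = 1\<^sub>m n"
    proof (rule eq_matI)
      fix i j assume "i < dim_row (1\<^sub>m n :: real mat)" "j < dim_col (1\<^sub>m n :: real mat)"
      then have ij: "i < n" "j < n" by auto
      have "(transpose_mat W * W) $$ (i, j)
          = (\<Sum>l<n. (of_bool (l = i) - w l * w i / c) * (of_bool (l = j) - w l * w j / c))"
        using ij by (simp add: W_def scalar_prod_def lessThan_atLeast0)
      also have "\<dots> = (\<Sum>l<n. of_bool (l = i) * of_bool (l = j) - of_bool (l = i) * (w l * w j / c)
          - of_bool (l = j) * (w l * w i / c) + w i * w j / c^2 * (w l * w l))"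
        by (rule sum.cong) (auto simp: algebra_simps power2_eq_square)
      also have "\<dots> = of_bool (i = j) - w i * w j / c - w j * w i / c + w i * w j / c^2 * (2 * c)"
        unfolding sum.distrib sum_subtractf sum_distrib_left[symmetric] ww
        using ij by (simp add: of_bool_def if_distrib[of "\<lambda>x. x * _"] if_distrib[of "\<lambda>x. x / _"] cong: if_cong)
      also have "\<dots> = of_bool (i = j)" using False by (simp add: field_simps power2_eq_square)
      finally show "(transpose_mat W * W) $$ (i, j) = 1\<^sub>m n $$ (i, j)" using ij by simp
    qed (simp_all add: W_def)
    moreover have "col W 0 = v"
    proof (rule eq_vecI)
      fix i assume "i < dim_vec v"
      with v have i: "i < n" by simp
      have "w i * w 0 / c = - w i" using False by (simp add: w_def c_def field_simps)
      then show "col W 0 $ i = v $ i" using i n by (simp add: W_def) (simp add: w_def)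
    qed (use v W in auto)
    ultimately show ?thesis using W by blast
  qed
qed

text \<open>A complex eigenvalue always exists. The Hermitian form \<open>H = \<mu> * N\<close> is
  its own conjugate, which forces \<open>\<mu>\<close> to be real. The real eigenvector is then
  obtained afresh from the real root of the characteristic polynomial.\<close>

lemma symmetric_mat_real_eigenvector:
  fixes A :: "real mat"
  assumes A: "A \<in> carrier_mat n n" and sym: "transpose_mat A = A" and n: "0 < n"
  shows "\<exists>e v. v \<in> carrier_vec n \<and> v \<bullet> v = 1 \<and> A *\<^sub>v v = e \<cdot>\<^sub>v v"
proof -
  let ?A = "map_mat complex_of_real A"
  have cA: "?A \<in> carrier_mat n n" using A by simp
  obtain \<mu> where "\<mu> \<in> spectrum ?A" using spectrum_non_empty[OF cA] n by auto
  then have ev: "eigenvalue ?A \<mu>" by (simp add: spectrum_def)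
  then obtain x where x: "x \<in> carrier_vec n" "x \<noteq> 0\<^sub>v n" "?A *\<^sub>v x = \<mu> \<cdot>\<^sub>v x"
    using A by (auto simp: eigenvalue_def eigenvector_def)
  have row: "(\<Sum>j<n. of_real (A $$ (i, j)) * x $ j) = \<mu> * x $ i" if "i < n" for i
  proof -
    have "(?A *\<^sub>v x) $ i = (\<mu> \<cdot>\<^sub>v x) $ i" using x by simp
    then show ?thesis using that A x(1) by (simp add: scalar_prod_def lessThan_atLeast0)
  qed
  have sA: "A $$ (i, j) = A $$ (j, i)" if "i < n" "j < n" for i j
    using that A arg_cong[OF sym, of "\<lambda>B. B $$ (i, j)"] by simp
  define N where "N = (\<Sum>i<n. cnj (x $ i) * x $ i)"
  define H where "H = (\<Sum>i<n. \<Sum>j<n. cnj (x $ i) * of_real (A $$ (i, j)) * x $ j)"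
  have NN: "N = of_real (\<Sum>i<n. (cmod (x $ i))^2)"
    by (simp add: N_def complex_norm_square mult.commute del: of_real_power)
  have "H = (\<Sum>i<n. cnj (x $ i) * (\<mu> * x $ i))"
    unfolding H_def by (intro sum.cong refl) (auto simp: row[symmetric] sum_distrib_left mult.assoc)
  then have H1: "H = \<mu> * N" by (simp add: N_def sum_distrib_left mult.left_commute)
  have "cnj H = (\<Sum>i<n. \<Sum>j<n. cnj (x $ j) * of_real (A $$ (j, i)) * x $ i)"
    unfolding H_def cnj_sum by (intro sum.cong refl) (auto simp: sA mult_ac)
  also have "\<dots> = H" unfolding H_def by (rule sum.swap)
  finally have "cnj H = H" .
  then have "cnj \<mu> * N = \<mu> * N" unfolding H1 by (simp add: NN)
  moreover have "N \<noteq> 0"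
  proof
    assume "N = 0"
    then have "(\<Sum>i<n. (cmod (x $ i))^2) = 0" using NN by (simp del: of_real_sum)
    then have "\<forall>i<n. x $ i = 0" by (subst (asm) sum_nonneg_eq_0_iff) auto
    then have "x = 0\<^sub>v n" using x(1) by (intro eq_vecI) auto
    with x(2) show False by simp
  qed
  ultimately have "cnj \<mu> = \<mu>" by simp
  then obtain e where e: "\<mu> = of_real e" by (metis Reals_cases Reals_cnj_iff)
  interpret hom: inj_idom_hom complex_of_real by (unfold_locales) auto
  have "char_poly ?A = map_poly complex_of_real (char_poly A)"
    using of_real_hom.char_poly_hom[OF A] by simp
  moreover have "poly (char_poly ?A) \<mu> = 0" using ev eigenvalue_root_char_poly[OF cA] by simp
  ultimately have "poly (char_poly A) e = 0" unfolding e by simp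
  then have "eigenvalue A e" using eigenvalue_root_char_poly[OF A] by simp
  then obtain y where y: "y \<in> carrier_vec n" "y \<noteq> 0\<^sub>v n" "A *\<^sub>v y = e \<cdot>\<^sub>v y"
    using A by (auto simp: eigenvalue_def eigenvector_def)
  have yy: "y \<bullet> y > 0"
    using y conjugate_square_greater_0_vec[of y n] by simp
  let ?s = "1 / sqrt (y \<bullet> y)"
  let ?v = "?s \<cdot>\<^sub>v y"
  have "?v \<bullet> ?v = ?s * ?s * (y \<bullet> y)" using y(1) by simp
  also have "\<dots> = 1" using yy by (simp add: real_sqrt_mult_self field_simps)
  finally have "?v \<bullet> ?v = 1" .
  moreover have "A *\<^sub>v ?v = e \<cdot>\<^sub>v ?v"
    using y A by (simp add: mult_mat_vec smult_smult_assoc mult.commute)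
  ultimately show ?thesis using y(1) by (intro exI[of _ e] exI[of _ ?v]) auto
qed

lemma mult_block_diagonal_mat:
  fixes A B :: "'a :: comm_ring_1 mat"
  assumes A: "A \<in> carrier_mat m m" "A' \<in> carrier_mat m m"
    and B: "B \<in> carrier_mat n n" "B' \<in> carrier_mat n n"
  shows "four_block_mat A (0\<^sub>m m n) (0\<^sub>m n m) B * four_block_mat A' (0\<^sub>m m n) (0\<^sub>m n m) B'
    = four_block_mat (A * A') (0\<^sub>m m n) (0\<^sub>m n m) (B * B')"
proof -
  have z: "0\<^sub>m m n \<in> carrier_mat m n" "0\<^sub>m n m \<in> carrier_mat n m" for m n by auto
  show ?thesis
    unfolding mult_four_block_mat[OF A(1) z(1) z(2) B(1) A(2) z(1) z(2) B(2)]
    using A B by simp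
qed

text \<open>Deflation: in an orthonormal basis that starts with an eigenvector, symmetry clears the
  first row along with the first column, and the remaining block is symmetric again.\<close>

lemma symmetric_mat_orthogonal_diagonalization:
  fixes A :: "real mat"
  assumes "A \<in> carrier_mat n n" and "transpose_mat A = A"
  shows "\<exists>U D. U \<in> carrier_mat n n \<and> transpose_mat U * U = 1\<^sub>m n \<and>
    D \<in> carrier_mat n n \<and> diagonal_mat D \<and> A = U * D * transpose_mat U"
  using assms
proof (induction n arbitrary: A)
  case 0
  then show ?case by (intro exI[of _ A]) (auto simp: diagonal_mat_def)
next
  case (Suc n)
  note A = Suc.prems(1) and sym = Suc.prems(2)
  obtain e v where v: "v \<in> carrier_vec (Suc n)" "v \<bullet> v = 1" and ev: "A *\<^sub>v v = e \<cdot>\<^sub>v v"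
    using symmetric_mat_real_eigenvector[OF A sym] by auto
  obtain W where W: "W \<in> carrier_mat (Suc n) (Suc n)"
    and WW: "transpose_mat W * W = 1\<^sub>m (Suc n)" and col: "col W 0 = v"
    using householder_completion[OF v] by auto
  let ?W = "transpose_mat W"
  have Wt: "?W \<in> carrier_mat (Suc n) (Suc n)" using W by simp
  have WW': "W * ?W = 1\<^sub>m (Suc n)" by (rule mat_mult_left_right_inverse[OF Wt W WW])
  define B where "B = ?W * A * W"
  have B: "B \<in> carrier_mat (Suc n) (Suc n)" using A W by (simp add: B_def)
  have symB: "transpose_mat B = B"
    unfolding B_def using A W Wt sym
    by (simp add: transpose_mult[of _ "Suc n" "Suc n" _ "Suc n"] assoc_mult_mat[of _ "Suc n" "Suc n" _ "Suc n" _ "Suc n"])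
  have Bij: "B $$ (i, j) = B $$ (j, i)" if "i < Suc n" "j < Suc n" for i j
    using arg_cong[OF symB, of "\<lambda>M. M $$ (i, j)"] that B by simp
  have B0: "B $$ (i, 0) = e * of_bool (i = 0)" if i: "i < Suc n" for i
  proof -
    have "col B 0 = (?W * A) *\<^sub>v col W 0"
      unfolding B_def by (rule col_mult2[of _ "Suc n" "Suc n" _ "Suc n"]) (use A W in auto)
    also have "\<dots> = ?W *\<^sub>v (A *\<^sub>v v)"
      unfolding col by (rule assoc_mult_mat_vec[OF Wt A v(1)])
    also have "\<dots> = e \<cdot>\<^sub>v (?W *\<^sub>v col W 0)" unfolding ev col by (rule mult_mat_vec[OF Wt v(1)])
    also have "?W *\<^sub>v col W 0 = col (?W * W) 0"
      by (rule col_mult2[symmetric, of _ "Suc n" "Suc n" _ "Suc n"]) (use W in auto)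
    finally have "col B 0 = e \<cdot>\<^sub>v col (1\<^sub>m (Suc n)) 0" unfolding WW .
    then have "col B 0 $ i = (e \<cdot>\<^sub>v col (1\<^sub>m (Suc n)) 0) $ i" by simp
    then show ?thesis using i B by simp
  qed
  define A3 where "A3 = mat n n (\<lambda>(i, j). B $$ (Suc i, Suc j))"
  have A3: "A3 \<in> carrier_mat n n" by (simp add: A3_def)
  have symA3: "transpose_mat A3 = A3"
    by (rule eq_matI) (auto simp: A3_def Bij)
  obtain U D where U: "U \<in> carrier_mat n n" and UU: "transpose_mat U * U = 1\<^sub>m n"
    and D: "D \<in> carrier_mat n n" "diagonal_mat D" and A3U: "A3 = U * D * transpose_mat U"
    using Suc.IH[OF A3 symA3] by blast
  let ?E = "mat 1 1 (\<lambda>_. e) :: real mat"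
  let ?Z = "0\<^sub>m 1 n :: real mat" and ?Z' = "0\<^sub>m n 1 :: real mat"
  define V where "V = four_block_mat (1\<^sub>m 1) ?Z ?Z' U"
  define F where "F = four_block_mat ?E ?Z ?Z' D"
  have V: "V \<in> carrier_mat (Suc n) (Suc n)" using four_block_carrier_mat[of "1\<^sub>m 1" 1 1 U n n] U unfolding V_def by simp
  have F: "F \<in> carrier_mat (Suc n) (Suc n)" using four_block_carrier_mat[of ?E 1 1 D n n] D unfolding F_def by simp
  have Vt: "transpose_mat V = four_block_mat (1\<^sub>m 1) ?Z ?Z' (transpose_mat U)"
    using transpose_four_block_mat[of "1\<^sub>m 1" 1 1 ?Z n ?Z' n U] U unfolding V_def by simp
  have VV: "transpose_mat V * V = 1\<^sub>m (Suc n)"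
    unfolding Vt unfolding V_def
    using mult_block_diagonal_mat[of "1\<^sub>m 1" 1 "1\<^sub>m 1" "transpose_mat U" n U] U UU by simp
  have BV: "B = V * F * transpose_mat V"
  proof -
    have "V * F = four_block_mat ?E ?Z ?Z' (U * D)"
      unfolding V_def F_def
      using mult_block_diagonal_mat[of "1\<^sub>m 1" 1 ?E U n D] U D by simp
    then have "V * F * transpose_mat V = four_block_mat ?E ?Z ?Z' A3"
      unfolding Vt A3U
      using mult_block_diagonal_mat[of ?E 1 "1\<^sub>m 1" "U * D" n "transpose_mat U"] U D by simp
    also have "\<dots> = B"
    proof (rule eq_matI)
      fix i j assume "i < dim_row B" "j < dim_col B"
      then have ij: "i < Suc n" "j < Suc n" using B by auto
      then show "four_block_mat ?E ?Z ?Z' A3 $$ (i, j) = B $$ (i, j)"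
        using B0[of i] B0[of j] Bij[of i j] A3 by (cases i; cases j) (auto simp: A3_def)
    qed (use B A3 in auto)
    finally show ?thesis by simp
  qed
  have Vt': "transpose_mat V \<in> carrier_mat (Suc n) (Suc n)" using V by simp
  have WV: "W * V \<in> carrier_mat (Suc n) (Suc n)" using W V by simp
  have tWV: "transpose_mat (W * V) = transpose_mat V * ?W"
    using W V by (simp add: transpose_mult[of _ "Suc n" "Suc n" _ "Suc n"])
  note assoc = assoc_mult_mat[of _ "Suc n" "Suc n" _ "Suc n" _ "Suc n"]
  have "transpose_mat (W * V) * (W * V) = transpose_mat V * ((?W * W) * V)"
    unfolding tWV using W V Wt Vt' by (simp add: assoc)
  then have orth: "transpose_mat (W * V) * (W * V) = 1\<^sub>m (Suc n)"
    unfolding WW using V VV by simp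
  have "A = (W * ?W) * A * (W * ?W)" unfolding WW' using A by simp
  also have "\<dots> = W * B * ?W" unfolding B_def using A W Wt by (simp add: assoc)
  also have "\<dots> = (W * V) * F * transpose_mat (W * V)"
    unfolding BV tWV using W V Wt Vt' F by (simp add: assoc)
  finally have "A = (W * V) * F * transpose_mat (W * V)" .
  moreover have "diagonal_mat F"
    using D unfolding F_def diagonal_mat_def by (auto simp: less_Suc_eq_0_disj) metis+
  ultimately show ?case using WV orth F by blast
qed

lemma mult_diagonal_mat_transpose_index:
  fixes U D :: "real mat"
  assumes U: "U \<in> carrier_mat n n" and D: "D \<in> carrier_mat n n" "diagonal_mat D"
    and ij: "i < n" "j < n"
  shows "(U * D * transpose_mat U) $$ (i, j) = (\<Sum>t<n. D $$ (t, t) * (U $$ (i, t) * U $$ (j, t)))"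
proof -
  have UD: "(U * D) $$ (i, t) = U $$ (i, t) * D $$ (t, t)" if t: "t < n" for t
  proof -
    have "(U * D) $$ (i, t) = (\<Sum>s<n. U $$ (i, s) * D $$ (s, t))"
      using ij t U D by (simp add: scalar_prod_def lessThan_atLeast0)
    also have "\<dots> = (\<Sum>s<n. if s = t then U $$ (i, t) * D $$ (t, t) else 0)"
      by (rule sum.cong) (use D t in \<open>auto simp: diagonal_mat_def\<close>)
    also have "\<dots> = U $$ (i, t) * D $$ (t, t)" using t by simp
    finally show ?thesis .
  qed
  have "(U * D * transpose_mat U) $$ (i, j) = (\<Sum>t<n. (U * D) $$ (i, t) * U $$ (j, t))"
    using ij U D by (simp add: scalar_prod_def lessThan_atLeast0 del: assoc_mult_mat)
  also have "\<dots> = (\<Sum>t<n. D $$ (t, t) * (U $$ (i, t) * U $$ (j, t)))"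
    by (rule sum.cong) (auto simp: UD mult_ac)
  finally show ?thesis .
qed

lemma proots_prod_list_linear: "proots (\<Prod>e\<leftarrow>es. [:- e, 1:]) = mset (es :: real list)"
proof (induction es)
  case (Cons e es)
  have "prod_list (map (\<lambda>e. [:- e, 1:]) es) \<noteq> (0 :: real poly)"
    by (auto simp: prod_list_zero_iff)
  then have "proots ([:- e, 1:] * (\<Prod>e\<leftarrow>es. [:- e, 1:])) = proots [:- e, 1:] + mset es"
    using Cons by (subst proots_mult) auto
  then show ?case by (simp add: proots_linear_factor del: mult_pCons_left)
qed simp

text \<open>Interface to the rest of the proof: sums over indices instead of matrix products, and
  the threshold rank as a number of indices \<open>t\<close> instead of the size of a multiset of
  roots, by similarity to the diagonal matrix.\<close>

lemma symmetric_mat_spectral: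
  fixes A :: "real mat"
  assumes A: "A \<in> carrier_mat n n" and sym: "transpose_mat A = A"
  obtains u :: "nat \<Rightarrow> nat \<Rightarrow> real" and lam :: "nat \<Rightarrow> real"
  where "\<And>i j. i < n \<Longrightarrow> j < n \<Longrightarrow> A $$ (i, j) = (\<Sum>t<n. lam t * (u t i * u t j))"
    and "\<And>i j. i < n \<Longrightarrow> j < n \<Longrightarrow> (\<Sum>t<n. u t i * u t j) = of_bool (i = j)"
    and "\<And>t t'. t < n \<Longrightarrow> t' < n \<Longrightarrow> (\<Sum>i<n. u t i * u t' i) = of_bool (t = t')"
    and "\<And>\<tau>. threshold_rank A \<tau> = card {t. t < n \<and> lam t > \<tau>}"
proof -
  obtain U D where U: "U \<in> carrier_mat n n" and UU: "transpose_mat U * U = 1\<^sub>m n"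
    and D: "D \<in> carrier_mat n n" "diagonal_mat D" and AU: "A = U * D * transpose_mat U"
    using symmetric_mat_orthogonal_diagonalization[OF A sym] by blast
  have Ut: "transpose_mat U \<in> carrier_mat n n" using U by simp
  have UU': "U * transpose_mat U = 1\<^sub>m n" by (rule mat_mult_left_right_inverse[OF Ut U UU])
  let ?u = "\<lambda>t i. U $$ (i, t)" and ?lam = "\<lambda>t. D $$ (t, t)"
  have "(\<Sum>t<n. ?u t i * ?u t j) = of_bool (i = j)" if "i < n" "j < n" for i j
    using that U arg_cong[OF UU', of "\<lambda>M. M $$ (i, j)"]
    by (simp add: scalar_prod_def lessThan_atLeast0)
  moreover have "(\<Sum>i<n. ?u t i * ?u t' i) = of_bool (t = t')" if "t < n" "t' < n" for t t'
    using that U arg_cong[OF UU, of "\<lambda>M. M $$ (t, t')"]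
    by (simp add: scalar_prod_def lessThan_atLeast0)
  moreover have "threshold_rank A \<tau> = card {t. t < n \<and> ?lam t > \<tau>}" for \<tau>
  proof -
    have "similar_mat_wit A D U (transpose_mat U)"
      by (rule similar_mat_witI[of _ _ n]) (use A U D AU UU UU' in auto)
    then have "char_poly A = char_poly D"
      by (intro char_poly_similar) (auto simp: similar_mat_def)
    also have "\<dots> = (\<Prod>e\<leftarrow>diag_mat D. [:- e, 1:])"
      by (rule char_poly_upper_triangular[OF D(1)]) (use D in \<open>auto simp: diagonal_mat_def\<close>)
    finally have "proots (char_poly A) = mset (map ?lam [0..<n])"
      using D by (simp add: proots_prod_list_linear diag_mat_def del: map_map)
    then have "threshold_rank A \<tau> = size {#z \<in># image_mset ?lam (mset [0..<n]). z > \<tau>#}"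
      by (simp add: threshold_rank_def)
    also have "\<dots> = size (filter_mset (\<lambda>t. ?lam t > \<tau>) (mset_set {0..<n}))"
      by (simp add: filter_mset_image_mset)
    also have "\<dots> = card {t. t < n \<and> ?lam t > \<tau>}"
      by (simp add: filter_mset_mset_set)
    finally show ?thesis .
  qed
  moreover have "A $$ (i, j) = (\<Sum>t<n. ?lam t * (?u t i * ?u t j))" if "i < n" "j < n" for i j
    unfolding AU by (rule mult_diagonal_mat_transpose_index[OF U D that])
  ultimately show ?thesis using that[of ?lam ?u] by blast
qed

section \<open>Correlation along edges and between all pairs\<close>

text \<open>Each vertex has total weight one as a row and as a column, so a function of one endpoint
  sums to the same from either side. Used to bound Rayleigh quotients and to turn edge averages of
  vertex weights into vertex sums.\<close>

lemma symmetric_stochastic_sum: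
  fixes A :: "nat \<Rightarrow> nat \<Rightarrow> real"
  assumes sym: "\<And>i j. i < n \<Longrightarrow> j < n \<Longrightarrow> A i j = A j i"
    and row: "\<And>i. i < n \<Longrightarrow> (\<Sum>j<n. A i j) = 1"
  shows "(\<Sum>i<n. \<Sum>j<n. A i j * ((f i + f j) / 2)) = (\<Sum>i<n. f i)"
proof -
  have 1: "(\<Sum>i<n. \<Sum>j<n. A i j * f i) = (\<Sum>i<n. f i)"
    by (simp add: sum_distrib_right[symmetric] row)
  have "(\<Sum>i<n. \<Sum>j<n. A i j * f j) = (\<Sum>j<n. \<Sum>i<n. A j i * f j)"
    by (subst sum.swap) (intro sum.cong refl, simp add: sym)
  then have 2: "(\<Sum>i<n. \<Sum>j<n. A i j * f j) = (\<Sum>i<n. f i)" using 1 by simp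
  have "(\<Sum>i<n. \<Sum>j<n. A i j * ((f i + f j) / 2))
      = ((\<Sum>i<n. \<Sum>j<n. A i j * f i) + (\<Sum>i<n. \<Sum>j<n. A i j * f j)) / 2"
    unfolding sum.distrib[symmetric] sum_divide_distrib by (intro sum.cong refl) (simp add: field_simps)
  then show ?thesis using 1 2 by simp
qed

text \<open>The vertex weights are \<open>s i = (l i + m + \<delta>) powr (- 1/2)\<close>, where \<open>l i\<close> is the leverage score
  of \<open>i\<close> in the span of the top \<open>m\<close> eigenvectors. Reweighting makes the entries of the top part of
  the matrix at most \<open>1 / n\<close>, so that edge averages are bounded by averages over all pairs without a
  Cauchy-Schwarz step; this keeps the final bound linear in \<open>k\<close>. The offset \<open>m + \<delta>\<close> bounds the
  contribution of the small eigenvalues.\<close>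

lemma leverage_reweighting:
  fixes A :: "real mat" and \<tau> \<delta> :: real
  assumes A: "A \<in> carrier_mat n n" and sym: "transpose_mat A = A"
    and nonneg: "\<And>i j. i < n \<Longrightarrow> j < n \<Longrightarrow> 0 \<le> A $$ (i, j)"
    and row: "\<And>i. i < n \<Longrightarrow> (\<Sum>j<n. A $$ (i, j)) = 1"
    and n: "0 < n" and \<tau>: "0 \<le> \<tau>" and \<delta>: "0 < \<delta>"
  obtains s :: "nat \<Rightarrow> real" where "\<And>i. 0 < s i"
    and "(\<Sum>i<n. 1 / (s i)\<^sup>2) = real n * (2 * real (threshold_rank A \<tau>) + \<delta>)"
    and "\<And>M. (\<And>y. 0 \<le> (\<Sum>i<n. \<Sum>j<n. y i * y j * M i j)) \<Longrightarrow>
      (\<And>i j. i < n \<Longrightarrow> j < n \<Longrightarrow> 0 \<le> M i j) \<Longrightarrow> (\<And>i. i < n \<Longrightarrow> M i i \<le> 1) \<Longrightarrow>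
      (\<Sum>i<n. \<Sum>j<n. A $$ (i, j) * (s i * s j * M i j)) / n
        \<le> (\<Sum>i<n. \<Sum>j<n. M i j) / (real n)\<^sup>2 + \<tau> / (real (threshold_rank A \<tau>) + \<delta>)"
proof -
  have symA: "A $$ (i, j) = A $$ (j, i)" if "i < n" "j < n" for i j
    using arg_cong[OF sym, of "\<lambda>M. M $$ (i, j)"] A that by simp
  obtain u :: "nat \<Rightarrow> nat \<Rightarrow> real" and lam :: "nat \<Rightarrow> real"
    where Aij: "\<And>i j. i < n \<Longrightarrow> j < n \<Longrightarrow> A $$ (i, j) = (\<Sum>t<n. lam t * (u t i * u t j))"
    and res: "\<And>i j. i < n \<Longrightarrow> j < n \<Longrightarrow> (\<Sum>t<n. u t i * u t j) = of_bool (i = j)"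
    and orth: "\<And>t t'. t < n \<Longrightarrow> t' < n \<Longrightarrow> (\<Sum>i<n. u t i * u t' i) = of_bool (t = t')"
    and rank: "\<And>\<tau>. threshold_rank A \<tau> = card {t. t < n \<and> lam t > \<tau>}"
    by (rule symmetric_mat_spectral[OF A sym]) (rule that)
  \<comment> \<open>The Rayleigh quotient of a symmetric stochastic matrix is at most one, by AM-GM
    on each product \<open>u t i * u t j\<close>.\<close>
  have lam1: "lam t \<le> 1" if t: "t < n" for t
  proof -
    let ?t = "\<lambda>t' i j. lam t' * ((u t' i * u t i) * (u t' j * u t j))"
    have "(\<Sum>i<n. \<Sum>j<n. A $$ (i, j) * (u t i * u t j))
        = (\<Sum>i<n. \<Sum>j<n. \<Sum>t'<n. ?t t' i j)"
      by (intro sum.cong refl) (simp only: Aij lessThan_iff sum_distrib_right, intro sum.cong refl, simp only: mult_ac)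
    also have "\<dots> = (\<Sum>i<n. \<Sum>t'<n. \<Sum>j<n. ?t t' i j)"
      by (rule sum.cong[OF refl], rule sum.swap)
    also have "\<dots> = (\<Sum>t'<n. \<Sum>i<n. \<Sum>j<n. ?t t' i j)"
      by (rule sum.swap)
    also have "\<dots> = (\<Sum>t'<n. lam t' * ((\<Sum>i<n. u t' i * u t i) * (\<Sum>j<n. u t' j * u t j)))"
      by (simp add: sum_distrib_left[symmetric] sum_distrib_right[symmetric])
    also have "\<dots> = (\<Sum>t'<n. if t' = t then lam t else 0)"
      by (intro sum.cong refl) (use t in \<open>auto simp: orth\<close>)
    finally have "lam t = (\<Sum>i<n. \<Sum>j<n. A $$ (i, j) * (u t i * u t j))" using t by simp
    also have "\<dots> \<le> (\<Sum>i<n. \<Sum>j<n. A $$ (i, j) * (((u t i)\<^sup>2 + (u t j)\<^sup>2) / 2))"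
      by (intro sum_mono mult_left_mono nonneg) (use sum_squares_bound[of "u t _" "u t _"] in \<open>auto simp: field_simps\<close>)
    also have "\<dots> = (\<Sum>i<n. (u t i)\<^sup>2)"
      by (rule symmetric_stochastic_sum) (use symA row in auto)
    also have "\<dots> = 1" using orth[OF t t] by (simp add: power2_eq_square)
    finally show ?thesis .
  qed
  define T where "T = {t. t < n \<and> lam t > \<tau>}"
  have fT: "finite T" "T \<subseteq> {..<n}" by (auto simp: T_def)
  define m where "m = real (threshold_rank A \<tau>)"
  have m: "m = real (card T)" by (simp add: m_def T_def rank)
  \<comment> \<open>Scaled by \<open>n\<close> so that the average over the vertices is exactly
    \<open>m\<close>. The \<open>2 * m\<close> in the weight sum is one \<open>m\<close> from the
    scores and one from the offset.\<close>
  define l where "l i = real n * (\<Sum>t\<in>T. (u t i)\<^sup>2)" for i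
  have l0: "0 \<le> l i" for i by (simp add: l_def sum_nonneg)
  have pos: "0 < l i + m + \<delta>" for i using l0[of i] \<delta> by (simp add: m)
  define s where "s i = 1 / sqrt (l i + m + \<delta>)" for i
  have s0: "0 < s i" for i using pos[of i] by (simp add: s_def)
  have ss: "(s i)\<^sup>2 = 1 / (l i + m + \<delta>)" for i using pos[of i] by (simp add: s_def power_divide)
  have "(\<Sum>i<n. l i) = real n * (\<Sum>t\<in>T. \<Sum>i<n. (u t i)\<^sup>2)"
    unfolding l_def sum_distrib_left[symmetric] by (subst sum.swap) simp
  also have "(\<Sum>t\<in>T. \<Sum>i<n. (u t i)\<^sup>2) = (\<Sum>t\<in>T. 1)"
    by (intro sum.cong refl) (use fT orth in \<open>auto simp: power2_eq_square T_def\<close>)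
  finally have suml: "(\<Sum>i<n. l i) = real n * m" by (simp add: m)
  have sums: "(\<Sum>i<n. 1 / (s i)\<^sup>2) = real n * (2 * m + \<delta>)"
    by (simp add: ss sum.distrib suml algebra_simps)
  have main: "(\<Sum>i<n. \<Sum>j<n. A $$ (i, j) * (s i * s j * M i j)) / n
      \<le> (\<Sum>i<n. \<Sum>j<n. M i j) / (real n)\<^sup>2 + \<tau> / (m + \<delta>)"
    if psd: "\<And>y. 0 \<le> (\<Sum>i<n. \<Sum>j<n. y i * y j * M i j)"
      and M0: "\<And>i j. i < n \<Longrightarrow> j < n \<Longrightarrow> 0 \<le> M i j" and M1: "\<And>i. i < n \<Longrightarrow> M i i \<le> 1" for M
  proof -
    define N where "N i j = s i * s j * M i j" for i j
    \<comment> \<open>The quadratic form of the reweighted matrix at the eigenvector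
      \<open>u t\<close>. Its nonnegativity is what allows eigenvalues to be replaced by upper
      bounds.\<close>
    define Q where "Q t = (\<Sum>i<n. \<Sum>j<n. u t i * u t j * N i j)" for t
    have Q0: "0 \<le> Q t" for t
      using psd[of "\<lambda>i. u t i * s i"] by (simp add: Q_def N_def mult_ac)
    have swapQ: "(\<Sum>t\<in>X. c t * Q t) = (\<Sum>i<n. \<Sum>j<n. (\<Sum>t\<in>X. c t * (u t i * u t j)) * N i j)" for c X
    proof -
      have "(\<Sum>t\<in>X. c t * Q t) = (\<Sum>t\<in>X. \<Sum>i<n. \<Sum>j<n. c t * (u t i * u t j) * N i j)"
        by (simp add: Q_def sum_distrib_left mult.assoc)
      also have "\<dots> = (\<Sum>i<n. \<Sum>t\<in>X. \<Sum>j<n. c t * (u t i * u t j) * N i j)" by (rule sum.swap)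
      also have "\<dots> = (\<Sum>i<n. \<Sum>j<n. \<Sum>t\<in>X. c t * (u t i * u t j) * N i j)"
        by (rule sum.cong[OF refl], rule sum.swap)
      finally show ?thesis by (simp add: sum_distrib_right)
    qed
    have "(\<Sum>i<n. \<Sum>j<n. A $$ (i, j) * (s i * s j * M i j)) = (\<Sum>t<n. lam t * Q t)"
      unfolding swapQ by (intro sum.cong refl) (simp add: Aij N_def)
    \<comment> \<open>Top indices are charged \<open>(1 + \<tau>) * Q t\<close>, so that the
      \<open>\<tau>\<close> part becomes a full trace.\<close>
    also have "\<dots> \<le> (\<Sum>t<n. (if t \<in> T then 1 * Q t else 0) + \<tau> * Q t)"
    proof (rule sum_mono)
      fix t assume t: "t \<in> {..<n}"
      have "lam t * Q t \<le> 1 * Q t + \<tau> * Q t" if "t \<in> T"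
        using mult_right_mono[OF lam1 Q0, of t t] t \<tau> Q0[of t] by (simp add: add_increasing2)
      moreover have "lam t * Q t \<le> \<tau> * Q t" if "t \<notin> T"
        using that t Q0[of t] by (intro mult_right_mono) (auto simp: T_def)
      ultimately show "lam t * Q t \<le> (if t \<in> T then 1 * Q t else 0) + \<tau> * Q t" by simp
    qed
    also have "\<dots> = (\<Sum>t\<in>T. 1 * Q t) + \<tau> * (\<Sum>t<n. 1 * Q t)"
      using fT by (simp add: sum.distrib sum_distrib_left sum.If_cases Int_absorb1)
    \<comment> \<open>The eigenvectors form an orthonormal basis, so the sum is the trace of
      \<open>N\<close>; the offset in \<open>s\<close> bounds each diagonal entry.\<close>
    also have "(\<Sum>t<n. 1 * Q t) \<le> n / (m + \<delta>)"
    proof -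
      have "(\<Sum>t<n. 1 * Q t) = (\<Sum>i<n. \<Sum>j<n. if i = j then N i i else 0)"
        unfolding swapQ by (intro sum.cong refl) (auto simp: res)
      also have "\<dots> = (\<Sum>i<n. (s i)\<^sup>2 * M i i)" by (simp add: N_def power2_eq_square)
      also have "\<dots> \<le> (\<Sum>i<n. 1 / (m + \<delta>))"
      proof (rule sum_mono)
        fix i assume i: "i \<in> {..<n}"
        have "(s i)\<^sup>2 * M i i \<le> (s i)\<^sup>2 * 1" using M1 i by (intro mult_left_mono) auto
        also have "\<dots> \<le> 1 / (m + \<delta>)"
          unfolding ss using pos[of i] l0[of i] \<delta> by (simp add: m field_simps)
        finally show "(s i)\<^sup>2 * M i i \<le> 1 / (m + \<delta>)" .
      qed
      finally show ?thesis by simp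
    qed
    \<comment> \<open>Entrywise: the projection on the top eigenvectors has entries at most
      \<open>sqrt (l i * l j) / n\<close>, which the factor \<open>s i * s j\<close> reduces to at
      most \<open>1 / n\<close>.\<close>
    also have "(\<Sum>t\<in>T. 1 * Q t) \<le> (\<Sum>i<n. \<Sum>j<n. M i j) / n"
    proof -
      have "(\<Sum>t\<in>T. 1 * (u t i * u t j)) * N i j \<le> M i j / n" if ij: "i < n" "j < n" for i j
      proof -
        let ?w = "\<Sum>t\<in>T. u t i * u t j"
        have "(real n * ?w)\<^sup>2 \<le> (real n)\<^sup>2 * ((\<Sum>t\<in>T. (u t i)\<^sup>2) * (\<Sum>t\<in>T. (u t j)\<^sup>2))"
          unfolding power_mult_distrib by (intro mult_left_mono Cauchy_Schwarz_ineq_sum) simp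
        also have "\<dots> = l i * l j" by (simp add: l_def power2_eq_square)
        also have "\<dots> \<le> (l i + m + \<delta>) * (l j + m + \<delta>)"
          using l0 \<delta> by (intro mult_mono) (auto simp: m add_nonneg_nonneg)
        finally have "real n * ?w \<le> sqrt ((l i + m + \<delta>) * (l j + m + \<delta>))"
          by (rule real_le_rsqrt)
        then have "real n * ?w * (s i * s j) \<le> 1"
          using pos[of i] pos[of j] by (simp add: s_def real_sqrt_mult divide_le_eq)
        then have "real n * ?w * (s i * s j) * M i j \<le> 1 * M i j"
          by (intro mult_right_mono M0 ij)
        then show ?thesis using n by (simp add: N_def field_simps)
      qed
      then show ?thesis unfolding swapQ sum_divide_distrib by (intro sum_mono) auto
    qed
    finally have "(\<Sum>i<n. \<Sum>j<n. A $$ (i, j) * (s i * s j * M i j))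
        \<le> (\<Sum>i<n. \<Sum>j<n. M i j) / n + \<tau> * (n / (m + \<delta>))"
      using \<tau> by (simp add: mult_left_mono)
    then have "(\<Sum>i<n. \<Sum>j<n. A $$ (i, j) * (s i * s j * M i j)) / n
        \<le> ((\<Sum>i<n. \<Sum>j<n. M i j) / n + \<tau> * (n / (m + \<delta>))) / n"
      by (rule divide_right_mono) simp
    then show ?thesis using n by (simp add: add_divide_distrib power2_eq_square)
  qed
  show ?thesis
    by (rule that[of s]) (use s0 sums main in \<open>simp_all only: m_def\<close>)
qed

text \<open>\<open>K i j\<close> is of the order of a square root of \<open>M i j\<close>. AM-GM
  with weight \<open>\<theta> * s i * s j\<close> splits it into a term linear in
  \<open>M i j\<close>, to which the spectral bound applies, and a reciprocal term that sees only
  vertex weights. Linearity in \<open>M\<close> permits averaging over conditionings with one common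
  \<open>\<theta>\<close>.\<close>

lemma edge_correlation_bound:
  fixes A :: "real mat" and \<tau> \<delta> :: real
  assumes A: "A \<in> carrier_mat n n" and sym: "transpose_mat A = A"
    and nonneg: "\<And>i j. i < n \<Longrightarrow> j < n \<Longrightarrow> 0 \<le> A $$ (i, j)"
    and row: "\<And>i. i < n \<Longrightarrow> (\<Sum>j<n. A $$ (i, j)) = 1"
    and n: "0 < n" and \<tau>: "0 \<le> \<tau>" and \<delta>: "0 < \<delta>" and \<theta>: "0 < \<theta>"
    and psd: "\<And>y. 0 \<le> (\<Sum>i<n. \<Sum>j<n. y i * y j * M i j)"
    and M1: "\<And>i. i < n \<Longrightarrow> M i i \<le> 1"
    and K: "\<And>i j. i < n \<Longrightarrow> j < n \<Longrightarrow> (K i j)\<^sup>2 \<le> real k * M i j"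
    and M0: "\<And>i j. i < n \<Longrightarrow> j < n \<Longrightarrow> 0 \<le> M i j"
  shows "(\<Sum>i<n. \<Sum>j<n. A $$ (i, j) * K i j) / n
    \<le> (\<theta> * real k * ((\<Sum>i<n. \<Sum>j<n. M i j) / (real n)\<^sup>2 + \<tau> / (real (threshold_rank A \<tau>) + \<delta>))
      + (2 * real (threshold_rank A \<tau>) + \<delta>) / \<theta>) / 2"
proof -
  have symA: "A $$ (i, j) = A $$ (j, i)" if "i < n" "j < n" for i j
    using arg_cong[OF sym, of "\<lambda>M. M $$ (i, j)"] A that by simp
  obtain s where s0: "\<And>i. 0 < s i"
    and s1: "(\<Sum>i<n. 1 / (s i)\<^sup>2) = real n * (2 * real (threshold_rank A \<tau>) + \<delta>)"
    and s2: "(\<Sum>i<n. \<Sum>j<n. A $$ (i, j) * (s i * s j * M i j)) / n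
        \<le> (\<Sum>i<n. \<Sum>j<n. M i j) / (real n)\<^sup>2 + \<tau> / (real (threshold_rank A \<tau>) + \<delta>)"
    by (rule leverage_reweighting[OF A sym nonneg row n \<tau> \<delta>]) (use psd M0 M1 in \<open>auto intro: that\<close>)
  let ?F = "\<Sum>i<n. \<Sum>j<n. A $$ (i, j) * (s i * s j * M i j)"
  let ?h = "\<lambda>i j. (1 / (s i)\<^sup>2 + 1 / (s j)\<^sup>2) / 2"
  have K': "K i j \<le> \<theta> * real k / 2 * (s i * s j * M i j) + 1 / (2 * \<theta>) * ?h i j"
    if ij: "i < n" "j < n" for i j
  proof -
    define r where "r = s i * s j"
    have r: "0 < r" using s0 by (simp add: r_def)
    have "2 * K i j \<le> \<theta> * r * (K i j)\<^sup>2 + 1 / (\<theta> * r)"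
    proof -
      have "0 \<le> (\<theta> * r * K i j - 1)\<^sup>2 / (\<theta> * r)" using \<theta> r by simp
      also have "\<dots> = \<theta> * r * (K i j)\<^sup>2 + 1 / (\<theta> * r) - 2 * K i j"
        using \<theta> r by (simp add: field_simps power2_eq_square)
      finally show ?thesis by simp
    qed
    also have "\<theta> * r * (K i j)\<^sup>2 \<le> \<theta> * r * (real k * M i j)"
      using \<theta> r K[OF ij] by (intro mult_left_mono) auto
    also have "1 / (\<theta> * r) \<le> 1 / \<theta> * ?h i j"
    proof -
      have "2 * (1 / s i) * (1 / s j) \<le> (1 / s i)\<^sup>2 + (1 / s j)\<^sup>2" by (rule sum_squares_bound)
      then have "1 / r \<le> (1 / (s i)\<^sup>2 + 1 / (s j)\<^sup>2) / 2" by (simp add: r_def power_divide)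
      then have "1 / \<theta> * (1 / r) \<le> 1 / \<theta> * ?h i j"
        using \<theta> by (intro mult_left_mono) auto
      then show ?thesis by simp
    qed
    finally have "2 * K i j \<le> \<theta> * r * (real k * M i j) + 1 / \<theta> * ?h i j"
      by simp
    then have "K i j \<le> (\<theta> * r * (real k * M i j) + 1 / \<theta> * ?h i j) / 2"
      by simp
    then show ?thesis by (simp add: r_def add_divide_distrib mult_ac)
  qed
  have "(\<Sum>i<n. \<Sum>j<n. A $$ (i, j) * K i j)
      \<le> (\<Sum>i<n. \<Sum>j<n. A $$ (i, j) * (\<theta> * real k / 2 * (s i * s j * M i j)
          + 1 / (2 * \<theta>) * ?h i j))"
    by (intro sum_mono mult_left_mono K' nonneg) auto
  also have "\<dots> = \<theta> * real k / 2 * ?F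
      + 1 / (2 * \<theta>) * (\<Sum>i<n. \<Sum>j<n. A $$ (i, j) * ?h i j)"
    unfolding sum_distrib_left sum.distrib[symmetric] by (intro sum.cong refl) (simp only: distrib_left mult_ac)
  also have "(\<Sum>i<n. \<Sum>j<n. A $$ (i, j) * ?h i j) = (\<Sum>i<n. 1 / (s i)\<^sup>2)"
    by (rule symmetric_stochastic_sum) (use symA row in auto)
  finally have "(\<Sum>i<n. \<Sum>j<n. A $$ (i, j) * K i j) / n
      \<le> (\<theta> * real k / 2 * ?F
      + 1 / (2 * \<theta>) * (real n * (2 * real (threshold_rank A \<tau>) + \<delta>))) / n"
    unfolding s1 by (rule divide_right_mono) simp
  also have "\<dots> = \<theta> * real k / 2 * (?F / n)
      + 1 / (2 * \<theta>) * (2 * real (threshold_rank A \<tau>) + \<delta>)"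
    using n by (simp add: add_divide_distrib)
  also have "\<dots> \<le> \<theta> * real k / 2 * ((\<Sum>i<n. \<Sum>j<n. M i j) / (real n)\<^sup>2 + \<tau> / (real (threshold_rank A \<tau>) + \<delta>))
      + 1 / (2 * \<theta>) * (2 * real (threshold_rank A \<tau>) + \<delta>)"
    using \<theta> s2 by (intro add_right_mono mult_left_mono) auto
  finally show ?thesis by (simp add: add_divide_distrib mult_ac)
qed

section \<open>Covariances of pairwise distributions\<close>

text \<open>Models the variables conditioned on \<open>X_S = \<alpha>\<close>. There need not be a
  joint distribution of all variables: there are only pairwise tables that agree on marginals, and
  \<open>gram\<close>, the positivity inherited from the Lasserre vectors.\<close>

locale pairwise_distribution =
  fixes n k d :: nat
    and p :: "nat \<Rightarrow> nat \<Rightarrow> real"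
    and P :: "nat \<Rightarrow> nat \<Rightarrow> nat \<Rightarrow> nat \<Rightarrow> real"
    and u :: "nat \<Rightarrow> nat \<Rightarrow> nat \<Rightarrow> real"
  assumes P_nonneg: "0 \<le> P i j a b"
    and P_commute: "i < n \<Longrightarrow> j < n \<Longrightarrow> P i j a b = P j i b a"
    and P_marginal: "i < n \<Longrightarrow> j < n \<Longrightarrow> a < k \<Longrightarrow> (\<Sum>b<k. P i j a b) = p i a"
    and p_sum: "i < n \<Longrightarrow> (\<Sum>a<k. p i a) = 1"
    and gram: "i < n \<Longrightarrow> j < n \<Longrightarrow> a < k \<Longrightarrow> b < k \<Longrightarrow>
      P i j a b - p i a * p j b = (\<Sum>f<d. u i a f * u j b f)"
begin

definition C :: "nat \<Rightarrow> nat \<Rightarrow> nat \<Rightarrow> nat \<Rightarrow> real" where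
  "C i j a b = P i j a b - p i a * p j b"

text \<open>The normalisation of \<open>M\<close> is symmetric, which makes \<open>M\<close> positive semidefinite; \<open>D i j\<close> is the
  expected drop of the variance of \<open>i\<close> when \<open>j\<close> is revealed. They are related by AM-GM.\<close>

definition M :: "nat \<Rightarrow> nat \<Rightarrow> real" where
  "M i j = (\<Sum>a<k. \<Sum>b<k. (C i j a b)\<^sup>2 / (sqrt (p i a) * sqrt (p j b)))"

definition D :: "nat \<Rightarrow> nat \<Rightarrow> real" where
  "D i j = (\<Sum>a<k. \<Sum>b<k. (C i j a b)\<^sup>2 / p j b)"

lemma p_nonneg: assumes "i < n" "a < k" shows "0 \<le> p i a"
proof -
  have "0 \<le> (\<Sum>b<k. P i i a b)" by (intro sum_nonneg P_nonneg)
  then show ?thesis using P_marginal[of i i a] assms by simp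
qed

lemma P_le: assumes "i < n" "j < n" "a < k" "b < k" shows "P i j a b \<le> p i a"
proof -
  have "P i j a b \<le> (\<Sum>b<k. P i j a b)" by (rule member_le_sum) (use assms P_nonneg in auto)
  then show ?thesis using P_marginal assms by simp
qed

lemma P_le': "i < n \<Longrightarrow> j < n \<Longrightarrow> a < k \<Longrightarrow> b < k \<Longrightarrow> P i j a b \<le> p j b"
  using P_le[of j i b a] P_commute by simp

lemma C_eq_0: assumes "i < n" "j < n" "a < k" "b < k" "p i a = 0 \<or> p j b = 0" shows "C i j a b = 0"
  using P_le[OF assms(1-4)] P_le'[OF assms(1-4)] P_nonneg[of i j a b] assms(5) by (auto simp: C_def)

lemma C_commute: "i < n \<Longrightarrow> j < n \<Longrightarrow> C i j a b = C j i b a"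
  by (simp add: C_def P_commute[of i j] mult.commute)

lemma C_sum: assumes "i < n" "j < n" shows "(\<Sum>a<k. \<Sum>b<k. C i j a b) = 0"
  using assms by (simp add: C_def sum_subtractf P_marginal p_sum sum_distrib_left[symmetric])

lemma M_nonneg: "i < n \<Longrightarrow> j < n \<Longrightarrow> 0 \<le> M i j"
  unfolding M_def by (intro sum_nonneg divide_nonneg_nonneg mult_nonneg_nonneg) (auto simp: p_nonneg)

text \<open>The square of an inner product is an inner product of tensor squares, and the weight
  factorises over \<open>i\<close> and \<open>j\<close>. So \<open>M\<close> is the Gram matrix of
  the tensors \<open>T i\<close>, the weighted sums over the letters of \<open>u i a\<close>
  tensored with itself.\<close>

lemma M_psd: "0 \<le> (\<Sum>i<n. \<Sum>j<n. y i * y j * M i j)"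
proof -
  define w where "w i a = 1 / sqrt (p i a)" for i a
  define T where "T i f g = (\<Sum>a<k. w i a * (u i a f * u i a g))" for i f g
  have M: "M i j = (\<Sum>f<d. \<Sum>g<d. T i f g * T j f g)" if ij: "i < n" "j < n" for i j
  proof -
    let ?t = "\<lambda>a b f g. (w i a * (u i a f * u i a g)) * (w j b * (u j b f * u j b g))"
    have "(C i j a b)\<^sup>2 / (sqrt (p i a) * sqrt (p j b))
        = (\<Sum>f<d. \<Sum>g<d. ?t a b f g)"
      if "a < k" "b < k" for a b
    proof -
      have "(C i j a b)\<^sup>2 / (sqrt (p i a) * sqrt (p j b))
          = w i a * w j b * ((\<Sum>f<d. u i a f * u j b f) * (\<Sum>g<d. u i a g * u j b g))"
        unfolding C_def gram[OF ij that] by (simp add: w_def power2_eq_square)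
      also have "\<dots> = (\<Sum>f<d. \<Sum>g<d. w i a * w j b * ((u i a f * u j b f) * (u i a g * u j b g)))"
        unfolding sum_product by (simp only: sum_distrib_left)
      finally show ?thesis by (simp only: mult_ac)
    qed
    then have "M i j = (\<Sum>a<k. \<Sum>b<k. \<Sum>f<d. \<Sum>g<d. ?t a b f g)"
      by (simp add: M_def)
    also have "\<dots> = (\<Sum>a<k. \<Sum>f<d. \<Sum>b<k. \<Sum>g<d. ?t a b f g)"
      by (rule sum.cong[OF refl], rule sum.swap)
    also have "\<dots> = (\<Sum>f<d. \<Sum>a<k. \<Sum>b<k. \<Sum>g<d. ?t a b f g)"
      by (rule sum.swap)
    also have "\<dots> = (\<Sum>f<d. \<Sum>a<k. \<Sum>g<d. \<Sum>b<k. ?t a b f g)"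
      by (rule sum.cong[OF refl], rule sum.cong[OF refl], rule sum.swap)
    also have "\<dots> = (\<Sum>f<d. \<Sum>g<d. \<Sum>a<k. \<Sum>b<k. ?t a b f g)"
      by (rule sum.cong[OF refl], rule sum.swap)
    finally show ?thesis unfolding T_def sum_product .
  qed
  let ?t = "\<lambda>i j f g. (y i * T i f g) * (y j * T j f g)"
  have "(\<Sum>i<n. \<Sum>j<n. y i * y j * M i j) = (\<Sum>i<n. \<Sum>j<n. \<Sum>f<d. \<Sum>g<d. ?t i j f g)"
    by (intro sum.cong[OF refl]) (simp only: M lessThan_iff sum_distrib_left mult_ac)
  also have "\<dots> = (\<Sum>i<n. \<Sum>f<d. \<Sum>j<n. \<Sum>g<d. ?t i j f g)"
    by (rule sum.cong[OF refl], rule sum.swap)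
  also have "\<dots> = (\<Sum>f<d. \<Sum>i<n. \<Sum>j<n. \<Sum>g<d. ?t i j f g)"
    by (rule sum.swap)
  also have "\<dots> = (\<Sum>f<d. \<Sum>i<n. \<Sum>g<d. \<Sum>j<n. ?t i j f g)"
    by (rule sum.cong[OF refl], rule sum.cong[OF refl], rule sum.swap)
  also have "\<dots> = (\<Sum>f<d. \<Sum>g<d. \<Sum>i<n. \<Sum>j<n. ?t i j f g)"
    by (rule sum.cong[OF refl], rule sum.swap)
  also have "\<dots> = (\<Sum>f<d. \<Sum>g<d. (\<Sum>i<n. y i * T i f g)\<^sup>2)"
    by (simp only: sum_product power2_eq_square)
  finally show ?thesis by (simp add: sum_nonneg)
qed

lemma sum_sqrt_le: assumes i: "i < n" shows "(\<Sum>a<k. sqrt (p i a)) \<le> sqrt (real k)"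
proof (rule real_le_rsqrt)
  have "(\<Sum>a<k. 1 * sqrt (p i a))\<^sup>2 \<le> (\<Sum>a<k. 1\<^sup>2) * (\<Sum>a<k. (sqrt (p i a))\<^sup>2)"
    by (rule Cauchy_Schwarz_ineq_sum)
  also have "(\<Sum>a<k. (sqrt (p i a))\<^sup>2) = 1" using i p_sum p_nonneg by simp
  finally show "(\<Sum>a<k. sqrt (p i a))\<^sup>2 \<le> real k" by simp
qed

text \<open>Cauchy-Schwarz with the weights \<open>q a b\<close>. Their total mass is a product of
  two sums of at most \<open>sqrt k\<close> each, so one factor \<open>k\<close> is lost where the
  unweighted inequality loses \<open>k^2\<close>.\<close>

lemma abs_C_sum_le: assumes ij: "i < n" "j < n"
  shows "(\<Sum>a<k. \<Sum>b<k. \<bar>C i j a b\<bar>)\<^sup>2 \<le> real k * M i j"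
proof -
  define q where "q a b = sqrt (p i a) * sqrt (p j b)" for a b
  have q0: "0 \<le> q a b" if "a < k" "b < k" for a b using that p_nonneg ij by (simp add: q_def)
  let ?X = "{..<k} \<times> {..<k}"
  \<comment> \<open>Dividing and multiplying by \<open>sqrt (q a b)\<close> is harmless at weight
    zero because the covariance vanishes there.\<close>
  have eq: "(\<Sum>a<k. \<Sum>b<k. \<bar>C i j a b\<bar>) = (\<Sum>x\<in>?X. (\<bar>case_prod (C i j) x\<bar> / sqrt (case_prod q x)) * sqrt (case_prod q x))"
    unfolding sum.cartesian_product
    by (rule sum.cong) (auto simp: q_def C_eq_0[OF ij])
  have "(\<Sum>a<k. \<Sum>b<k. \<bar>C i j a b\<bar>)\<^sup>2
      \<le> (\<Sum>x\<in>?X. (\<bar>case_prod (C i j) x\<bar> / sqrt (case_prod q x))\<^sup>2) * (\<Sum>x\<in>?X. (sqrt (case_prod q x))\<^sup>2)"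
    unfolding eq by (rule Cauchy_Schwarz_ineq_sum)
  also have "(\<Sum>x\<in>?X. (\<bar>case_prod (C i j) x\<bar> / sqrt (case_prod q x))\<^sup>2) = M i j"
  proof -
    have "(\<bar>C i j a b\<bar> / sqrt (q a b))\<^sup>2 = (C i j a b)\<^sup>2 / (sqrt (p i a) * sqrt (p j b))"
      if "a < k" "b < k" for a b
      using q0[OF that] by (simp only: power_divide power2_abs real_sqrt_pow2) (simp only: q_def)
    then have "M i j = (\<Sum>a<k. \<Sum>b<k. (\<bar>C i j a b\<bar> / sqrt (q a b))\<^sup>2)"
      unfolding M_def by (intro sum.cong refl) auto
    then show ?thesis by (simp only: sum.cartesian_product case_prod_unfold)
  qed
  also have "(\<Sum>x\<in>?X. (sqrt (case_prod q x))\<^sup>2) = (\<Sum>a<k. \<Sum>b<k. q a b)"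
    unfolding sum.cartesian_product by (rule sum.cong) (auto simp: q0)
  also have "\<dots> = (\<Sum>a<k. sqrt (p i a)) * (\<Sum>b<k. sqrt (p j b))"
    unfolding q_def sum_product ..
  also have "M i j * \<dots> \<le> M i j * (sqrt (real k) * sqrt (real k))"
    by (intro mult_left_mono mult_mono sum_sqrt_le ij M_nonneg sum_nonneg) (auto simp: p_nonneg ij)
  finally show ?thesis by (simp add: mult.commute)
qed

text \<open>The law of total variance: the expected sum of squared conditional probabilities of
  \<open>i\<close> given \<open>j\<close>, minus the unconditional sum of squares. Differences of
  this shape telescope as variables are revealed.\<close>

lemma D_eq: assumes ij: "i < n" "j < n"
  shows "D i j = (\<Sum>a<k. \<Sum>b<k. (P i j a b)\<^sup>2 / p j b) - (\<Sum>a<k. (p i a)\<^sup>2)"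
proof -
  have "(C i j a b)\<^sup>2 / p j b = (P i j a b)\<^sup>2 / p j b - 2 * p i a * P i j a b + (p i a)\<^sup>2 * p j b"
    if "a < k" "b < k" for a b
  proof (cases "p j b = 0")
    case True
    then have "P i j a b = 0" using P_le'[OF ij that] P_nonneg[of i j a b] by simp
    with True show ?thesis by simp
  next
    case False
    then show ?thesis by (simp add: C_def field_simps power2_eq_square)
  qed
  then have "D i j = (\<Sum>a<k. \<Sum>b<k. (P i j a b)\<^sup>2 / p j b - 2 * p i a * P i j a b + (p i a)\<^sup>2 * p j b)"
    by (simp add: D_def)
  also have "\<dots> = (\<Sum>a<k. (\<Sum>b<k. (P i j a b)\<^sup>2 / p j b) - 2 * p i a * p i a + (p i a)\<^sup>2)"
    by (intro sum.cong refl)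
      (simp add: sum.distrib sum_subtractf sum_distrib_left[symmetric] P_marginal ij p_sum)
  finally show ?thesis by (simp add: sum_subtractf sum.distrib power2_eq_square sum_negf sum_distrib_left[symmetric])
qed

lemma D_le_1: assumes ij: "i < n" "j < n" shows "D i j \<le> 1"
proof -
  have "(\<Sum>a<k. \<Sum>b<k. (P i j a b)\<^sup>2 / p j b) \<le> (\<Sum>a<k. \<Sum>b<k. P i j a b)"
  proof (intro sum_mono)
    fix a b assume "a \<in> {..<k}" "b \<in> {..<k}"
    then have ab: "a < k" "b < k" by auto
    show "(P i j a b)\<^sup>2 / p j b \<le> P i j a b"
    proof (cases "p j b = 0")
      case False
      then have "0 < p j b" using p_nonneg[of j b] ij ab by simp
      then show ?thesis
        using mult_left_mono[OF P_le'[OF ij ab] P_nonneg[of i j a b]]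
        by (simp add: divide_le_eq power2_eq_square)
    qed (simp add: P_nonneg)
  qed
  also have "\<dots> = 1" using ij by (simp add: P_marginal p_sum)
  finally show ?thesis unfolding D_eq[OF ij] using sum_nonneg[of "{..<k}" "\<lambda>a. (p i a)\<^sup>2"] by simp
qed

lemma M_le_D: assumes ij: "i < n" "j < n" shows "M i j \<le> (D i j + D j i) / 2"
proof -
  have "(C i j a b)\<^sup>2 / (sqrt (p i a) * sqrt (p j b)) \<le> (C i j a b)\<^sup>2 / p j b / 2 + (C j i b a)\<^sup>2 / p i a / 2"
    if ab: "a < k" "b < k" for a b
  proof (cases "p i a = 0 \<or> p j b = 0")
    case True
    then show ?thesis using C_eq_0[OF ij ab] C_commute[OF ij, of a b] by simp
  next
    case False
    then have pos: "0 < p i a" "0 < p j b"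
      using p_nonneg[of i a] p_nonneg[of j b] ij ab by auto
    have "2 * (1 / sqrt (p i a)) * (1 / sqrt (p j b)) \<le> (1 / sqrt (p i a))\<^sup>2 + (1 / sqrt (p j b))\<^sup>2"
      by (rule sum_squares_bound)
    then have "1 / (sqrt (p i a) * sqrt (p j b)) \<le> (1 / p i a + 1 / p j b) / 2"
      using pos by (simp add: power_divide)
    then have "(C i j a b)\<^sup>2 * (1 / (sqrt (p i a) * sqrt (p j b))) \<le> (C i j a b)\<^sup>2 * ((1 / p i a + 1 / p j b) / 2)"
      by (intro mult_left_mono) auto
    then show ?thesis using C_commute[OF ij, of a b] by (simp add: field_simps)
  qed
  then have "M i j \<le> (\<Sum>a<k. \<Sum>b<k. (C i j a b)\<^sup>2 / p j b / 2 + (C j i b a)\<^sup>2 / p i a / 2)"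
    unfolding M_def by (intro sum_mono) auto
  also have "\<dots> = D i j / 2 + (\<Sum>a<k. \<Sum>b<k. (C j i b a)\<^sup>2 / p i a) / 2"
    by (simp add: sum.distrib D_def sum_divide_distrib)
  also have "(\<Sum>a<k. \<Sum>b<k. (C j i b a)\<^sup>2 / p i a) = D j i"
    unfolding D_def by (rule sum.swap)
  finally show ?thesis by simp
qed

lemma M_diag_le_1: "i < n \<Longrightarrow> M i i \<le> 1"
  using M_le_D[of i i] D_le_1[of i i] by simp

lemma sum_M_le_sum_D: "(\<Sum>i<n. \<Sum>j<n. M i j) \<le> (\<Sum>i<n. \<Sum>j<n. D i j)"
proof -
  have "(\<Sum>i<n. \<Sum>j<n. M i j) \<le> (\<Sum>i<n. \<Sum>j<n. D i j / 2 + D j i / 2)"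
    by (intro sum_mono) (use M_le_D in \<open>auto simp: add_divide_distrib\<close>)
  also have "\<dots> = (\<Sum>i<n. \<Sum>j<n. D i j) / 2 + (\<Sum>i<n. \<Sum>j<n. D j i) / 2"
    by (simp add: sum.distrib sum_divide_distrib)
  also have "(\<Sum>i<n. \<Sum>j<n. D j i) = (\<Sum>i<n. \<Sum>j<n. D i j)" by (rule sum.swap)
  finally show ?thesis by simp
qed

text \<open>The covariances of the full table sum to zero, so the part on \<open>R\<close> is half
  of its difference with the part outside \<open>R\<close>.\<close>

lemma sum_C_le:
  assumes ij: "i < n" "j < n" and R: "R \<subseteq> {..<k} \<times> {..<k}"
  shows "(\<Sum>(a, b)\<in>R. C i j a b) \<le> (\<Sum>a<k. \<Sum>b<k. \<bar>C i j a b\<bar>) / 2"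
proof -
  let ?X = "{..<k} \<times> {..<k}" and ?c = "case_prod (C i j)"
  have fR: "finite R" using R finite_subset by blast
  have "sum ?c R + sum ?c (?X - R) = 0"
    using C_sum[OF ij] R by (simp add: sum.cartesian_product sum.subset_diff[of R ?X] add.commute case_prod_unfold)
  then have "2 * sum ?c R = sum ?c R + sum (\<lambda>x. - ?c x) (?X - R)" by (simp add: sum_negf)
  also have "\<dots> \<le> sum (\<lambda>x. \<bar>?c x\<bar>) R + sum (\<lambda>x. \<bar>?c x\<bar>) (?X - R)"
    by (intro add_mono sum_mono) auto
  also have "\<dots> = (\<Sum>a<k. \<Sum>b<k. \<bar>C i j a b\<bar>)"
    using R by (simp add: sum.cartesian_product sum.subset_diff[of R ?X] add.commute case_prod_unfold)
  finally show ?thesis by simp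
qed

end

section \<open>Conditioning a Lasserre solution\<close>

lemma prob_sum_fibres:
  assumes "finite B" and "\<And>x. x \<in> set_pmf M \<Longrightarrow> f x \<in> B"
  shows "measure_pmf.prob M {x. E x} = (\<Sum>b\<in>B. measure_pmf.prob M {x. E x \<and> f x = b})"
proof -
  have "measure_pmf.prob M {x. E x} = measure_pmf.prob M (\<Union>b\<in>B. {x. E x \<and> f x = b})"
    by (rule measure_prob_cong_0) (use assms in \<open>auto simp: set_pmf_iff\<close>)
  also have "\<dots> = (\<Sum>b\<in>B. measure_pmf.prob M {x. E x \<and> f x = b})"
    by (rule measure_pmf.finite_measure_finite_Union) (use assms in \<open>auto simp: disjoint_family_on_def\<close>)
  finally show ?thesis .
qed

lemma finite_assignments: "finite S \<Longrightarrow> finite (assignments S k)"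
  by (simp add: assignments_def finite_PiE)

text \<open>If \<open>i\<close> already lies in \<open>S\<close>, an update with another letter
  would change the condition on \<open>S\<close>. The second assumption excludes this; the conflict
  is treated separately, as an empty event.\<close>

lemma restrict_insert_eq_iff:
  assumes "\<alpha> \<in> assignments S k" and "i \<notin> S \<or> \<alpha> i = a"
  shows "restrict x (insert i S) = \<alpha>(i := a) \<longleftrightarrow> restrict x S = \<alpha> \<and> x i = a"
  using assms by (auto simp: assignments_def fun_eq_iff restrict_def PiE_def extensional_def)

lemma assignments_insert_bij:
  assumes "j \<notin> S"
  shows "bij_betw (\<lambda>(\<alpha>, b). \<alpha>(j := b)) (assignments S k \<times> {..<k}) (assignments (insert j S) k)"
  unfolding assignments_def
proof (rule bij_betwI[where g = "\<lambda>\<beta>. (restrict \<beta> S, \<beta> j)"])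
  show "(\<lambda>(\<alpha>, b). \<alpha>(j := b)) \<in> (S \<rightarrow>\<^sub>E {..<k}) \<times> {..<k} \<rightarrow> (insert j S \<rightarrow>\<^sub>E {..<k})"
    by (auto simp: PiE_def extensional_def)
  show "(\<lambda>\<beta>. (restrict \<beta> S, \<beta> j)) \<in> (insert j S \<rightarrow>\<^sub>E {..<k}) \<rightarrow> (S \<rightarrow>\<^sub>E {..<k}) \<times> {..<k}"
    by (auto simp: PiE_def)
  show "(restrict (case x of (\<alpha>, b) \<Rightarrow> \<alpha>(j := b)) S, (case x of (\<alpha>, b) \<Rightarrow> \<alpha>(j := b)) j) = x"
    if "x \<in> (S \<rightarrow>\<^sub>E {..<k}) \<times> {..<k}" for x
    using that assms by (auto simp: fun_eq_iff restrict_def PiE_def extensional_def)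
  show "(case (restrict y S, y j) of (\<alpha>, b) \<Rightarrow> \<alpha>(j := b)) = y" if "y \<in> insert j S \<rightarrow>\<^sub>E {..<k}" for y
    using that by (auto simp: fun_eq_iff restrict_def PiE_def extensional_def)
qed

lemma restrict_assignments: "x \<in> assignments S k \<Longrightarrow> restrict x S \<in> assignments S k"
  by (auto simp: assignments_def)

lemma small_sets_mono: "T \<in> small_sets n r \<Longrightarrow> S \<subseteq> T \<Longrightarrow> S \<in> small_sets n r"
  unfolding small_sets_def
  by (auto dest: card_mono[OF finite_subset[OF _ finite_lessThan]] intro: order_trans)

lemma small_sets_finite: "T \<in> small_sets n r \<Longrightarrow> finite T"
  unfolding small_sets_def using finite_subset by auto

locale lasserre_relaxation =
  fixes n k r :: nat and L :: lasserre
  assumes solution: "lasserre_solution n k r L"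
begin

abbreviation pr :: "nat set \<Rightarrow> (nat \<Rightarrow> nat) set \<Rightarrow> real" where
  "pr T \<equiv> measure_pmf.prob (local_dist L T)"

text \<open>Two variables are kept in reserve, so that the pair of any constraint can join a seed
  and still has a local distribution.\<close>

definition seeds :: "nat set set" where
  "seeds = {S. S \<subseteq> {..<n} \<and> card S \<le> r}"

text \<open>Joint, not conditional, probabilities: the summation identities between
  \<open>Z\<close>, \<open>G\<close> and \<open>J\<close> then hold at assignments of probability
  zero as well.\<close>

definition Z :: "nat set \<Rightarrow> (nat \<Rightarrow> nat) \<Rightarrow> real" where
  "Z S \<alpha> = pr S {x. restrict x S = \<alpha>}"

definition G :: "nat set \<Rightarrow> (nat \<Rightarrow> nat) \<Rightarrow> nat \<Rightarrow> nat \<Rightarrow> real" where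
  "G S \<alpha> i a = pr (insert i S) {x. restrict x S = \<alpha> \<and> x i = a}"

definition J :: "nat set \<Rightarrow> (nat \<Rightarrow> nat) \<Rightarrow> nat \<Rightarrow> nat \<Rightarrow> nat \<Rightarrow> nat \<Rightarrow> real" where
  "J S \<alpha> i j a b = pr (insert i (insert j S)) {x. restrict x S = \<alpha> \<and> x i = a \<and> x j = b}"

lemma support: "T \<in> small_sets n r \<Longrightarrow> x \<in> set_pmf (local_dist L T) \<Longrightarrow> x \<in> assignments T k"
  using solution unfolding lasserre_solution_def by blast

lemma support_less: "T \<in> small_sets n r \<Longrightarrow> x \<in> set_pmf (local_dist L T) \<Longrightarrow> i \<in> T \<Longrightarrow> x i < k"
  using support unfolding assignments_def by (auto dest: PiE_mem)

lemma pr_marginal: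
  assumes T: "T' \<in> small_sets n r" "T \<subseteq> T'" and Q: "\<And>x. Q (restrict x T) = Q x"
  shows "pr T' {x. Q x} = pr T {x. Q x}"
proof -
  have "T \<in> small_sets n r" using T by (rule small_sets_mono)
  then have "map_pmf (\<lambda>x. restrict x (T' \<inter> T)) (local_dist L T') = map_pmf (\<lambda>x. restrict x (T' \<inter> T)) (local_dist L T)"
    using solution T(1) unfolding lasserre_solution_def by blast
  moreover have "T' \<inter> T = T" using T(2) by blast
  ultimately have "measure_pmf.prob (map_pmf (\<lambda>x. restrict x T) (local_dist L T')) {x. Q x}
    = measure_pmf.prob (map_pmf (\<lambda>x. restrict x T) (local_dist L T)) {x. Q x}" by simp
  then show ?thesis by (simp add: measure_map_pmf vimage_def Q)
qed

lemma lvec_inner: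
  assumes "S \<union> T \<in> small_sets n r" "\<alpha> \<in> assignments S k" "\<beta> \<in> assignments T k"
  shows "(\<Sum>f<vec_dim L. lvec L S \<alpha> $ f * lvec L T \<beta> $ f)
    = pr (S \<union> T) {x. restrict x S = \<alpha> \<and> restrict x T = \<beta>}"
proof -
  have S: "S \<in> small_sets n r" "T \<in> small_sets n r" using small_sets_mono[OF assms(1)] by auto
  have "lvec L T \<beta> \<in> carrier_vec (vec_dim L)"
    using solution S(2) assms(3) unfolding lasserre_solution_def by blast
  moreover have "lvec L S \<alpha> \<bullet> lvec L T \<beta> = pr (S \<union> T) {x. restrict x S = \<alpha> \<and> restrict x T = \<beta>}"
    using solution S assms unfolding lasserre_solution_def by blast
  ultimately show ?thesis by (simp add: scalar_prod_def lessThan_atLeast0)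
qed

lemma seeds_finite: "S \<in> seeds \<Longrightarrow> finite S"
  unfolding seeds_def using finite_subset by auto

lemma seeds_small: "S \<in> seeds \<Longrightarrow> i < n \<Longrightarrow> j < n \<Longrightarrow> insert i (insert j S) \<in> small_sets n r"
  using seeds_finite[of S] by (auto simp: seeds_def small_sets_def card_insert_if)

lemma seeds_small1: "S \<in> seeds \<Longrightarrow> i < n \<Longrightarrow> insert i S \<in> small_sets n r"
  using seeds_small[of S i i] by simp

lemma seeds_small0: "S \<in> seeds \<Longrightarrow> S \<in> small_sets n r"
  by (auto simp: seeds_def small_sets_def)

lemma J_nonneg: "0 \<le> J S \<alpha> i j a b" and G_nonneg: "0 \<le> G S \<alpha> i a" and Z_nonneg: "0 \<le> Z S \<alpha>"
  by (simp_all add: J_def G_def Z_def)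

lemma J_commute: "J S \<alpha> i j a b = J S \<alpha> j i b a"
  unfolding J_def by (subst insert_commute) (metis (no_types, lifting) conj_commute)

lemma J_sum: assumes S: "S \<in> seeds" and ij: "i < n" "j < n"
  shows "(\<Sum>b<k. J S \<alpha> i j a b) = G S \<alpha> i a"
proof -
  let ?T = "insert i (insert j S)"
  note T = seeds_small[OF S ij]
  have "G S \<alpha> i a = pr ?T {x. restrict x S = \<alpha> \<and> x i = a}"
    unfolding G_def by (rule pr_marginal[symmetric, OF T])
      (auto simp: Int_absorb2 Int_absorb1 subset_insertI)
  also have "\<dots> = (\<Sum>b<k. pr ?T {x. (restrict x S = \<alpha> \<and> x i = a) \<and> x j = b})"
    by (rule prob_sum_fibres) (use support_less[OF T] in auto)
  finally show ?thesis by (simp add: J_def)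
qed

lemma G_sum: assumes T: "insert i S \<in> small_sets n r"
  shows "(\<Sum>a<k. G S \<alpha> i a) = Z S \<alpha>"
proof -
  have "Z S \<alpha> = pr (insert i S) {x. restrict x S = \<alpha>}"
    unfolding Z_def by (rule pr_marginal[symmetric, OF T]) auto
  also have "\<dots> = (\<Sum>a<k. pr (insert i S) {x. restrict x S = \<alpha> \<and> x i = a})"
    by (rule prob_sum_fibres) (use support_less[OF T] in auto)
  finally show ?thesis by (simp add: G_def)
qed

lemma Z_sum: assumes S: "S \<in> small_sets n r" shows "(\<Sum>\<alpha>\<in>assignments S k. Z S \<alpha>) = 1"
proof -
  have "1 = pr S {x. True}" by simp
  also have "\<dots> = (\<Sum>\<alpha>\<in>assignments S k. pr S {x. True \<and> restrict x S = \<alpha>})"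
    by (rule prob_sum_fibres)
      (use support[OF S] small_sets_finite[OF S] in \<open>auto simp: finite_assignments restrict_assignments\<close>)
  finally show ?thesis by (simp add: Z_def)
qed

section \<open>Conditional marginals and covariance vectors\<close>

definition cp :: "nat set \<Rightarrow> (nat \<Rightarrow> nat) \<Rightarrow> nat \<Rightarrow> nat \<Rightarrow> real" where
  "cp S \<alpha> i a = G S \<alpha> i a / Z S \<alpha>"

definition cP :: "nat set \<Rightarrow> (nat \<Rightarrow> nat) \<Rightarrow> nat \<Rightarrow> nat \<Rightarrow> nat \<Rightarrow> nat \<Rightarrow> real" where
  "cP S \<alpha> i j a b = J S \<alpha> i j a b / Z S \<alpha>"

text \<open>The vector of the event that \<open>X_S = \<alpha>\<close> and \<open>X_i = a\<close>.
  For \<open>i\<close> in \<open>S\<close> with another letter this event is empty, while the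
  updated function would name a different event; hence the zero vector.\<close>

definition cv :: "nat set \<Rightarrow> (nat \<Rightarrow> nat) \<Rightarrow> nat \<Rightarrow> nat \<Rightarrow> nat \<Rightarrow> real" where
  "cv S \<alpha> i a f = (if i \<notin> S \<or> \<alpha> i = a then lvec L (insert i S) (\<alpha>(i := a)) $ f else 0)"

text \<open>The component orthogonal to the vector of \<open>X_S = \<alpha>\<close>. That vector has
  squared length \<open>Z S \<alpha>\<close> and inner product \<open>G S \<alpha> i a\<close> with
  \<open>cv\<close>, so the coefficient to remove is the conditional marginal.\<close>

definition cu :: "nat set \<Rightarrow> (nat \<Rightarrow> nat) \<Rightarrow> nat \<Rightarrow> nat \<Rightarrow> nat \<Rightarrow> real" where
  "cu S \<alpha> i a f = (cv S \<alpha> i a f - cp S \<alpha> i a * lvec L S \<alpha> $ f) / sqrt (Z S \<alpha>)"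

lemma assignments_upd:
  "\<alpha> \<in> assignments S k \<Longrightarrow> a < k \<Longrightarrow> \<alpha>(i := a) \<in> assignments (insert i S) k"
  by (auto simp: assignments_def PiE_def extensional_def)

lemma cv_inner:
  assumes S: "S \<in> seeds" and \<alpha>: "\<alpha> \<in> assignments S k" and ij: "i < n" "j < n" and ab: "a < k" "b < k"
  shows "(\<Sum>f<vec_dim L. cv S \<alpha> i a f * cv S \<alpha> j b f) = J S \<alpha> i j a b"
proof (cases "(i \<notin> S \<or> \<alpha> i = a) \<and> (j \<notin> S \<or> \<alpha> j = b)")
  case True
  have U: "insert i S \<union> insert j S = insert i (insert j S)" by auto
  have "(\<Sum>f<vec_dim L. cv S \<alpha> i a f * cv S \<alpha> j b f)
    = pr (insert i S \<union> insert j S) {x. restrict x (insert i S) = \<alpha>(i := a) \<and> restrict x (insert j S) = \<alpha>(j := b)}"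
    using True lvec_inner[of "insert i S" "insert j S" "\<alpha>(i := a)" "\<alpha>(j := b)"]
      seeds_small[OF S ij] assignments_upd[OF \<alpha>] ab by (simp add: cv_def U del: Un_insert_left Un_insert_right)
  also have "{x. restrict x (insert i S) = \<alpha>(i := a) \<and> restrict x (insert j S) = \<alpha>(j := b)}
      = {x. restrict x S = \<alpha> \<and> x i = a \<and> x j = b}"
    using True restrict_insert_eq_iff[OF \<alpha>] by auto
  finally show ?thesis unfolding J_def U .
next
  case False
  then have e: "{x. restrict x S = \<alpha> \<and> x i = a \<and> x j = b} = {}" by auto
  show ?thesis unfolding J_def e using False by (auto simp: cv_def)
qed

lemma cv_inner_lvec:
  assumes S: "S \<in> seeds" and \<alpha>: "\<alpha> \<in> assignments S k" and i: "i < n" and a: "a < k"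
  shows "(\<Sum>f<vec_dim L. cv S \<alpha> i a f * lvec L S \<alpha> $ f) = G S \<alpha> i a"
proof (cases "i \<notin> S \<or> \<alpha> i = a")
  case True
  have U: "insert i S \<union> S = insert i S" by auto
  have "(\<Sum>f<vec_dim L. cv S \<alpha> i a f * lvec L S \<alpha> $ f)
    = pr (insert i S \<union> S) {x. restrict x (insert i S) = \<alpha>(i := a) \<and> restrict x S = \<alpha>}"
    using True lvec_inner[of "insert i S" S "\<alpha>(i := a)" \<alpha>]
      seeds_small1[OF S i] assignments_upd[OF \<alpha>] a \<alpha> by (simp add: cv_def U)
  also have "{x. restrict x (insert i S) = \<alpha>(i := a) \<and> restrict x S = \<alpha>} = {x. restrict x S = \<alpha> \<and> x i = a}"
    using True restrict_insert_eq_iff[OF \<alpha>] by auto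
  finally show ?thesis by (simp add: G_def U)
next
  case False
  then have e: "{x. restrict x S = \<alpha> \<and> x i = a} = {}" by auto
  show ?thesis unfolding G_def e using False by (auto simp: cv_def)
qed

lemma lvec_norm:
  assumes S: "S \<in> seeds" and \<alpha>: "\<alpha> \<in> assignments S k"
  shows "(\<Sum>f<vec_dim L. lvec L S \<alpha> $ f * lvec L S \<alpha> $ f) = Z S \<alpha>"
  using lvec_inner[of S S \<alpha> \<alpha>] seeds_small0[OF S] \<alpha> by (simp add: Z_def)

text \<open>Inner products of the orthogonal components are \<open>J - G * G / Z\<close>; divided by
  \<open>Z\<close> they become the conditional covariances.\<close>

lemma conditional_pairwise_distribution:
  assumes S: "S \<in> seeds" and \<alpha>: "\<alpha> \<in> assignments S k" and Z: "0 < Z S \<alpha>"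
  shows "pairwise_distribution n k (vec_dim L) (cp S \<alpha>) (cP S \<alpha>) (cu S \<alpha>)"
proof
  show "0 \<le> cP S \<alpha> i j a b" for i j a b by (simp add: cP_def J_nonneg Z_nonneg)
  show "cP S \<alpha> i j a b = cP S \<alpha> j i b a" for i j a b by (simp add: cP_def J_commute[of S \<alpha> i j])
  show "(\<Sum>b<k. cP S \<alpha> i j a b) = cp S \<alpha> i a" if "i < n" "j < n" for i j a
    using J_sum[OF S that] by (simp add: cP_def cp_def sum_divide_distrib[symmetric])
  show "(\<Sum>a<k. cp S \<alpha> i a) = 1" if "i < n" for i
    using G_sum[OF seeds_small1[OF S that]] Z by (simp add: cp_def sum_divide_distrib[symmetric])
  show "cP S \<alpha> i j a b - cp S \<alpha> i a * cp S \<alpha> j b = (\<Sum>f<vec_dim L. cu S \<alpha> i a f * cu S \<alpha> j b f)"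
    if ij: "i < n" "j < n" and ab: "a < k" "b < k" for i j a b
  proof -
    let ?z = "Z S \<alpha>" and ?w = "\<lambda>f. lvec L S \<alpha> $ f"
    have "cu S \<alpha> i a f * cu S \<alpha> j b f = (cv S \<alpha> i a f * cv S \<alpha> j b f
        - cp S \<alpha> j b * (cv S \<alpha> i a f * ?w f) - cp S \<alpha> i a * (cv S \<alpha> j b f * ?w f)
        + cp S \<alpha> i a * cp S \<alpha> j b * (?w f * ?w f)) / ?z" for f
    proof -
      have "cu S \<alpha> i a f * cu S \<alpha> j b f = ((cv S \<alpha> i a f - cp S \<alpha> i a * ?w f) * (cv S \<alpha> j b f - cp S \<alpha> j b * ?w f)) / ?z"
        using Z by (simp add: cu_def)
      then show ?thesis by (simp add: algebra_simps)
    qed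
    then have "(\<Sum>f<vec_dim L. cu S \<alpha> i a f * cu S \<alpha> j b f) = (J S \<alpha> i j a b
        - cp S \<alpha> j b * G S \<alpha> i a - cp S \<alpha> i a * G S \<alpha> j b + cp S \<alpha> i a * cp S \<alpha> j b * ?z) / ?z"
      by (simp add: sum_divide_distrib[symmetric] sum.distrib sum_subtractf sum_distrib_left[symmetric]
          cv_inner[OF S \<alpha> ij ab] cv_inner_lvec[OF S \<alpha>] lvec_norm[OF S \<alpha>] ij ab)
    also have "\<dots> = cP S \<alpha> i j a b - cp S \<alpha> i a * cp S \<alpha> j b"
      using Z by (simp add: cP_def cp_def field_simps)
    finally show ?thesis by simp
  qed
qed

text \<open>Up to sign and a constant, the potential is the expected variance of the variables given \<open>X\<^sub>S\<close>.\<close>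

definition potential :: "nat set \<Rightarrow> real" where
  "potential S = (\<Sum>i<n. \<Sum>\<alpha>\<in>assignments S k. \<Sum>a<k. (G S \<alpha> i a)\<^sup>2 / Z S \<alpha>)"

lemma G_le_Z: assumes T: "insert i S \<in> small_sets n r" and a: "a < k" shows "G S \<alpha> i a \<le> Z S \<alpha>"
proof -
  have "G S \<alpha> i a \<le> (\<Sum>a<k. G S \<alpha> i a)" by (rule member_le_sum) (use a G_nonneg in auto)
  then show ?thesis using G_sum[OF T] by simp
qed

lemma J_le_G: assumes S: "S \<in> seeds" and ij: "i < n" "j < n" and ab: "a < k" "b < k"
  shows "J S \<alpha> i j a b \<le> G S \<alpha> j b"
proof -
  have "J S \<alpha> j i b a \<le> (\<Sum>a<k. J S \<alpha> j i b a)" by (rule member_le_sum) (use ab J_nonneg in auto)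
  then show ?thesis using J_sum[OF S ij(2,1)] J_commute[of S \<alpha> i j a b] by simp
qed

lemma potential_nonneg: "0 \<le> potential S"
  unfolding potential_def by (intro sum_nonneg divide_nonneg_nonneg) (auto simp: Z_nonneg)

text \<open>One variable more than in a seed is allowed: the potential involves \<open>S\<close> and
  one further variable only, and the growing set in the search for a seed may reach this
  size.\<close>

lemma potential_le: assumes S: "S \<subseteq> {..<n}" "card S \<le> Suc r" shows "potential S \<le> real n"
proof -
  have fS: "finite S" using S(1) finite_subset by blast
  have T: "insert i S \<in> small_sets n r" if "i < n" for i
    using S fS that by (auto simp: small_sets_def card_insert_if)
  have "potential S \<le> (\<Sum>i<n. \<Sum>\<alpha>\<in>assignments S k. \<Sum>a<k. G S \<alpha> i a)"
    unfolding potential_def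
  proof (intro sum_mono)
    fix i \<alpha> a assume "i \<in> {..<n}" "a \<in> {..<k}"
    then have le: "G S \<alpha> i a \<le> Z S \<alpha>" using G_le_Z[OF T] by auto
    show "(G S \<alpha> i a)\<^sup>2 / Z S \<alpha> \<le> G S \<alpha> i a"
    proof (cases "Z S \<alpha> = 0")
      case False
      then have "0 < Z S \<alpha>" using Z_nonneg[of S \<alpha>] by simp
      then show ?thesis using mult_left_mono[OF le G_nonneg[of S \<alpha> i a]]
        by (simp add: divide_le_eq power2_eq_square)
    qed (simp add: G_nonneg)
  qed
  also have "\<dots> = (\<Sum>i<n. 1)"
  proof (rule sum.cong[OF refl])
    fix i assume i: "i \<in> {..<n}"
    then have "S \<in> small_sets n r" using small_sets_mono[OF T] by auto
    then show "(\<Sum>\<alpha>\<in>assignments S k. \<Sum>a<k. G S \<alpha> i a) = 1"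
      using i by (simp add: G_sum T Z_sum)
  qed
  finally show ?thesis by simp
qed

text \<open>The formula also covers \<open>j\<close> in \<open>S\<close>, where a single
  \<open>b\<close> contributes and nothing changes, so the sum over all \<open>j\<close> has no
  exceptions. For a new \<open>j\<close>, assignments of the larger set are pairs of an old
  assignment and a letter.\<close>

lemma potential_insert: assumes S: "S \<in> seeds" and j: "j < n"
  shows "potential (insert j S)
    = (\<Sum>i<n. \<Sum>\<alpha>\<in>assignments S k. \<Sum>a<k. \<Sum>b<k. (J S \<alpha> i j a b)\<^sup>2 / G S \<alpha> j b)"
proof (cases "j \<in> S")
  case True
  then have ins: "insert j S = S" by auto
  show ?thesis unfolding ins potential_def
  proof (intro sum.cong refl)
    fix i \<alpha> a assume \<alpha>: "\<alpha> \<in> assignments S k"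
    have e: "{x. restrict x S = \<alpha> \<and> x j = b} = (if b = \<alpha> j then {x. restrict x S = \<alpha>} else {})"
      "{x. restrict x S = \<alpha> \<and> x i = a \<and> x j = b} = (if b = \<alpha> j then {x. restrict x S = \<alpha> \<and> x i = a} else {})" for b
      using True by auto
    have G: "G S \<alpha> j b = of_bool (b = \<alpha> j) * Z S \<alpha>" for b
      unfolding G_def Z_def ins e by simp
    have J: "J S \<alpha> i j a b = of_bool (b = \<alpha> j) * G S \<alpha> i a" for b
      unfolding J_def G_def ins e by simp
    have "\<alpha> j < k" using \<alpha> True by (auto simp: assignments_def)
    then show "(G S \<alpha> i a)\<^sup>2 / Z S \<alpha> = (\<Sum>b<k. (J S \<alpha> i j a b)\<^sup>2 / G S \<alpha> j b)"
      unfolding J G by (subst sum.remove[of _ "\<alpha> j"]) auto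
  qed
next
  case False
  have Z: "Z (insert j S) (\<alpha>(j := b)) = G S \<alpha> j b" if "\<alpha> \<in> assignments S k" for \<alpha> b
    unfolding Z_def G_def using restrict_insert_eq_iff[OF that, of j b] False by simp
  have G: "G (insert j S) (\<alpha>(j := b)) i a = J S \<alpha> i j a b" if "\<alpha> \<in> assignments S k" for \<alpha> b i a
    unfolding J_def G_def using restrict_insert_eq_iff[OF that, of j b] False by (simp add: conj_ac)
  have "(\<Sum>\<beta>\<in>assignments (insert j S) k. \<Sum>a<k. (G (insert j S) \<beta> i a)\<^sup>2 / Z (insert j S) \<beta>)
      = (\<Sum>\<alpha>\<in>assignments S k. \<Sum>a<k. \<Sum>b<k. (J S \<alpha> i j a b)\<^sup>2 / G S \<alpha> j b)" for i
  proof -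
    have "(\<Sum>\<beta>\<in>assignments (insert j S) k. \<Sum>a<k. (G (insert j S) \<beta> i a)\<^sup>2 / Z (insert j S) \<beta>)
        = (\<Sum>x\<in>assignments S k \<times> {..<k}. \<Sum>a<k. (G (insert j S) (case x of (\<alpha>, b) \<Rightarrow> \<alpha>(j := b)) i a)\<^sup>2
            / Z (insert j S) (case x of (\<alpha>, b) \<Rightarrow> \<alpha>(j := b)))"
      by (rule sum.reindex_bij_betw[OF assignments_insert_bij[OF False], symmetric])
    also have "\<dots> = (\<Sum>(\<alpha>, b)\<in>assignments S k \<times> {..<k}. \<Sum>a<k. (J S \<alpha> i j a b)\<^sup>2 / G S \<alpha> j b)"
      by (intro sum.cong refl) (auto simp: Z G)
    also have "\<dots> = (\<Sum>\<alpha>\<in>assignments S k. \<Sum>b<k. \<Sum>a<k. (J S \<alpha> i j a b)\<^sup>2 / G S \<alpha> j b)"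
      by (rule sum.cartesian_product[symmetric])
    also have "\<dots> = (\<Sum>\<alpha>\<in>assignments S k. \<Sum>a<k. \<Sum>b<k. (J S \<alpha> i j a b)\<^sup>2 / G S \<alpha> j b)"
      by (rule sum.cong[OF refl], rule sum.swap)
    finally show ?thesis .
  qed
  then show ?thesis by (simp add: potential_def)
qed

definition cD :: "nat set \<Rightarrow> (nat \<Rightarrow> nat) \<Rightarrow> nat \<Rightarrow> nat \<Rightarrow> real" where
  "cD S \<alpha> = pairwise_distribution.D k (cp S \<alpha>) (cP S \<alpha>)"

text \<open>The total variance identity multiplied by the probability of the condition. At
  probability zero both sides vanish because \<open>G\<close> is at most \<open>Z\<close> and
  division by zero yields zero.\<close>

lemma cD_eq: assumes S: "S \<in> seeds" and \<alpha>: "\<alpha> \<in> assignments S k" and ij: "i < n" "j < n"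
  shows "Z S \<alpha> * cD S \<alpha> i j
    = (\<Sum>a<k. \<Sum>b<k. (J S \<alpha> i j a b)\<^sup>2 / G S \<alpha> j b) - (\<Sum>a<k. (G S \<alpha> i a)\<^sup>2 / Z S \<alpha>)"
proof (cases "Z S \<alpha> = 0")
  case True
  have "G S \<alpha> j b = 0" if "j < n" "b < k" for j b
    using G_le_Z[OF seeds_small1[OF S that(1)] that(2), of \<alpha>] G_nonneg[of S \<alpha> j b] True by simp
  then show ?thesis using True ij by simp
next
  case False
  then have Z: "0 < Z S \<alpha>" using Z_nonneg[of S \<alpha>] by simp
  interpret pairwise_distribution n k "vec_dim L" "cp S \<alpha>" "cP S \<alpha>" "cu S \<alpha>"
    by (rule conditional_pairwise_distribution[OF S \<alpha> Z])
  have 1: "Z S \<alpha> * ((cP S \<alpha> i j a b)\<^sup>2 / cp S \<alpha> j b) = (J S \<alpha> i j a b)\<^sup>2 / G S \<alpha> j b" for a b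
    using Z by (simp add: cP_def cp_def field_simps power2_eq_square)
  have 2: "Z S \<alpha> * (cp S \<alpha> i a)\<^sup>2 = (G S \<alpha> i a)\<^sup>2 / Z S \<alpha>" for a
    using Z by (simp add: cp_def field_simps power2_eq_square)
  show ?thesis unfolding cD_def D_eq[OF ij] right_diff_distrib sum_distrib_left 1 2 ..
qed

definition expected_drop :: "nat set \<Rightarrow> real" where
  "expected_drop S = (\<Sum>\<alpha>\<in>assignments S k. Z S \<alpha> * (\<Sum>i<n. \<Sum>j<n. cD S \<alpha> i j))"

lemma potential_increments: assumes S: "S \<in> seeds"
  shows "(\<Sum>j<n. potential (insert j S) - potential S) = expected_drop S"
proof -
  have "(\<Sum>j<n. potential (insert j S) - potential S)
      = (\<Sum>j<n. \<Sum>i<n. \<Sum>\<alpha>\<in>assignments S k. Z S \<alpha> * cD S \<alpha> i j)"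
  proof (rule sum.cong[OF refl])
    fix j assume "j \<in> {..<n}"
    then have j: "j < n" by simp
    show "potential (insert j S) - potential S = (\<Sum>i<n. \<Sum>\<alpha>\<in>assignments S k. Z S \<alpha> * cD S \<alpha> i j)"
      unfolding potential_insert[OF S j] unfolding potential_def sum_subtractf[symmetric]
      by (intro sum.cong refl) (simp only: cD_eq[OF S] j lessThan_iff sum_subtractf)
  qed
  also have "\<dots> = (\<Sum>j<n. \<Sum>\<alpha>\<in>assignments S k. \<Sum>i<n. Z S \<alpha> * cD S \<alpha> i j)"
    by (rule sum.cong[OF refl], rule sum.swap)
  also have "\<dots> = (\<Sum>\<alpha>\<in>assignments S k. \<Sum>j<n. \<Sum>i<n. Z S \<alpha> * cD S \<alpha> i j)"
    by (rule sum.swap)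
  also have "\<dots> = (\<Sum>\<alpha>\<in>assignments S k. \<Sum>i<n. \<Sum>j<n. Z S \<alpha> * cD S \<alpha> i j)"
    by (rule sum.cong[OF refl], rule sum.swap)
  finally show ?thesis by (simp add: expected_drop_def sum_distrib_left)
qed

text \<open>The drop is the sum of the increments over all \<open>j\<close>. If it were too large at
  every seed, some variable would always raise the potential by more than
  \<open>n / (r + 1)\<close>, and \<open>r + 1\<close> such steps from the empty set would exceed
  the upper bound \<open>n\<close>.\<close>

lemma exists_low_correlation_seed: assumes n: "0 < n"
  shows "\<exists>S\<in>seeds. expected_drop S / (real n)\<^sup>2 \<le> 1 / (r + 1)"
proof (rule ccontr)
  assume neg: "\<not> ?thesis"
  have step: "\<exists>j<n. potential S + n / (r + 1) < potential (insert j S)" if S: "S \<in> seeds" for S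
  proof (rule ccontr)
    assume "\<not> ?thesis"
    then have "potential (insert j S) \<le> potential S + n / (r + 1)" if "j < n" for j
      using that not_less by blast
    then have "(\<Sum>j<n. potential (insert j S) - potential S) \<le> (\<Sum>j<n. n / (r + 1))"
      by (intro sum_mono) (simp add: diff_le_eq add.commute)
    then have "expected_drop S \<le> n * (n / (r + 1))"
      unfolding potential_increments[OF S] by simp
    then have "expected_drop S / (real n)\<^sup>2 \<le> n * (n / (r + 1)) / (real n)\<^sup>2"
      by (rule divide_right_mono) simp
    also have "\<dots> = 1 / (r + 1)" using n by (simp add: power2_eq_square)
    finally show False using neg S by blast
  qed
  \<comment> \<open>The weak bound starts the induction at \<open>t = 0\<close>. The strict one,
    available from the first step on, gives the contradiction at \<open>r + 1\<close>, where the
    bound equals \<open>n\<close>.\<close>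
  have "\<exists>S. S \<subseteq> {..<n} \<and> card S \<le> t \<and> t * (n / (r + 1)) \<le> potential S \<and> (0 < t \<longrightarrow> t * (n / (r + 1)) < potential S)"
    if "t \<le> r + 1" for t
    using that
  proof (induction t)
    case 0
    show ?case by (intro exI[of _ "{}"]) (simp add: potential_nonneg)
  next
    case (Suc t)
    then obtain S where S: "S \<subseteq> {..<n}" "card S \<le> t" "t * (n / (r + 1)) \<le> potential S" by auto
    then have "S \<in> seeds" using Suc.prems by (simp add: seeds_def)
    then obtain j where j: "j < n" "potential S + n / (r + 1) < potential (insert j S)" using step by blast
    have "card (insert j S) \<le> Suc t" using S finite_subset[OF S(1)] by (simp add: card_insert_if)
    moreover have "Suc t * (n / (r + 1)) = t * (n / (r + 1)) + n / (r + 1)" by (simp add: algebra_simps add_divide_distrib)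
    ultimately show ?case using S j by (intro exI[of _ "insert j S"]) auto
  qed
  from this[of "r + 1"] obtain S where S: "S \<subseteq> {..<n}" "card S \<le> r + 1" "(r + 1) * (n / (r + 1)) < potential S" by auto
  then have "real n < potential S" by simp
  with potential_le[of S] S show False by simp
qed

end

section \<open>Independent rounding\<close>

locale regular_csp =
  fixes n k :: nat and I :: "constraint pmf"
  assumes csp: "max2csp n k I" and regular: "regular_constraint_graph n I"
begin

abbreviation A :: "real mat" where "A \<equiv> normalized_adjacency n I"

lemma k_pos: "0 < k" using csp by (simp add: max2csp_def)

lemma set_I: "c \<in> set_pmf I \<Longrightarrow> c = (i, j, R) \<Longrightarrow> i < n \<and> j < n \<and> R \<subseteq> {..<k} \<times> {..<k}"
  using csp by (auto simp: max2csp_def)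

lemma finite_I: "finite (set_pmf I)"
  by (rule finite_subset[of _ "{..<n} \<times> {..<n} \<times> Pow ({..<k} \<times> {..<k})"])
    (use csp in \<open>auto simp: max2csp_def\<close>)

lemma sum_pmf_I: "(\<Sum>c\<in>set_pmf I. pmf I c) = 1"
  using finite_I by (simp add: sum_pmf_eq_1)

lemma n_pos: "0 < n"
proof -
  obtain i j R where "(i, j, R) \<in> set_pmf I" using set_pmf_not_empty[of I] by (metis ex_in_conv prod_cases3)
  then show ?thesis using set_I by fastforce
qed

lemma prob_I: "measure_pmf.prob I X = (\<Sum>c\<in>set_pmf I. pmf I c * of_bool (c \<in> X))"
proof -
  have "measure_pmf.prob I X = measure_pmf.prob I (X \<inter> set_pmf I)" by (simp add: measure_Int_set_pmf)
  also have "\<dots> = sum (pmf I) (X \<inter> set_pmf I)" using finite_I by (simp add: measure_measure_pmf_finite)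
  also have "\<dots> = (\<Sum>c\<in>set_pmf I. pmf I c * of_bool (c \<in> X))"
    using finite_I by (simp add: of_bool_def if_distrib sum.If_cases Int_commute cong: if_cong)
  finally show ?thesis .
qed

section \<open>Degrees and the normalised constraint graph\<close>

lemma edge_weight_sum:
  "edge_weight I i j = (\<Sum>(a, b, R)\<in>set_pmf I. pmf I (a, b, R) * of_bool ({a, b} = {i, j}))"
  unfolding edge_weight_def prob_I by (simp add: case_prod_unfold)

lemma edge_weight_commute: "edge_weight I i j = edge_weight I j i"
  by (simp add: edge_weight_def insert_commute)

text \<open>A sum over ordered pairs meets a proper edge twice and a loop once. This is the source
  of the bounds 1 and 2 on \<open>n * deg\<close>.\<close>

lemma edge_weight_weighted_sum:
  assumes K: "\<And>i j. i < n \<Longrightarrow> j < n \<Longrightarrow> K i j = K j i"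
  shows "(\<Sum>i<n. \<Sum>j<n. edge_weight I i j * K i j)
    = (\<Sum>(a, b, R)\<in>set_pmf I. pmf I (a, b, R) * (if a = b then K a b else 2 * K a b))"
proof -
  have "(\<Sum>i<n. \<Sum>j<n. edge_weight I i j * K i j)
      = (\<Sum>i<n. \<Sum>j<n. \<Sum>(a, b, R)\<in>set_pmf I. pmf I (a, b, R) * (of_bool ({a, b} = {i, j}) * K i j))"
    by (simp add: edge_weight_sum sum_distrib_right case_prod_unfold mult.assoc)
  also have "\<dots> = (\<Sum>i<n. \<Sum>(a, b, R)\<in>set_pmf I. \<Sum>j<n. pmf I (a, b, R) * (of_bool ({a, b} = {i, j}) * K i j))"
    unfolding case_prod_unfold by (rule sum.cong[OF refl], rule sum.swap)
  also have "\<dots> = (\<Sum>(a, b, R)\<in>set_pmf I. \<Sum>i<n. \<Sum>j<n. pmf I (a, b, R) * (of_bool ({a, b} = {i, j}) * K i j))"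
    unfolding case_prod_unfold by (rule sum.swap)
  also have "\<dots> = (\<Sum>(a, b, R)\<in>set_pmf I. pmf I (a, b, R) * (if a = b then K a b else 2 * K a b))"
  proof (intro sum.cong refl, clarify)
    fix a b R assume "(a, b, R) \<in> set_pmf I"
    then have ab: "a < n" "b < n" using set_I by blast+
    have "(\<Sum>i<n. \<Sum>j<n. of_bool ({a, b} = {i, j}) * K i j)
        = (\<Sum>x\<in>{..<n} \<times> {..<n}. if x \<in> {(a, b), (b, a)} then case_prod K x else 0)"
      unfolding sum.cartesian_product
      by (intro sum.cong refl) (auto simp: of_bool_def doubleton_eq_iff split: if_splits)
    also have "\<dots> = (\<Sum>x\<in>{(a, b), (b, a)}. case_prod K x)"
      using ab by (subst sum.If_cases) (auto intro!: sum.cong)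
    also have "\<dots> = (if a = b then K a b else 2 * K a b)" using K[OF ab] by auto
    finally show "(\<Sum>i<n. \<Sum>j<n. pmf I (a, b, R) * (of_bool ({a, b} = {i, j}) * K i j))
      = pmf I (a, b, R) * (if a = b then K a b else 2 * K a b)"
      by (simp only: sum_distrib_left[symmetric])
  qed
  finally show ?thesis .
qed

lemma edge_weight_nonneg: "0 \<le> edge_weight I i j"
  by (simp add: edge_weight_def)

definition deg :: real where "deg = incident_weight n I 0"

lemma deg: "i < n \<Longrightarrow> incident_weight n I i = deg"
  using regular n_pos unfolding regular_constraint_graph_def deg_def by metis

lemma deg_bounds: "1 \<le> n * deg" "n * deg \<le> 2"
proof -
  have "n * deg = (\<Sum>i<n. incident_weight n I i)" by (simp add: deg)
  also have "\<dots> = (\<Sum>i<n. \<Sum>j<n. edge_weight I i j * 1)" by (simp add: incident_weight_def)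
  also have "\<dots> = (\<Sum>(a, b, R)\<in>set_pmf I. pmf I (a, b, R) * (if a = b then 1 else 2 * 1))"
    by (rule edge_weight_weighted_sum) simp
  finally have e: "n * deg = (\<Sum>(a, b, R)\<in>set_pmf I. pmf I (a, b, R) * (if a = b then 1 else 2))"
    by (simp only: mult_1_right)
  have "(\<Sum>c\<in>set_pmf I. pmf I c * 1) \<le> n * deg"
    unfolding e by (intro sum_mono) auto
  then show "1 \<le> n * deg" by (simp add: sum_pmf_I)
  have "n * deg \<le> (\<Sum>c\<in>set_pmf I. pmf I c * 2)"
    unfolding e by (intro sum_mono) auto
  then show "n * deg \<le> 2" by (simp add: sum_distrib_right[symmetric] sum_pmf_I)
qed

lemma deg_pos: "0 < deg"
  using deg_bounds(1) n_pos by (smt (verit) of_nat_0_less_iff zero_less_mult_pos)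

lemma A_carrier: "A \<in> carrier_mat n n"
  by (simp add: normalized_adjacency_def)

lemma A_index: "i < n \<Longrightarrow> j < n \<Longrightarrow> A $$ (i, j) = edge_weight I i j / deg"
  by (simp add: normalized_adjacency_def deg)

lemma A_sym: "transpose_mat A = A"
  by (rule eq_matI) (use A_carrier in \<open>auto simp: A_index edge_weight_commute\<close>)

lemma A_nonneg: "i < n \<Longrightarrow> j < n \<Longrightarrow> 0 \<le> A $$ (i, j)"
  using deg_pos by (simp add: A_index edge_weight_nonneg)

lemma A_row: "i < n \<Longrightarrow> (\<Sum>j<n. A $$ (i, j)) = 1"
  using deg_pos deg[of i] by (simp add: A_index sum_divide_distrib[symmetric] incident_weight_def)

text \<open>Loops are excluded because the constraint graph weights them less than other edges;
  the rounding loses nothing on them.\<close>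

lemma nonloop_sum_le:
  assumes K: "\<And>i j. i < n \<Longrightarrow> j < n \<Longrightarrow> K i j = K j i" and K0: "\<And>i j. i < n \<Longrightarrow> j < n \<Longrightarrow> 0 \<le> K i j"
  shows "(\<Sum>(i, j, R)\<in>set_pmf I. pmf I (i, j, R) * (of_bool (i \<noteq> j) * K i j))
    \<le> (\<Sum>i<n. \<Sum>j<n. A $$ (i, j) * K i j) / n"
proof -
  let ?s = "\<Sum>(i, j, R)\<in>set_pmf I. pmf I (i, j, R) * (of_bool (i \<noteq> j) * K i j)"
  have s0: "0 \<le> ?s" by (intro sum_nonneg) (use set_I K0 in \<open>fastforce simp: zero_le_mult_iff\<close>)
  have "2 * ?s \<le> (\<Sum>(a, b, R)\<in>set_pmf I. pmf I (a, b, R) * (if a = b then K a b else 2 * K a b))"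
    unfolding sum_distrib_left case_prod_unfold
  proof (intro sum_mono)
    fix c assume c: "c \<in> set_pmf I"
    have "fst c < n" "fst (snd c) < n"
      using set_I[OF c, of "fst c" "fst (snd c)" "snd (snd c)"] by simp_all
    then show "2 * (pmf I (fst c, fst (snd c), snd (snd c)) * (of_bool (fst c \<noteq> fst (snd c)) * K (fst c) (fst (snd c))))
      \<le> pmf I (fst c, fst (snd c), snd (snd c))
        * (if fst c = fst (snd c) then K (fst c) (fst (snd c)) else 2 * K (fst c) (fst (snd c)))"
      using K0 by auto
  qed
  also have "\<dots> = (\<Sum>i<n. \<Sum>j<n. edge_weight I i j * K i j)"
    by (rule edge_weight_weighted_sum[symmetric]) (rule K)
  finally have "2 * ?s / (n * deg) \<le> (\<Sum>i<n. \<Sum>j<n. edge_weight I i j * K i j) / (n * deg)"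
    using deg_bounds by (intro divide_right_mono) auto
  also have "\<dots> = (\<Sum>i<n. \<Sum>j<n. A $$ (i, j) * K i j) / n"
    by (simp add: A_index sum_divide_distrib mult.commute)
  finally have *: "2 * ?s / (n * deg) \<le> (\<Sum>i<n. \<Sum>j<n. A $$ (i, j) * K i j) / n" .
  \<comment> \<open>As \<open>n * deg\<close> is at most two, normalising by it does not shrink the
    doubled sum below \<open>?s\<close>.\<close>
  have "?s \<le> 2 * ?s / (n * deg)"
    using mult_left_mono[OF deg_bounds(2) s0] deg_bounds(1) by (simp add: le_divide_eq mult.commute)
  with * show ?thesis by simp
qed

text \<open>On a loop one variable is sampled once, so only equal letters count. This makes the
  rounding exact on loops and keeps the value linear in every single row of
  \<open>q\<close>.\<close>

definition product_value :: "(nat \<Rightarrow> nat \<Rightarrow> real) \<Rightarrow> constraint \<Rightarrow> real" where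
  "product_value q c = (case c of (i, j, R) \<Rightarrow>
    \<Sum>(a, b)\<in>R. if i = j then of_bool (a = b) * q i a else q i a * q j b)"

definition rounding_value :: "(nat \<Rightarrow> nat \<Rightarrow> real) \<Rightarrow> real" where
  "rounding_value q = (\<Sum>c\<in>set_pmf I. pmf I c * product_value q c)"

end

locale csp_relaxation = regular_csp n k I + lasserre_relaxation n k r L for n k I r L
begin

definition conditional_value :: "nat set \<Rightarrow> (nat \<Rightarrow> nat) \<Rightarrow> real" where
  "conditional_value S \<alpha> =
    (\<Sum>(i, j, R)\<in>set_pmf I. pmf I (i, j, R) * (\<Sum>(a, b)\<in>R. cP S \<alpha> i j a b))"

text \<open>Conditioning on \<open>X_S\<close> and averaging over its assignments leaves the
  objective unchanged, by consistency of the local distributions.\<close>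

lemma lasserre_value_eq:
  assumes S: "S \<in> seeds"
  shows "lasserre_value I L = (\<Sum>\<alpha>\<in>assignments S k. Z S \<alpha> * conditional_value S \<alpha>)"
proof -
  have c: "pr {i, j} {x. (x i, x j) \<in> R} = (\<Sum>\<alpha>\<in>assignments S k. Z S \<alpha> * (\<Sum>(a, b)\<in>R. cP S \<alpha> i j a b))"
    if "(i, j, R) \<in> set_pmf I" for i j R
  proof -
    have ij: "i < n" "j < n" and R: "R \<subseteq> {..<k} \<times> {..<k}" using set_I that by blast+
    have fR: "finite R" using R finite_subset by blast
    let ?T = "insert i (insert j S)"
    note T = seeds_small[OF S ij]
    have "pr {i, j} {x. (x i, x j) \<in> R} = pr ?T {x. (x i, x j) \<in> R}"
      by (rule pr_marginal[symmetric, OF T]) auto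
    also have "\<dots> = (\<Sum>\<alpha>\<in>assignments S k. pr ?T {x. (x i, x j) \<in> R \<and> restrict x S = \<alpha>})"
    proof (rule prob_sum_fibres)
      show "finite (assignments S k)" using S by (simp add: finite_assignments seeds_finite)
      show "restrict x S \<in> assignments S k" if "x \<in> set_pmf (local_dist L ?T)" for x
        using support_less[OF T that] by (auto simp: assignments_def)
    qed
    also have "\<dots> = (\<Sum>\<alpha>\<in>assignments S k. \<Sum>(a, b)\<in>R. J S \<alpha> i j a b)"
    proof (rule sum.cong[OF refl])
      fix \<alpha>
      have "pr ?T {x. (x i, x j) \<in> R \<and> restrict x S = \<alpha>}
          = pr ?T (\<Union>(a, b)\<in>R. {x. restrict x S = \<alpha> \<and> x i = a \<and> x j = b})"
        by (rule arg_cong[where f = "pr ?T"]) auto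
      also have "\<dots> = (\<Sum>(a, b)\<in>R. J S \<alpha> i j a b)"
        unfolding J_def case_prod_unfold
        by (rule measure_pmf.finite_measure_finite_Union[OF fR]) (auto simp: disjoint_family_on_def)
      finally show "pr ?T {x. (x i, x j) \<in> R \<and> restrict x S = \<alpha>} = (\<Sum>(a, b)\<in>R. J S \<alpha> i j a b)" .
    qed
    also have "\<dots> = (\<Sum>\<alpha>\<in>assignments S k. Z S \<alpha> * (\<Sum>(a, b)\<in>R. cP S \<alpha> i j a b))"
    proof (intro sum.cong refl)
      fix \<alpha>
      have "J S \<alpha> i j a b = Z S \<alpha> * cP S \<alpha> i j a b" if "(a, b) \<in> R" for a b
      \<comment> \<open>At probability zero the quotient \<open>cP\<close> is zero by convention,
        and \<open>J\<close> is zero because \<open>Z\<close> bounds it.\<close>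
      proof (cases "Z S \<alpha> = 0")
        case True
        have ab: "a < k" "b < k" using R that by auto
        have "J S \<alpha> i j a b = 0"
          using J_le_G[OF S ij ab, of \<alpha>] G_le_Z[OF seeds_small1[OF S ij(2)] ab(2), of \<alpha>] True
            J_nonneg[of S \<alpha> i j a b] by simp
        then show ?thesis using True by simp
      qed (simp add: cP_def)
      then show "(\<Sum>(a, b)\<in>R. J S \<alpha> i j a b) = Z S \<alpha> * (\<Sum>(a, b)\<in>R. cP S \<alpha> i j a b)"
        unfolding sum_distrib_left by (intro sum.cong) auto
    qed
    finally show ?thesis .
  qed
  have "lasserre_value I L = (\<Sum>(i, j, R)\<in>set_pmf I. pmf I (i, j, R) * pr {i, j} {x. (x i, x j) \<in> R})"
    unfolding lasserre_value_def
    by (subst integral_measure_pmf[OF finite_I]) (auto simp: case_prod_unfold)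
  also have "\<dots> = (\<Sum>(i, j, R)\<in>set_pmf I. \<Sum>\<alpha>\<in>assignments S k. Z S \<alpha> * (pmf I (i, j, R) * (\<Sum>(a, b)\<in>R. cP S \<alpha> i j a b)))"
    by (rule sum.cong[OF refl], clarify) (simp add: c sum_distrib_left mult.left_commute)
  also have "\<dots> = (\<Sum>\<alpha>\<in>assignments S k. \<Sum>(i, j, R)\<in>set_pmf I. Z S \<alpha> * (pmf I (i, j, R) * (\<Sum>(a, b)\<in>R. cP S \<alpha> i j a b)))"
    unfolding case_prod_unfold by (rule sum.swap)
  finally show ?thesis by (simp add: conditional_value_def sum_distrib_left case_prod_unfold)
qed

lemma cP_diag: assumes S: "S \<in> seeds" and i: "i < n"
  shows "cP S \<alpha> i i a b = of_bool (a = b) * cp S \<alpha> i a"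
proof -
  have "{x. restrict x S = \<alpha> \<and> x i = a \<and> x i = b} = (if a = b then {x. restrict x S = \<alpha> \<and> x i = a} else {})"
    by auto
  then show ?thesis by (simp add: cP_def cp_def J_def G_def)
qed

text \<open>The loss on an edge is at most half the absolute covariance sum, and AM-GM contributes
  another half, whence the division by four. With a single letter all covariances vanish; this case
  is split off because the later choice of constants relies on \<open>k \<ge> 2\<close>.\<close>

lemma rounding_loss:
  assumes S: "S \<in> seeds" and \<alpha>: "\<alpha> \<in> assignments S k" and Z: "0 < Z S \<alpha>"
    and \<tau>: "0 \<le> \<tau>" and \<delta>: "0 < \<delta>" and \<theta>: "0 < \<theta>"
  defines "m \<equiv> real (csp_threshold_rank n I \<tau>)"
  shows "conditional_value S \<alpha> - rounding_value (cp S \<alpha>)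
    \<le> (if k = 1 then 0 else (\<theta> * real k * ((\<Sum>i<n. \<Sum>j<n. cD S \<alpha> i j) / (real n)\<^sup>2 + \<tau> / (m + \<delta>)) + (2 * m + \<delta>) / \<theta>) / 4)"
proof -
  interpret P: pairwise_distribution n k "vec_dim L" "cp S \<alpha>" "cP S \<alpha>" "cu S \<alpha>"
    by (rule conditional_pairwise_distribution[OF S \<alpha> Z])
  define K where "K i j = (\<Sum>a<k. \<Sum>b<k. \<bar>P.C i j a b\<bar>)" for i j
  have K0: "0 \<le> K i j" for i j by (simp add: K_def sum_nonneg)
  have Kc: "K i j = K j i" if "i < n" "j < n" for i j
    unfolding K_def by (subst sum.swap) (simp add: P.C_commute[OF that])
  have "conditional_value S \<alpha> - rounding_value (cp S \<alpha>)
      = (\<Sum>(i, j, R)\<in>set_pmf I. pmf I (i, j, R) * ((\<Sum>(a, b)\<in>R. cP S \<alpha> i j a b) - product_value (cp S \<alpha>) (i, j, R)))"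
    by (simp add: conditional_value_def rounding_value_def sum_subtractf[symmetric] case_prod_unfold right_diff_distrib)
  also have "\<dots> \<le> (\<Sum>(i, j, R)\<in>set_pmf I. pmf I (i, j, R) * (of_bool (i \<noteq> j) * (K i j / 2)))"
  proof (intro sum_mono, clarify)
    fix i j R assume "(i, j, R) \<in> set_pmf I"
    then have ij: "i < n" "j < n" and R: "R \<subseteq> {..<k} \<times> {..<k}" using set_I by blast+
    have "(\<Sum>(a, b)\<in>R. cP S \<alpha> i j a b) - product_value (cp S \<alpha>) (i, j, R) \<le> of_bool (i \<noteq> j) * (K i j / 2)"
    proof (cases "i = j")
      case True
      then show ?thesis by (simp add: product_value_def cP_diag[OF S ij(2)])
    next
      case False
      then have "(\<Sum>(a, b)\<in>R. cP S \<alpha> i j a b) - product_value (cp S \<alpha>) (i, j, R) = (\<Sum>(a, b)\<in>R. P.C i j a b)"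
        by (simp add: product_value_def P.C_def sum_subtractf case_prod_unfold)
      also have "\<dots> \<le> K i j / 2" unfolding K_def by (rule P.sum_C_le[OF ij R])
      finally show ?thesis using False by simp
    qed
    then show "pmf I (i, j, R) * ((\<Sum>(a, b)\<in>R. cP S \<alpha> i j a b) - product_value (cp S \<alpha>) (i, j, R))
      \<le> pmf I (i, j, R) * (of_bool (i \<noteq> j) * (K i j / 2))"
      by (intro mult_left_mono) auto
  qed
  also have "\<dots> \<le> (\<Sum>i<n. \<Sum>j<n. A $$ (i, j) * (K i j / 2)) / n"
    by (rule nonloop_sum_le) (simp_all add: Kc K0)
  also have "\<dots> = (\<Sum>i<n. \<Sum>j<n. A $$ (i, j) * K i j) / n / 2"
    by (simp add: sum_divide_distrib mult.commute)
  finally have *: "conditional_value S \<alpha> - rounding_value (cp S \<alpha>)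
      \<le> (\<Sum>i<n. \<Sum>j<n. A $$ (i, j) * K i j) / n / 2" .
  show ?thesis
  proof (cases "k = 1")
    case True
    have "K i j = 0" if "i < n" "j < n" for i j
      using P.C_sum[OF that] True by (simp add: K_def)
    then have "(\<Sum>i<n. \<Sum>j<n. A $$ (i, j) * K i j) = 0" by simp
    with * True show ?thesis by simp
  next
    case False
    have "(\<Sum>i<n. \<Sum>j<n. A $$ (i, j) * K i j) / n
      \<le> (\<theta> * real k * ((\<Sum>i<n. \<Sum>j<n. P.M i j) / (real n)\<^sup>2 + \<tau> / (real (threshold_rank A \<tau>) + \<delta>))
      + (2 * real (threshold_rank A \<tau>) + \<delta>) / \<theta>) / 2"
      by (rule edge_correlation_bound[OF A_carrier A_sym A_nonneg A_row n_pos \<tau> \<delta> \<theta> P.M_psd P.M_diag_le_1 _ P.M_nonneg])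
        (auto simp: K_def P.abs_C_sum_le)
    also have "\<dots> \<le> (\<theta> * real k * ((\<Sum>i<n. \<Sum>j<n. cD S \<alpha> i j) / (real n)\<^sup>2 + \<tau> / (real (threshold_rank A \<tau>) + \<delta>))
      + (2 * real (threshold_rank A \<tau>) + \<delta>) / \<theta>) / 2"
      using \<theta> P.sum_M_le_sum_D unfolding cD_def
      by (intro divide_right_mono add_right_mono mult_left_mono) auto
    finally have "(\<Sum>i<n. \<Sum>j<n. A $$ (i, j) * K i j) / n / 2 \<le>
      (\<theta> * real k * ((\<Sum>i<n. \<Sum>j<n. cD S \<alpha> i j) / (real n)\<^sup>2 + \<tau> / (real (threshold_rank A \<tau>) + \<delta>))
      + (2 * real (threshold_rank A \<tau>) + \<delta>) / \<theta>) / 2 / 2"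
      by (rule divide_right_mono) simp
    from order_trans[OF * this] show ?thesis
      unfolding m_def csp_threshold_rank_def if_not_P[OF False] divide_divide_eq_left by simp
  qed
qed

text \<open>At a seed of low correlation the expected loss over \<open>\<alpha>\<close> is strictly
  below \<open>\<epsilon>\<close>, so not every assignment of positive probability can fall short of
  the Lasserre value by \<open>\<epsilon>\<close> or more.\<close>

lemma exists_good_seed:
  assumes \<epsilon>: "0 < \<epsilon>" "\<epsilon> \<le> 1"
    and r: "real k * real (csp_threshold_rank n I ((\<epsilon> / real k) powr 3)) / \<epsilon> powr 3 \<le> real r"
  shows "\<exists>S\<in>seeds. \<exists>\<alpha>\<in>assignments S k. 0 < Z S \<alpha> \<and> lasserre_value I L - \<epsilon> < rounding_value (cp S \<alpha>)"
proof -
  define \<tau> where "\<tau> = (\<epsilon> / real k) powr 3"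
  define m where "m = real (csp_threshold_rank n I \<tau>)"
  have \<tau>: "\<tau> = (\<epsilon> / real k) ^ 3" "0 \<le> \<tau>" using \<epsilon> k_pos by (simp_all add: \<tau>_def powr_numeral)
  have m0: "0 \<le> m" by (simp add: m_def)
  have km: "real k * m \<le> \<epsilon> ^ 3 * real r"
    using r \<epsilon> by (simp add: m_def \<tau>_def powr_numeral divide_le_eq mult.commute)
  obtain S where S: "S \<in> seeds"
    and low: "expected_drop S / (real n)\<^sup>2 \<le> 1 / (r + 1)"
    using exists_low_correlation_seed[OF n_pos] by blast
  have Z1: "(\<Sum>\<alpha>\<in>assignments S k. Z S \<alpha>) = 1" by (rule Z_sum[OF seeds_small0[OF S]])
  \<comment> \<open>Positive even when the threshold rank is zero, and small enough that
    \<open>k * \<delta> = \<epsilon>^3 / 2\<close>.\<close>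
  define \<delta> where "\<delta> = \<epsilon> ^ 3 / (2 * real k)"
  have \<delta>: "0 < \<delta>" using \<epsilon> k_pos by (simp add: \<delta>_def)
  \<comment> \<open>Makes the reciprocal term \<open>(2 * m + \<delta>) / \<theta>\<close> equal to
    \<open>2 * \<epsilon>\<close>, so that its share of the loss is
    \<open>\<epsilon> / 2\<close>.\<close>
  define \<theta> where "\<theta> = (2 * m + \<delta>) / (2 * \<epsilon>)"
  have \<theta>: "0 < \<theta>" using \<epsilon> \<delta> m0 by (simp add: \<theta>_def)
  define loss where "loss \<alpha> = (if k = 1 then 0 else (\<theta> * real k * ((\<Sum>i<n. \<Sum>j<n. cD S \<alpha> i j) / (real n)\<^sup>2 + \<tau> / (m + \<delta>)) + (2 * m + \<delta>) / \<theta>) / 4)" for \<alpha>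
  have total: "(\<Sum>\<alpha>\<in>assignments S k. Z S \<alpha> * loss \<alpha>) < \<epsilon>"
  proof (cases "k = 1")
    case True
    then show ?thesis using \<epsilon> by (simp add: loss_def)
  next
    case False
    then have k2: "2 \<le> real k" using k_pos by simp
    let ?X = "expected_drop S / (real n)\<^sup>2"
    have "(\<Sum>\<alpha>\<in>assignments S k. Z S \<alpha> * loss \<alpha>) = (\<Sum>\<alpha>\<in>assignments S k.
        \<theta> * real k / 4 * (Z S \<alpha> * (\<Sum>i<n. \<Sum>j<n. cD S \<alpha> i j) / (real n)\<^sup>2)
        + (\<theta> * real k * (\<tau> / (m + \<delta>)) + (2 * m + \<delta>) / \<theta>) / 4 * Z S \<alpha>)"
      unfolding loss_def if_not_P[OF False]
      by (intro sum.cong refl) (simp add: algebra_simps add_divide_distrib)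
    also have "\<dots> = \<theta> * real k / 4 * ?X + (\<theta> * real k * (\<tau> / (m + \<delta>)) + (2 * m + \<delta>) / \<theta>) / 4"
      by (simp only: sum.distrib sum_distrib_left[symmetric] sum_divide_distrib[symmetric] Z1 mult_1_right expected_drop_def)
    also have "\<dots> \<le> \<theta> * real k / 4 * (1 / (r + 1)) + (\<theta> * real k * (\<tau> / (m + \<delta>)) + (2 * m + \<delta>) / \<theta>) / 4"
      using \<theta> low by (intro add_right_mono mult_left_mono) auto
    also have "\<dots> = (real k * (2 * m + \<delta>) / (r + 1) + real k * \<tau> * ((2 * m + \<delta>) / (m + \<delta>))) / (8 * \<epsilon>) + \<epsilon> / 2"
    proof -
      have "(2 * m + \<delta>) / \<theta> = 2 * \<epsilon>" using \<theta> \<epsilon> \<delta> m0 by (simp add: \<theta>_def)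
      moreover have "q / (2 * \<epsilon>) * real k / 4 * (1 / R) + (q / (2 * \<epsilon>) * real k * (\<tau> / W) + 2 * \<epsilon>) / 4
          = (real k * q / R + real k * \<tau> * (q / W)) / (8 * \<epsilon>) + \<epsilon> / 2" for q R W :: real
        by (simp add: add_divide_distrib mult_ac)
      ultimately show ?thesis by (simp only: \<theta>_def)
    qed
    \<comment> \<open>The factor 3 is \<open>5/2\<close> for the correlation term, from the lower
      bound on \<open>r\<close>, plus \<open>1/2\<close> for the threshold term, from the choice of
      \<open>\<tau>\<close> and \<open>k \<ge> 2\<close>.\<close>
    also have "\<dots> \<le> (3 * \<epsilon> ^ 3) / (8 * \<epsilon>) + \<epsilon> / 2"
    proof -
      have "real k * (2 * m + \<delta>) = 2 * (real k * m) + \<epsilon> ^ 3 / 2"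
        using k2 by (simp add: \<delta>_def field_simps)
      also have "\<dots> \<le> 2 * (\<epsilon> ^ 3 * real r) + \<epsilon> ^ 3 / 2" using km by simp
      also have "\<dots> \<le> (2 * \<epsilon> ^ 3 + \<epsilon> ^ 3 / 2) * (r + 1)" using \<epsilon> by (simp add: algebra_simps)
      finally have 1: "real k * (2 * m + \<delta>) / (r + 1) \<le> 2 * \<epsilon> ^ 3 + \<epsilon> ^ 3 / 2"
        by (simp add: divide_le_eq)
      have "real k * \<tau> * ((2 * m + \<delta>) / (m + \<delta>)) \<le> real k * \<tau> * 2"
        using \<tau> \<delta> m0 by (intro mult_left_mono) (auto simp: divide_le_eq)
      also have "\<dots> = 2 * \<epsilon> ^ 3 / (real k)\<^sup>2"
        using k2 unfolding \<tau>(1) by (simp add: power_divide power2_eq_square power3_eq_cube)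
      also have "\<dots> \<le> 2 * \<epsilon> ^ 3 / 2\<^sup>2"
        using k2 \<epsilon> by (intro divide_left_mono power_mono) auto
      finally have 2: "real k * \<tau> * ((2 * m + \<delta>) / (m + \<delta>)) \<le> \<epsilon> ^ 3 / 2" by simp
      have "(real k * (2 * m + \<delta>) / (r + 1) + real k * \<tau> * ((2 * m + \<delta>) / (m + \<delta>))) / (8 * \<epsilon>) \<le> 3 * \<epsilon> ^ 3 / (8 * \<epsilon>)"
        by (rule divide_right_mono) (use 1 2 \<epsilon> in linarith)+
      then show ?thesis by simp
    qed
    also have "\<dots> = 3 / 8 * \<epsilon>\<^sup>2 + \<epsilon> / 2" using \<epsilon> by (simp add: power2_eq_square power3_eq_cube)
    also have "\<dots> < \<epsilon>"
    proof -
      have "\<epsilon>\<^sup>2 \<le> \<epsilon>" using \<epsilon> by (simp add: power2_eq_square mult_left_le)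
      then show ?thesis using \<epsilon> by simp
    qed
    finally show ?thesis .
  qed
  show ?thesis
  proof (rule ccontr)
    assume neg: "\<not> ?thesis"
    have "Z S \<alpha> * conditional_value S \<alpha> \<le> Z S \<alpha> * (lasserre_value I L - \<epsilon> + loss \<alpha>)" if \<alpha>: "\<alpha> \<in> assignments S k" for \<alpha>
    proof (cases "Z S \<alpha> = 0")
      case False
      then have Z: "0 < Z S \<alpha>" using Z_nonneg[of S \<alpha>] by simp
      have "conditional_value S \<alpha> - rounding_value (cp S \<alpha>) \<le> loss \<alpha>"
        using rounding_loss[OF S \<alpha> Z \<tau>(2) \<delta> \<theta>] by (simp only: loss_def m_def)
      moreover have "rounding_value (cp S \<alpha>) \<le> lasserre_value I L - \<epsilon>"
        using neg S \<alpha> Z by (meson not_less)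
      ultimately show ?thesis using Z by (intro mult_left_mono) auto
    qed simp
    then have "lasserre_value I L \<le> (\<Sum>\<alpha>\<in>assignments S k. Z S \<alpha> * (lasserre_value I L - \<epsilon> + loss \<alpha>))"
      unfolding lasserre_value_eq[OF S] by (rule sum_mono)
    also have "\<dots> = (lasserre_value I L - \<epsilon>) * (\<Sum>\<alpha>\<in>assignments S k. Z S \<alpha>) + (\<Sum>\<alpha>\<in>assignments S k. Z S \<alpha> * loss \<alpha>)"
      by (simp add: sum_distrib_left sum.distrib sum_subtractf algebra_simps)
    finally show False using total unfolding Z1 by simp
  qed
qed

end

section \<open>Conditional expectations and integral solutions\<close>

definition point_row :: "nat \<Rightarrow> nat \<Rightarrow> real" where
  "point_row c a = of_bool (a = c)"

context regular_csp
begin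

lemma val_bounds: "0 \<le> val I x" "val I x \<le> 1"
  by (simp_all add: val_def)

lemma rounding_value_point_rows:
  assumes x: "\<And>i. i < n \<Longrightarrow> q i = point_row (x i)"
  shows "rounding_value q = val I x"
proof -
  have "product_value q c = of_bool (c \<in> {(i, j, R). (x i, x j) \<in> R})" if c: "c \<in> set_pmf I" for c
  proof -
    obtain i j R where cc: "c = (i, j, R)" by (cases c)
    have ij: "i < n" "j < n" and "R \<subseteq> {..<k} \<times> {..<k}" using set_I[OF c cc] by auto
    then have fR: "finite R" using finite_subset by blast
    have "product_value q c = (\<Sum>y\<in>R. if y = (x i, x j) then 1 else 0)"
      unfolding product_value_def cc using ij
      by (auto intro!: sum.cong simp: x point_row_def split: if_splits)
    then show ?thesis using fR by (simp add: cc)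
  qed
  then show ?thesis by (simp add: rounding_value_def val_def prob_I)
qed

text \<open>Multilinearity: a row is a combination of point rows, and each constraint that involves
  \<open>i\<close> is linear in this row, loops included. Constraints away from \<open>i\<close> use
  that the weights sum to one.\<close>

lemma rounding_value_row_average:
  assumes i: "i < n" and q1: "(\<Sum>a<k. q i a) = 1"
  shows "rounding_value q = (\<Sum>c<k. q i c * rounding_value (q(i := point_row c)))"
proof -
  have "product_value q d = (\<Sum>c<k. q i c * product_value (q(i := point_row c)) d)" if d: "d \<in> set_pmf I" for d
  proof -
    obtain i' j' R where dd: "d = (i', j', R)" by (cases d)
    have R: "R \<subseteq> {..<k} \<times> {..<k}" using set_I[OF d dd] by auto
    let ?f = "\<lambda>q (a, b). if i' = j' then of_bool (a = b) * q i' a else q i' a * (q j' b :: real)"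
    have pt: "(\<Sum>c<k. q i c * point_row c a) = q i a" if "a < k" for a
      using that by (simp add: point_row_def of_bool_def if_distrib cong: if_cong)
    have pt': "(\<Sum>c<k. q i c * (point_row c a * y)) = q i a * y"
      "(\<Sum>c<k. q i c * (y * point_row c a)) = y * q i a" if "a < k" for a y
      using pt[OF that] by (simp_all add: mult.assoc[symmetric] sum_distrib_right[symmetric])
        (simp add: mult.commute[of _ y] mult.assoc sum_distrib_left[symmetric])
    have c1: "(\<Sum>c<k. q i c * y) = y" for y using q1 by (simp add: sum_distrib_right[symmetric])
    have "?f q y = (\<Sum>c<k. q i c * ?f (q(i := point_row c)) y)" if "y \<in> R" for y
    proof -
      obtain a b where y: "y = (a, b)" by (cases y)
      have ab: "a < k" "b < k" using R that y by auto
      show ?thesis unfolding y using ab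
        by (cases "i' = i"; cases "j' = i"; cases "a = b") (auto simp: pt pt' c1)
    qed
    then have "product_value q d = (\<Sum>y\<in>R. \<Sum>c<k. q i c * ?f (q(i := point_row c)) y)"
      unfolding product_value_def dd prod.case by (rule sum.cong[OF refl])
    also have "\<dots> = (\<Sum>c<k. \<Sum>y\<in>R. q i c * ?f (q(i := point_row c)) y)" by (rule sum.swap)
    finally show ?thesis unfolding product_value_def dd prod.case by (simp only: sum_distrib_left)
  qed
  then have "rounding_value q = (\<Sum>d\<in>set_pmf I. \<Sum>c<k. pmf I d * (q i c * product_value (q(i := point_row c)) d))"
    by (simp add: rounding_value_def sum_distrib_left)
  also have "\<dots> = (\<Sum>c<k. \<Sum>d\<in>set_pmf I. pmf I d * (q i c * product_value (q(i := point_row c)) d))"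
    by (rule sum.swap)
  finally show ?thesis by (simp add: rounding_value_def sum_distrib_left mult.left_commute)
qed

lemma rounding_value_le_best_row:
  assumes i: "i < n" and q1: "(\<Sum>a<k. q i a) = 1" and q0: "\<And>a. a < k \<Longrightarrow> 0 \<le> q i a"
    and best: "\<And>a. a < k \<Longrightarrow> rounding_value (q(i := point_row a)) \<le> v"
  shows "rounding_value q \<le> v"
proof -
  have "rounding_value q \<le> (\<Sum>c<k. q i c * v)"
    unfolding rounding_value_row_average[of i q, OF i q1] by (intro sum_mono mult_left_mono best q0) auto
  also have "\<dots> = v" using q1 by (simp add: sum_distrib_right[symmetric])
  finally show ?thesis .
qed

text \<open>Fixing rows one at a time at a best letter never lowers the value. This form serves the
  bound on the relaxation; the program makes the same kind of choices and is verified
  separately.\<close>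

lemma conditional_expectations_assignment:
  assumes q1: "\<And>i. i < n \<Longrightarrow> (\<Sum>a<k. q i a) = 1" and q0: "\<And>i a. i < n \<Longrightarrow> a < k \<Longrightarrow> 0 \<le> q i a"
  shows "\<exists>x\<in>assignments {..<n} k. rounding_value q \<le> val I x"
proof -
  have "\<exists>x. (\<forall>i<t. x i < k) \<and> rounding_value q \<le> rounding_value (\<lambda>i. if i < t then point_row (x i) else q i)"
    if "t \<le> n" for t
    using that
  proof (induction t)
    case (Suc t)
    then obtain x where x: "\<forall>i<t. x i < k"
      and le: "rounding_value q \<le> rounding_value (\<lambda>i. if i < t then point_row (x i) else q i)" (is "_ \<le> rounding_value ?q")
      by auto
    let ?v = "\<lambda>a. rounding_value (?q(t := point_row a))"
    have "\<exists>c<k. \<forall>a<k. ?v a \<le> ?v c"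
    proof -
      have "Max (?v ` {..<k}) \<in> ?v ` {..<k}" using k_pos by (intro Max_in) auto
      then obtain c where c: "c < k" "Max (?v ` {..<k}) = ?v c" by blast
      have "?v a \<le> ?v c" if "a < k" for a unfolding c(2)[symmetric] using that by (intro Max_ge) auto
      then show ?thesis using c(1) by blast
    qed
    then obtain c where c: "c < k" "\<forall>a<k. ?v a \<le> ?v c" by blast
    have "rounding_value ?q \<le> ?v c"
      by (rule rounding_value_le_best_row[of t]) (use Suc.prems q1 q0 c in auto)
    moreover have "?q(t := point_row c) = (\<lambda>i. if i < Suc t then point_row ((x(t := c)) i) else q i)"
      by (auto simp: fun_eq_iff)
    ultimately show ?case using le x c(1) by (intro exI[of _ "x(t := c)"]) (auto simp: less_Suc_eq)
  qed simp
  from this[of n] obtain x where x: "\<forall>i<n. x i < k"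
    and le: "rounding_value q \<le> rounding_value (\<lambda>i. if i < n then point_row (x i) else q i)" by auto
  have "rounding_value (\<lambda>i. if i < n then point_row (x i) else q i) = val I (restrict x {..<n})"
    by (rule rounding_value_point_rows) simp
  moreover have "restrict x {..<n} \<in> assignments {..<n} k" using x by (auto simp: assignments_def)
  ultimately show ?thesis using le by auto
qed

section \<open>Comparison of the optimum over assignments with the relaxation\<close>

lemma objective_value_ge: "x \<in> assignments {..<n} k \<Longrightarrow> val I x \<le> objective_value n k I"
  unfolding objective_value_def by (intro Max_ge) (auto simp: finite_assignments)

lemma objective_value_attained: "\<exists>x\<in>assignments {..<n} k. val I x = objective_value n k I"
proof -
  have "restrict (\<lambda>_. 0) {..<n} \<in> assignments {..<n} k" using k_pos by (auto simp: assignments_def)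
  then have "val I ` assignments {..<n} k \<noteq> {}" by blast
  from Max_in[OF _ this] show ?thesis unfolding objective_value_def by (auto simp: finite_assignments)
qed

text \<open>Point distributions with one-dimensional 0/1 vectors. They show that the supremum ranges
  over a nonempty set and that \<open>sdpopt\<close> is at least the optimum over
  assignments.\<close>

definition integral_solution :: "(nat \<Rightarrow> nat) \<Rightarrow> lasserre" where
  "integral_solution x = \<lparr>local_dist = \<lambda>T. return_pmf (restrict x T), vec_dim = 1,
    lvec = \<lambda>S \<alpha>. vec 1 (\<lambda>_. of_bool (\<alpha> = restrict x S))\<rparr>"

lemma integral_solution_lasserre:
  assumes x: "x \<in> assignments {..<n} k"
  shows "lasserre_solution n k r (integral_solution x)"
  unfolding lasserre_solution_def
proof (intro conjI ballI impI)
  fix T assume "T \<in> small_sets n r"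
  then show "set_pmf (local_dist (integral_solution x) T) \<subseteq> assignments T k"
    using x by (auto simp: integral_solution_def assignments_def small_sets_def)
next
  fix S T \<alpha> \<beta>
  show "lvec (integral_solution x) S \<alpha> \<bullet> lvec (integral_solution x) T \<beta> =
    measure_pmf.prob (local_dist (integral_solution x) (S \<union> T)) {x. restrict x S = \<alpha> \<and> restrict x T = \<beta>}"
    by (auto simp: integral_solution_def scalar_prod_def indicator_def Int_absorb1 Int_absorb2)
qed (auto simp: integral_solution_def Int_ac)

lemma integral_solution_value: "lasserre_value I (integral_solution x) = val I x"
proof -
  have "lasserre_value I (integral_solution x) = measure_pmf.expectation I (indicator {(i, j, R). (x i, x j) \<in> R})"
    unfolding lasserre_value_def integral_solution_def
    by (intro Bochner_Integration.integral_cong) (auto simp: indicator_def)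
  then show ?thesis by (simp add: val_def)
qed

lemma lasserre_value_le_1: "lasserre_value I L \<le> 1"
proof -
  have "lasserre_value I L \<le> measure_pmf.expectation I (\<lambda>_. 1)"
    unfolding lasserre_value_def
    by (intro integral_mono measure_pmf.integrable_const_bound[where B = 1])
      (auto simp: case_prod_unfold intro!: measure_pmf.integrable_const_bound[where B = 1])
  then show ?thesis by simp
qed

lemma objective_value_le_sdpopt: "objective_value n k I \<le> sdpopt n k r I"
proof -
  obtain x where x: "x \<in> assignments {..<n} k" "val I x = objective_value n k I"
    using objective_value_attained by blast
  have "lasserre_value I (integral_solution x) \<le> sdpopt n k r I"
    unfolding sdpopt_def
    by (rule cSUP_upper) (auto intro!: bdd_aboveI2[where M = 1] lasserre_value_le_1 integral_solution_lasserre x)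
  then show ?thesis by (simp add: integral_solution_value x)
qed

lemma sdpopt_le:
  assumes "\<And>L. lasserre_solution n k r L \<Longrightarrow> lasserre_value I L \<le> b"
  shows "sdpopt n k r I \<le> b"
proof -
  obtain x where "x \<in> assignments {..<n} k" using objective_value_attained by blast
  then have "{L. lasserre_solution n k r L} \<noteq> {}" using integral_solution_lasserre by blast
  then show ?thesis unfolding sdpopt_def by (rule cSUP_least) (use assms in auto)
qed

end

context csp_relaxation
begin

lemma cp_distribution:
  assumes "S \<in> seeds" "\<alpha> \<in> assignments S k" "0 < Z S \<alpha>" "i < n"
  shows "(\<Sum>a<k. cp S \<alpha> i a) = 1" and "\<And>a. 0 \<le> cp S \<alpha> i a"
  using pairwise_distribution.p_sum[OF conditional_pairwise_distribution[OF assms(1-3)] assms(4)]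
  by (simp_all add: cp_def G_nonneg Z_nonneg)

lemma lasserre_value_le_objective:
  assumes "0 < \<epsilon>"
    and "real k * real (csp_threshold_rank n I ((\<epsilon> / real k) powr 3)) / \<epsilon> powr 3 \<le> real r"
  shows "lasserre_value I L \<le> objective_value n k I + \<epsilon>"
proof (cases "\<epsilon> \<le> 1")
  case True
  obtain S \<alpha> where S: "S \<in> seeds" "\<alpha> \<in> assignments S k" "0 < Z S \<alpha>"
    and lt: "lasserre_value I L - \<epsilon> < rounding_value (cp S \<alpha>)"
    using exists_good_seed[OF assms(1) True assms(2)] by blast
  obtain x where "x \<in> assignments {..<n} k" "rounding_value (cp S \<alpha>) \<le> val I x"
    using conditional_expectations_assignment[of "cp S \<alpha>"] cp_distribution[OF S] by blast
  then show ?thesis using lt objective_value_ge[of x] by simp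
next
  case False
  obtain x where "val I x = objective_value n k I" using objective_value_attained by blast
  then have "0 \<le> objective_value n k I" using val_bounds(1)[of x] by simp
  then show ?thesis using False lasserre_value_le_1[of L] by simp
qed

end

section \<open>Programs with time bounds\<close>

text \<open>Termination, postcondition and time in one predicate. An upper bound instead of an exact
  time lets the branches of a conditional and the iterations of a loop share one figure.\<close>

definition runs :: "prog \<Rightarrow> state \<Rightarrow> nat \<Rightarrow> (state \<Rightarrow> bool) \<Rightarrow> bool" where
  "runs p s T Q \<longleftrightarrow> (\<exists>t s'. exec p s t s' \<and> t \<le> T \<and> Q s')"

lemma runs_mono: "runs p s T Q \<Longrightarrow> T \<le> T' \<Longrightarrow> (\<And>s'. Q s' \<Longrightarrow> Q' s') \<Longrightarrow> runs p s T' Q'"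
  unfolding runs_def by (meson le_trans)

lemma runs_Skip: "Q s \<Longrightarrow> 1 \<le> T \<Longrightarrow> runs Skip s T Q"
  unfolding runs_def using exec.Skip by blast

lemma runs_NAssign:
  "Q (store (fst s) a (nval e s) (nval f s), snd s) \<Longrightarrow> 1 \<le> T \<Longrightarrow> runs (NAssign a e f) s T Q"
  unfolding runs_def using exec.NAssign by blast

lemma runs_RAssign:
  "Q (fst s, store (snd s) a (nval e s) (rval f s)) \<Longrightarrow> 1 \<le> T \<Longrightarrow> runs (RAssign a e f) s T Q"
  unfolding runs_def using exec.RAssign by blast

lemma runs_Seq: "runs p s T (\<lambda>s'. runs q s' T' Q) \<Longrightarrow> runs (Seq p q) s (T + T') Q"
  unfolding runs_def by (meson add_mono exec.Seq)

lemma runs_Cond: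
  assumes "tval b s \<Longrightarrow> runs p s T Q" and "\<not> tval b s \<Longrightarrow> runs q s T Q"
  shows "runs (Cond b p q) s (Suc T) Q"
proof (cases "tval b s")
  case True
  then obtain t s' where "exec p s t s'" "t \<le> T" "Q s'" using assms(1) unfolding runs_def by blast
  then show ?thesis unfolding runs_def using exec.CondTrue[OF True, of p t s' q] by (intro exI[of _ "t + 1"] exI[of _ s']) simp
next
  case False
  then obtain t s' where "exec q s t s'" "t \<le> T" "Q s'" using assms(2) unfolding runs_def by blast
  then show ?thesis unfolding runs_def using exec.CondFalse[OF False, of q t s' p] by (intro exI[of _ "t + 1"] exI[of _ s']) simp
qed

text \<open>Lists the arrays that may have changed; facts about all others carry over, so a
  program's specification only describes what it writes.\<close>

definition frame :: "nat set \<Rightarrow> nat set \<Rightarrow> state \<Rightarrow> state \<Rightarrow> bool" where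
  "frame W V s s' \<longleftrightarrow> (\<forall>a. a \<notin> W \<longrightarrow> fst s' a = fst s a) \<and> (\<forall>a. a \<notin> V \<longrightarrow> snd s' a = snd s a)"

lemma frame_nat: "frame W V s s' \<Longrightarrow> a \<notin> W \<Longrightarrow> fst s' a = fst s a"
  and frame_real: "frame W V s s' \<Longrightarrow> a \<notin> V \<Longrightarrow> snd s' a = snd s a"
  by (simp_all add: frame_def)

lemma frame_refl: "frame W V s s"
  by (simp add: frame_def)

lemma frame_trans: "frame W V s s' \<Longrightarrow> frame W' V' s' s'' \<Longrightarrow> W \<subseteq> X \<Longrightarrow> W' \<subseteq> X \<Longrightarrow> V \<subseteq> Y \<Longrightarrow> V' \<subseteq> Y \<Longrightarrow> frame X Y s s''"
  unfolding frame_def by (metis subsetD)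

lemma frame_mono: "frame W V s s' \<Longrightarrow> W \<subseteq> X \<Longrightarrow> V \<subseteq> Y \<Longrightarrow> frame X Y s s'"
  unfolding frame_def by blast

lemma store_apply: "store M a i y b = (if a = b then (M a)(i := y) else M b)"
  by (simp add: store_def)

lemma frame_store_nat: "frame W V s s' \<Longrightarrow> a \<in> W \<Longrightarrow> frame W V s (store (fst s') a i y, snd s')"
  by (auto simp: frame_def store_apply)

lemma frame_store_real: "frame W V s s' \<Longrightarrow> a \<in> V \<Longrightarrow> frame W V s (fst s', store (snd s') a i y)"
  by (auto simp: frame_def store_apply)

section \<open>Scalar variables and counted loops\<close>

abbreviation nvar :: "nat \<Rightarrow> nexp" where "nvar v \<equiv> NCell v (NConst 0)"
abbreviation rvar :: "nat \<Rightarrow> rexp" where "rvar v \<equiv> RCell v (NConst 0)"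

definition For :: "nat \<Rightarrow> nexp \<Rightarrow> prog \<Rightarrow> prog" where
  "For v b body = Seq (NAssign v (NConst 0) (NConst 0))
    (While (NLess (nvar v) b) (Seq body (NAssign v (NConst 0) (NAdd (nvar v) (NConst 1)))))"

definition TOr :: "test \<Rightarrow> test \<Rightarrow> test" where "TOr b c = TNot (TAnd (TNot b) (TNot c))"
definition TEq :: "nexp \<Rightarrow> nexp \<Rightarrow> test" where "TEq e f = TAnd (TNot (NLess e f)) (TNot (NLess f e))"

lemma tval_TOr[simp]: "tval (TOr b c) s \<longleftrightarrow> tval b s \<or> tval c s"
  by (simp add: TOr_def)

lemma tval_TEq[simp]: "tval (TEq e f) s \<longleftrightarrow> nval e s = nval f s"
  by (auto simp: TEq_def)

lemma runs_While_upto: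
  assumes step: "\<And>i s. i < m \<Longrightarrow> Inv i s \<Longrightarrow>
      runs body s T (\<lambda>s'. fst s' v 0 = i \<and> Inv (Suc i) (store (fst s') v 0 (Suc i), snd s'))"
    and cnt: "\<And>i s. Inv i s \<Longrightarrow> fst s v 0 = i \<and> nval b s = m"
  shows "i \<le> m \<Longrightarrow> Inv i s \<Longrightarrow>
    runs (While (NLess (nvar v) b) (Seq body (NAssign v (NConst 0) (NAdd (nvar v) (NConst 1))))) s
      ((m - i) * (T + 2) + 1) (Inv m)"
proof (induction "m - i" arbitrary: i s)
  case 0
  then have "i = m" by simp
  then show ?case using 0 cnt[of i s] exec.WhileFalse[of "NLess (nvar v) b" s]
    unfolding runs_def by (intro exI[of _ 1] exI[of _ s]) auto
next
  case (Suc d)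
  let ?body = "Seq body (NAssign v (NConst 0) (NAdd (nvar v) (NConst 1)))"
  have i: "i < m" using Suc.hyps(2) by simp
  obtain t s' where b: "exec body s t s'" "t \<le> T" "fst s' v 0 = i"
    and inv: "Inv (Suc i) (store (fst s') v 0 (Suc i), snd s')"
    using step[OF i Suc.prems(2)] unfolding runs_def by blast
  let ?s = "(store (fst s') v 0 (Suc i), snd s')"
  have "exec ?body s (t + 1) ?s"
    using exec.Seq[OF b(1) exec.NAssign[of v "NConst 0" "NAdd (nvar v) (NConst 1)" s']] b(3) by simp
  moreover have "runs (While (NLess (nvar v) b) ?body) ?s ((m - Suc i) * (T + 2) + 1) (Inv m)"
    by (rule Suc.hyps(1)) (use Suc.hyps(2) i inv in auto)
  then obtain t' s'' where w: "exec (While (NLess (nvar v) b) ?body) ?s t' s''"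
    "t' \<le> (m - Suc i) * (T + 2) + 1" "Inv m s''"
    unfolding runs_def by blast
  ultimately have "exec (While (NLess (nvar v) b) ?body) s (t + 1 + t' + 1) s''"
    using cnt[OF Suc.prems(2)] i by (intro exec.WhileTrue) auto
  moreover have "m - i = Suc (m - Suc i)" using i by simp
  then have "t + 1 + t' + 1 \<le> (m - i) * (T + 2) + 1" using b(2) w(2) by simp
  ultimately show ?case using w(3) unfolding runs_def by blast
qed

text \<open>Two extra steps per iteration for the test and the increment, and two outside for the
  initialisation and the last, failing test.\<close>

definition tfor :: "nat \<Rightarrow> nat \<Rightarrow> nat" where "tfor N T = N * (T + 2) + 2"

text \<open>The bound is evaluated anew at every test, so its value must be stable under all writes
  of the loop. The body must not write the counter, hence the frame without \<open>v\<close>, and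
  \<open>P\<close> must not depend on it, hence \<open>indep\<close>. Bounding \<open>m\<close> by
  \<open>N\<close> makes the time a function of the input size alone.\<close>

lemma runs_For:
  assumes v: "v \<in> W" and b: "\<And>s. frame W V s0 s \<Longrightarrow> nval b s = m" and m: "m \<le> N"
    and P0: "P 0 s0" and indep: "\<And>i s x. P i s \<Longrightarrow> P i (store (fst s) v 0 x, snd s)"
    and step: "\<And>i s. i < m \<Longrightarrow> frame W V s0 s \<Longrightarrow> fst s v 0 = i \<Longrightarrow> P i s \<Longrightarrow>
      runs body s T (\<lambda>s'. frame (W - {v}) V s s' \<and> P (Suc i) s')"
  shows "runs (For v b body) s0 (tfor N T) (\<lambda>s. frame W V s0 s \<and> P m s)"
proof -
  let ?Inv = "\<lambda>i s. frame W V s0 s \<and> fst s v 0 = i \<and> P i s"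
  let ?s = "(store (fst s0) v 0 0, snd s0)"
  have "runs (While (NLess (nvar v) b) (Seq body (NAssign v (NConst 0) (NAdd (nvar v) (NConst 1))))) ?s
      ((m - 0) * (T + 2) + 1) (?Inv m)"
  proof (rule runs_While_upto)
    show "?Inv 0 ?s" using P0 indep v by (auto simp: store_apply intro: frame_store_nat frame_refl)
    show "runs body s T (\<lambda>s'. fst s' v 0 = i \<and> ?Inv (Suc i) (store (fst s') v 0 (Suc i), snd s'))"
      if "i < m" "?Inv i s" for i s
    proof (rule runs_mono[OF step])
      fix s' assume s': "frame (W - {v}) V s s' \<and> P (Suc i) s'"
      have "frame W V s0 s'" by (rule frame_trans[of W V s0 s "W - {v}" V]) (use that s' in auto)
      then show "fst s' v 0 = i \<and> ?Inv (Suc i) (store (fst s') v 0 (Suc i), snd s')"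
        using s' that v frame_nat[of "W - {v}" V s s' v]
        by (auto simp: store_apply intro: frame_store_nat indep)
    qed (use that in auto)
  qed (use b in auto)
  then have "runs (For v b body) s0 (1 + ((m - 0) * (T + 2) + 1)) (?Inv m)"
    unfolding For_def by (intro runs_Seq runs_NAssign) simp_all
  then show ?thesis
    by (rule runs_mono) (use mult_le_mono1[OF m, of "T + 2"] in \<open>simp_all add: tfor_def\<close>)
qed

text \<open>Repeated addition along the array. Cell 0 is never written and relies on memory being
  zero at the start.\<close>

definition table_prog :: "nat \<Rightarrow> nexp \<Rightarrow> nexp \<Rightarrow> prog" where
  "table_prog arr b d = For 10 b (NAssign arr (NAdd (nvar 10) (NConst 1)) (NAdd (NCell arr (nvar 10)) d))"

lemma runs_table:
  assumes b: "\<And>s. frame {10, arr} {} s0 s \<Longrightarrow> nval b s = m" and m: "m \<le> N"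
    and d: "\<And>s. frame {10, arr} {} s0 s \<Longrightarrow> nval d s = D"
    and arr: "arr \<noteq> 10" and s0: "fst s0 arr 0 = 0"
  shows "runs (table_prog arr b d) s0 (tfor N 1) (\<lambda>s. frame {10, arr} {} s0 s \<and> (\<forall>i\<le>m. fst s arr i = i * D))"
  unfolding table_prog_def
proof (rule runs_For[where P = "\<lambda>m s. \<forall>i\<le>m. fst s arr i = i * D"])
  fix i s assume "i < m" and f: "frame {10, arr} {} s0 s" and "fst s 10 0 = i" "\<forall>j\<le>i. fst s arr j = j * D"
  then show "runs (NAssign arr (NAdd (nvar 10) (NConst 1)) (NAdd (NCell arr (nvar 10)) d)) s 1
    (\<lambda>s'. frame ({10, arr} - {10}) {} s s' \<and> (\<forall>j\<le>Suc i. fst s' arr j = j * D))"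
    using arr d[OF f]
    by (intro runs_NAssign) (auto simp: store_apply le_Suc_eq intro: frame_store_nat frame_refl)
qed (use b m s0 arr in \<open>auto simp: store_apply\<close>)

text \<open>Arrays of naturals: 6, 7 and 8 hold the multiples of \<open>k\<close>, \<open>n\<close> and \<open>k * k\<close> used for indexing, since there
  is no multiplication on naturals; 22 is the assignment under construction. Cells
  in use: 11 and 14 run over the listed index pairs, 12 over variables, 13 over letters, 15 over
  the entries of a row, 16 is the result of a row comparison, 17 runs over constraints,
  18 and 19 over pairs of letters, 20 is the best letter so far.
  Arrays of reals: 3 is the current product distribution, 4 its value, 5 the value for the best
  letter, 6 the value of the output so far.

  The test compares entry 15 of row 14 with that of row 11 after its entry 12 is set to letter 13.
  It fails if row 11 already assigns another letter to this variable.\<close>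

definition index_test :: test where
  "index_test = TOr
    (TAnd (TEq (nvar 15) (nvar 12))
      (TAnd (TEq (NCell 4 (NAdd (NCell 7 (nvar 14)) (nvar 15))) (NAdd (nvar 13) (NConst 1)))
        (TOr (TEq (NCell 4 (NAdd (NCell 7 (nvar 11)) (nvar 15))) (NConst 0))
          (TEq (NCell 4 (NAdd (NCell 7 (nvar 11)) (nvar 15))) (NAdd (nvar 13) (NConst 1))))))
    (TAnd (TNot (TEq (nvar 15) (nvar 12)))
      (TEq (NCell 4 (NAdd (NCell 7 (nvar 14)) (nvar 15))) (NCell 4 (NAdd (NCell 7 (nvar 11)) (nvar 15)))))"

abbreviation n_par :: nexp where "n_par \<equiv> NCell 1 (NConst 0)"
abbreviation k_par :: nexp where "k_par \<equiv> NCell 1 (NConst 1)"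
abbreviation C_par :: nexp where "C_par \<equiv> NCell 1 (NConst 4)"
abbreviation E_par :: nexp where "E_par \<equiv> NCell 1 (NConst 5)"

abbreviation q_cell :: nexp where "q_cell \<equiv> NAdd (NCell 6 (nvar 12)) (nvar 13)"

definition match_prog :: prog where
  "match_prog = For 15 n_par (Cond index_test Skip (NAssign 16 (NConst 0) (NConst 0)))"

text \<open>The index pairs come in arbitrary order, so the entry that extends the current row by
  the current variable and letter is found by scanning all rows.\<close>

definition marginal_prog :: prog where
  "marginal_prog = For 14 E_par (Seq (NAssign 16 (NConst 0) (NConst 1)) (Seq match_prog
    (Cond (NLess (NConst 0) (nvar 16))
      (RAssign 3 q_cell (RAdd (RCell 3 q_cell) (RDiv (RCell 1 (nvar 14)) (RCell 1 (nvar 11))))) Skip)))"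

definition extract_prog :: prog where
  "extract_prog = For 12 n_par (For 13 k_par (Seq (RAssign 3 q_cell (RNat (NConst 0))) marginal_prog))"

text \<open>Subtraction on naturals truncates at zero, so one minus the distance of two letters is
  the indicator of their equality.\<close>

definition point_prog :: "nat \<Rightarrow> prog" where
  "point_prog v = For 21 k_par (RAssign 3 (NAdd (NCell 6 (nvar 12)) (nvar 21))
    (RNat (NSub (NConst 1) (NAdd (NSub (nvar 21) (nvar v)) (NSub (nvar v) (nvar 21))))))"

abbreviation first_var :: nexp where "first_var \<equiv> NCell 2 (NAdd (nvar 17) (nvar 17))"
abbreviation second_var :: nexp where "second_var \<equiv> NCell 2 (NAdd (NAdd (nvar 17) (nvar 17)) (NConst (Suc 0)))"

definition term_prog :: prog where
  "term_prog = Cond (NLess (NConst 0) (NCell 3 (NAdd (NAdd (NCell 8 (nvar 17)) (NCell 6 (nvar 18))) (nvar 19))))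
    (Cond (TEq first_var second_var)
      (Cond (TEq (nvar 18) (nvar 19))
        (RAssign 4 (NConst 0) (RAdd (rvar 4) (RMul (RCell 0 (nvar 17)) (RCell 3 (NAdd (NCell 6 first_var) (nvar 18)))))) Skip)
      (RAssign 4 (NConst 0) (RAdd (rvar 4) (RMul (RCell 0 (nvar 17))
        (RMul (RCell 3 (NAdd (NCell 6 first_var) (nvar 18))) (RCell 3 (NAdd (NCell 6 second_var) (nvar 19))))))))
    Skip"

definition eval_prog :: prog where
  "eval_prog = Seq (RAssign 4 (NConst 0) (RNat (NConst 0)))
    (For 17 C_par (For 18 k_par (For 19 k_par term_prog)))"

text \<open>Letter 0 is always accepted, because the record cell may still hold a value from an
  earlier variable.\<close>

definition choose_prog :: prog where
  "choose_prog = For 13 k_par (Seq (point_prog 13) (Seq eval_prog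
    (Cond (TOr (TEq (nvar 13) (NConst 0)) (RLess (rvar 5) (rvar 4)))
      (Seq (RAssign 5 (NConst 0) (rvar 4)) (NAssign 20 (NConst 0) (nvar 13))) Skip)))"

definition greedy_prog :: prog where
  "greedy_prog = For 12 n_par (Seq choose_prog (Seq (point_prog 20) (NAssign 22 (nvar 12) (nvar 20))))"

definition copy_prog :: prog where
  "copy_prog = For 23 n_par (NAssign 0 (nvar 23) (NCell 22 (nvar 23)))"

text \<open>The first index pair is accepted without comparison; from then on the output is a valid
  assignment whose value is the record. \<open>eval_prog\<close> runs again because the last
  evaluation in \<open>choose_prog\<close> need not belong to the chosen letter.\<close>

definition seed_prog :: prog where
  "seed_prog = Seq extract_prog (Seq greedy_prog (Seq eval_prog
    (Cond (TOr (TEq (nvar 11) (NConst 0)) (RLess (rvar 6) (rvar 4)))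
      (Seq (RAssign 6 (NConst 0) (rvar 4)) copy_prog) Skip)))"

definition rounding_prog :: prog where
  "rounding_prog = Seq (table_prog 6 (NAdd n_par k_par) k_par) (Seq (table_prog 7 E_par n_par)
    (Seq (table_prog 8 C_par (NCell 6 k_par)) (For 11 E_par seed_prog)))"

text \<open>The data that the program reads, detached from the CSP and its encoding. The common
  bound \<open>N\<close> on all loop lengths later becomes the input size.\<close>

locale rounding_input =
  fixes n k E C N :: nat and row :: "nat \<Rightarrow> nat \<Rightarrow> nat" and bit :: "nat \<Rightarrow> nat \<Rightarrow> nat \<Rightarrow> bool"
    and ep1 ep2 :: "nat \<Rightarrow> nat" and w pm :: "nat \<Rightarrow> real"
  assumes sizes: "n \<le> N" "k \<le> N" "E \<le> N" "C \<le> N" and pos: "0 < k" "0 < E"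
    and ep: "\<And>c. c < C \<Longrightarrow> ep1 c < n" "\<And>c. c < C \<Longrightarrow> ep2 c < n"
begin

definition base :: "state \<Rightarrow> bool" where
  "base s \<longleftrightarrow> fst s 1 0 = n \<and> fst s 1 (Suc 0) = k \<and> fst s 1 4 = C \<and> fst s 1 5 = E \<and>
    (\<forall>c<C. fst s 2 (c + c) = ep1 c \<and> fst s 2 (Suc (c + c)) = ep2 c) \<and>
    (\<forall>c<C. \<forall>a<k. \<forall>b<k. fst s 3 (c * (k * k) + a * k + b) = of_bool (bit c a b)) \<and>
    (\<forall>e<E. \<forall>l<n. fst s 4 (e * n + l) = row e l) \<and>
    (\<forall>c<C. snd s 0 c = w c) \<and> (\<forall>e<E. snd s 1 e = pm e)"

text \<open>The multiples of \<open>k\<close> serve the rows of the product distribution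
  (\<open>i < n\<close>), the rows of a predicate (\<open>a < k\<close>) and, at index
  \<open>k\<close> itself, the value \<open>k * k\<close>.\<close>

definition tables :: "state \<Rightarrow> bool" where
  "tables s \<longleftrightarrow> (\<forall>i\<le>n + k. fst s 6 i = i * k) \<and> (\<forall>e\<le>E. fst s 7 e = e * n) \<and> (\<forall>c\<le>C. fst s 8 c = c * (k * k))"

definition ready :: "state \<Rightarrow> bool" where "ready s \<longleftrightarrow> base s \<and> tables s"

lemma base_frame:
  assumes "base s" "frame W V s s'" "W \<inter> {1, 2, 3, 4} = {}" "V \<inter> {0, 1} = {}"
  shows "base s'"
proof -
  have "fst s' a = fst s a" if "a \<in> {1, 2, 3, 4}" for a using frame_nat[OF assms(2)] assms(3) that by blast
  moreover have "snd s' a = snd s a" if "a \<in> {0, 1}" for a using frame_real[OF assms(2)] assms(4) that by blast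
  ultimately show ?thesis using assms(1) by (simp add: base_def)
qed

lemma ready_frame:
  assumes "ready s" "frame W V s s'" "W \<inter> {1, 2, 3, 4, 6, 7, 8} = {}" "V \<inter> {0, 1} = {}"
  shows "ready s'"
proof -
  have "fst s' a = fst s a" if "a \<in> {6, 7, 8}" for a using frame_nat[OF assms(2)] assms(3) that by blast
  moreover have "base s'" by (rule base_frame[OF _ assms(2)]) (use assms in \<open>auto simp: ready_def\<close>)
  ultimately show ?thesis using assms(1) by (simp add: ready_def tables_def)
qed

definition qrep :: "state \<Rightarrow> (nat \<Rightarrow> nat \<Rightarrow> real) \<Rightarrow> bool" where
  "qrep s q \<longleftrightarrow> (\<forall>i<n. \<forall>a<k. snd s 3 (i * k + a) = q i a)"

lemma index_inj: "a < k \<Longrightarrow> a' < k \<Longrightarrow> i * k + a = i' * k + a' \<Longrightarrow> i = i' \<and> a = a'" for i i' a a' :: nat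
  by (metis add.commute div_mult_self1 mod_mult_self1 div_less mod_less add_0 not_less0)

lemma qrep_store:
  assumes "qrep s q" "a < k" "x = i * k + a"
  shows "qrep (M, store (snd s) 3 x y) (q(i := (q i)(a := y)))"
  unfolding qrep_def
proof (intro allI impI)
  fix i' a' assume "i' < n" "a' < k"
  then show "snd (M, store (snd s) 3 x y) 3 (i' * k + a') = (q(i := (q i)(a := y))) i' a'"
    using assms index_inj[of a' a i' i] by (auto simp: qrep_def store_apply)
qed

lemma qrep_nat_store: "qrep s q \<Longrightarrow> qrep (M, snd s) q"
  by (simp add: qrep_def)

lemma qrep_frame: "qrep s q \<Longrightarrow> frame W V s s' \<Longrightarrow> 3 \<notin> V \<Longrightarrow> qrep s' q"
  by (simp add: qrep_def frame_real)

lemma qrep_cong: "qrep s q \<Longrightarrow> (\<And>i a. i < n \<Longrightarrow> a < k \<Longrightarrow> q i a = q' i a) \<Longrightarrow> qrep s q'"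
  by (simp add: qrep_def)

definition index_ok :: "nat \<Rightarrow> nat \<Rightarrow> nat \<Rightarrow> nat \<Rightarrow> nat \<Rightarrow> bool" where
  "index_ok e i a f l \<longleftrightarrow>
    (if l = i then row f l = Suc a \<and> (row e l = 0 \<or> row e l = Suc a) else row f l = row e l)"

text \<open>For distinct rows at most one \<open>f\<close> matches, so the sum is a lookup divided
  by the probability of the condition; a missing row gives zero.\<close>

definition seed_marginal :: "nat \<Rightarrow> nat \<Rightarrow> nat \<Rightarrow> real" where
  "seed_marginal e i a = (\<Sum>f<E. if \<forall>l<n. index_ok e i a f l then pm f / pm e else 0)"

lemma runs_match:
  assumes s0: "ready s0" "fst s0 11 0 = e" "e < E" "fst s0 12 0 = i" "fst s0 13 0 = a" "fst s0 14 0 = f" "f < E"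
    "fst s0 16 0 = 1"
  shows "runs match_prog s0 (tfor N 2)
    (\<lambda>s. frame {15, 16} {} s0 s \<and> fst s 16 0 = of_bool (\<forall>l<n. index_ok e i a f l))"
  unfolding match_prog_def
proof (rule runs_For[where P = "\<lambda>n s. fst s 16 0 = of_bool (\<forall>l<n. index_ok e i a f l)"])
  show "nval n_par s = n" if "frame {15, 16} {} s0 s" for s
    using ready_frame[OF s0(1) that] by (simp add: ready_def base_def)
next
  fix l s assume l: "l < n" and f: "frame {15, 16} {} s0 s" and lv: "fst s 15 0 = l"
    and P: "fst s 16 0 = of_bool (\<forall>l'<l. index_ok e i a f l')"
  have r: "ready s" by (rule ready_frame[OF s0(1) f]) auto
  have test: "tval index_test s \<longleftrightarrow> index_ok e i a f l"
    using r s0 l lv frame_nat[OF f] by (simp add: index_test_def index_ok_def ready_def base_def tables_def)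
  show "runs (Cond index_test Skip (NAssign 16 (NConst 0) (NConst 0))) s 2
    (\<lambda>s'. frame ({15, 16} - {15}) {} s s' \<and> fst s' 16 0 = of_bool (\<forall>l'<Suc l. index_ok e i a f l'))"
    unfolding numeral_2_eq_2
    by (rule runs_Cond; (rule runs_Skip | rule runs_NAssign))
      (use P test in \<open>auto simp: store_apply less_Suc_eq intro: frame_store_nat frame_refl\<close>)
qed (use sizes s0 in \<open>auto simp: store_apply\<close>)

lemma runs_marginal:
  assumes s0: "ready s0" "fst s0 11 0 = e" "e < E" "fst s0 12 0 = i" "i < n" "fst s0 13 0 = a" "a < k"
    and q: "qrep s0 (q(i := (q i)(a := 0)))"
  shows "runs marginal_prog s0 (tfor N (1 + (tfor N 2 + 2)))
    (\<lambda>s. frame {14, 15, 16} {3} s0 s \<and> qrep s (q(i := (q i)(a := seed_marginal e i a))))"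
proof -
  let ?sum = "RAdd (RCell 3 q_cell) (RDiv (RCell 1 (nvar 14)) (RCell 1 (nvar 11)))"
  let ?add = "RAssign 3 q_cell ?sum"
  let ?sel = "Cond (NLess (NConst 0) (nvar 16)) ?add Skip"
  let ?g = "\<lambda>f. if \<forall>l<n. index_ok e i a f l then pm f / pm e else 0"
  have "runs marginal_prog s0 (tfor N (1 + (tfor N 2 + 2)))
    (\<lambda>s. frame {14, 15, 16} {3} s0 s \<and> qrep s (q(i := (q i)(a := (\<Sum>f<E. ?g f)))))"
    unfolding marginal_prog_def
  proof (rule runs_For[where P = "\<lambda>E s. qrep s (q(i := (q i)(a := (\<Sum>f<E. ?g f))))"])
    show "nval E_par s = E" if "frame {14, 15, 16} {3} s0 s" for s
      using ready_frame[OF s0(1) that] by (simp add: ready_def base_def)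
  next
    fix f s assume f: "f < E" and fr: "frame {14, 15, 16} {3} s0 s" and fv: "fst s 14 0 = f"
      and P: "qrep s (q(i := (q i)(a := (\<Sum>f<f. ?g f))))"
    let ?s1 = "(store (fst s) 16 0 1, snd s)"
    let ?R = "\<lambda>s'. frame ({14, 15, 16} - {14}) {3} s s' \<and> qrep s' (q(i := (q i)(a := (\<Sum>f<Suc f. ?g f))))"
    have f1: "frame {14, 15, 16} {3} s0 ?s1" by (rule frame_store_nat[OF fr]) simp
    have r1: "ready ?s1" by (rule ready_frame[OF s0(1) f1]) auto
    show "runs (Seq (NAssign 16 (NConst 0) (NConst 1)) (Seq match_prog
        ?sel)) s
       (1 + (tfor N 2 + 2)) ?R"
    proof (intro runs_Seq runs_NAssign, unfold nval.simps)
      have "runs match_prog ?s1 (tfor N 2)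
          (\<lambda>s. frame {15, 16} {} ?s1 s \<and> fst s 16 0 = of_bool (\<forall>l<n. index_ok e i a f l))"
        by (rule runs_match) (use r1 frame_nat[OF fr] fv s0 f in \<open>auto simp: store_apply\<close>)
      then show "runs match_prog ?s1 (tfor N 2) (\<lambda>s'. runs ?sel s' 2
        ?R)"
      proof (rule runs_mono)
        fix s2 assume "frame {15, 16} {} ?s1 s2 \<and> fst s2 16 0 = of_bool (\<forall>l<n. index_ok e i a f l)"
        then have f2: "frame {15, 16} {} ?s1 s2" and m: "fst s2 16 0 = of_bool (\<forall>l<n. index_ok e i a f l)" by auto
        have fs: "frame {15, 16} {3} s s2"
          by (rule frame_trans[OF _ f2, of "{16}" "{}"]) (auto intro: frame_store_nat frame_refl)
        have r2: "ready s2" by (rule ready_frame[OF r1 f2]) auto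
        have q2: "qrep s2 (q(i := (q i)(a := (\<Sum>f<f. ?g f))))"
          using qrep_frame[OF qrep_nat_store[OF P] f2] by simp
        have v: "fst s2 11 0 = e" "fst s2 12 0 = i" "fst s2 13 0 = a" "fst s2 14 0 = f"
          using frame_nat[OF fs] frame_nat[OF fr] fv s0 by simp_all
        have cell: "nval q_cell s2 = i * k + a" using r2 v s0(5) by (simp add: ready_def tables_def)
        have val: "snd s2 3 (i * k + a) = (\<Sum>f<f. ?g f)" "snd s2 1 f = pm f" "snd s2 1 e = pm e"
          using q2 r2 s0 f by (auto simp: qrep_def ready_def base_def)
        show "runs ?sel s2 2
          ?R"
          unfolding numeral_2_eq_2
        proof (rule runs_Cond)
          assume t: "tval (NLess (NConst 0) (nvar 16)) s2"
          show "runs ?add s2 (Suc 0)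
            ?R"
          proof (rule runs_RAssign, unfold cell, intro conjI)
            show "qrep (fst s2, store (snd s2) 3 (i * k + a) (rval ?sum s2))
              (q(i := (q i)(a := (\<Sum>f<Suc f. ?g f))))"
              using qrep_store[OF q2 s0(7) refl, of "fst s2" i "(\<Sum>f<Suc f. ?g f)"] t m val v cell
              by (simp split: if_splits)
            show "frame ({14, 15, 16} - {14}) {3} s (fst s2, store (snd s2) 3 (i * k + a)
              (rval ?sum s2))"
              by (rule frame_store_real) (use fs in \<open>auto elim: frame_mono\<close>)
          qed simp
        next
          assume "\<not> tval (NLess (NConst 0) (nvar 16)) s2"
          then show "runs Skip s2 (Suc 0) ?R"
            by (intro runs_Skip) (use fs q2 m in \<open>auto elim: frame_mono split: if_splits\<close>)
        qed
      qed simp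
    qed simp
  qed (use sizes q in \<open>auto intro: qrep_nat_store\<close>)
  then show ?thesis by (simp only: seed_marginal_def)
qed

end

section \<open>Marginals and evaluation\<close>

context rounding_input
begin

lemma ready_pars:
  assumes "ready s"
  shows "nval n_par s = n" "nval k_par s = k" "nval C_par s = C" "nval E_par s = E"
  using assms by (simp_all add: ready_def base_def)

lemma runs_extract:
  assumes s0: "ready s0" "fst s0 11 0 = e" "e < E"
  shows "runs extract_prog s0 (tfor N (tfor N (1 + tfor N (1 + (tfor N 2 + 2)))))
    (\<lambda>s. frame {12, 13, 14, 15, 16} {3} s0 s \<and> qrep s (seed_marginal e))"
proof -
  let ?p = "Seq (RAssign 3 q_cell (RNat (NConst 0))) marginal_prog"
  let ?T = "tfor N (1 + tfor N (1 + (tfor N 2 + 2)))"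
  \<comment> \<open>Names the leftover contents of array 3, so that the invariant can describe a
    partly overwritten table.\<close>
  define q0 where "q0 i a = snd s0 3 (i * k + a)" for i a
  let ?q = "\<lambda>i i'. if i' < i then seed_marginal e i' else q0 i'"
  have "runs extract_prog s0 (tfor N (?T))
    (\<lambda>s. frame {12, 13, 14, 15, 16} {3} s0 s \<and> qrep s (?q n))"
    unfolding extract_prog_def
  proof (rule runs_For[where P = "\<lambda>i s. qrep s (?q i)"])
    fix i s assume i: "i < n" and f: "frame {12, 13, 14, 15, 16} {3} s0 s" and iv: "fst s 12 0 = i"
      and P: "qrep s (?q i)"
    have r: "ready s" by (rule ready_frame[OF s0(1) f]) auto
    let ?y = "\<lambda>a a'. if a' < a then seed_marginal e i a' else q0 i a'"
    have "runs (For 13 k_par ?p) s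
        (?T)
        (\<lambda>s'. frame {13, 14, 15, 16} {3} s s' \<and> qrep s' ((?q i)(i := ?y k)))"
    proof (rule runs_For[where P = "\<lambda>a s. qrep s ((?q i)(i := ?y a))"])
      fix a s1 assume a: "a < k" and f1: "frame {13, 14, 15, 16} {3} s s1" and av: "fst s1 13 0 = a"
        and P1: "qrep s1 ((?q i)(i := ?y a))"
      have r1: "ready s1" by (rule ready_frame[OF r f1]) auto
      have v: "fst s1 11 0 = e" "fst s1 12 0 = i" using frame_nat[OF f1] frame_nat[OF f] s0 iv by simp_all
      have cell: "nval q_cell s1 = i * k + a" using r1 v av i by (simp add: ready_def tables_def)
      let ?s2 = "(fst s1, store (snd s1) 3 (i * k + a) 0)"
      let ?q1 = "(?q i)(i := ?y a)"
      show "runs ?p s1 (1 + tfor N (1 + (tfor N 2 + 2)))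
        (\<lambda>s'. frame ({13, 14, 15, 16} - {13}) {3} s1 s' \<and> qrep s' ((?q i)(i := ?y (Suc a))))"
      proof (intro runs_Seq runs_RAssign, unfold cell, unfold rval.simps nval.simps)
        have f2: "frame {} {3} s1 ?s2" by (intro frame_store_real frame_refl) simp
        have "runs marginal_prog ?s2 (tfor N (1 + (tfor N 2 + 2)))
          (\<lambda>s. frame {14, 15, 16} {3} ?s2 s \<and> qrep s (?q1(i := (?q1 i)(a := seed_marginal e i a))))"
        proof (rule runs_marginal)
          show "ready ?s2" by (rule ready_frame[OF r1 f2]) auto
          show "qrep ?s2 (?q1(i := (?q1 i)(a := 0)))" by (rule qrep_store[OF P1 a refl])
        qed (use v av s0 i a in auto)
        then show "runs marginal_prog (fst s1, store (snd s1) 3 (i * k + a) (real 0)) (tfor N (1 + (tfor N 2 + 2)))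
          (\<lambda>s'. frame ({13, 14, 15, 16} - {13}) {3} s1 s' \<and> qrep s' ((?q i)(i := ?y (Suc a))))"
          unfolding of_nat_0
        proof (rule runs_mono)
          fix s' assume s': "frame {14, 15, 16} {3} ?s2 s' \<and> qrep s' (?q1(i := (?q1 i)(a := seed_marginal e i a)))"
          then have "frame ({13, 14, 15, 16} - {13}) {3} s1 s'" by (auto intro: frame_trans[OF f2])
          moreover have "qrep s' ((?q i)(i := ?y (Suc a)))"
            by (rule qrep_cong[OF conjunct2[OF s']]) (auto simp: less_Suc_eq)
          ultimately show "frame ({13, 14, 15, 16} - {13}) {3} s1 s' \<and> qrep s' ((?q i)(i := ?y (Suc a)))" ..
        qed simp
      qed simp
    next
      show "qrep s ((?q i)(i := ?y 0))" by (rule qrep_cong[OF P]) auto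
      show "nval k_par s' = k" if "frame {13, 14, 15, 16} {3} s s'" for s'
        by (rule ready_pars, rule ready_frame[OF r that]) auto
    qed (use sizes in \<open>auto intro: qrep_nat_store\<close>)
    then show "runs (For 13 k_par ?p) s
        (?T)
        (\<lambda>s'. frame ({12, 13, 14, 15, 16} - {12}) {3} s s' \<and> qrep s' (?q (Suc i)))"
    proof (rule runs_mono)
      fix s' assume s': "frame {13, 14, 15, 16} {3} s s' \<and> qrep s' ((?q i)(i := ?y k))"
      have "qrep s' (?q (Suc i))"
        by (rule qrep_cong[OF conjunct2[OF s']]) (auto simp: less_Suc_eq)
      then show "frame ({12, 13, 14, 15, 16} - {12}) {3} s s' \<and> qrep s' (?q (Suc i))"
        using s' by (auto elim: frame_mono)
    qed simp
  next
    show "qrep s0 (?q 0)" by (simp add: qrep_def q0_def)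
    show "nval n_par s' = n" if "frame {12, 13, 14, 15, 16} {3} s0 s'" for s'
      by (rule ready_pars, rule ready_frame[OF s0(1) that]) auto
  qed (use sizes in \<open>auto intro: qrep_nat_store\<close>)
  then show ?thesis
    by (rule runs_mono) (auto intro: qrep_cong)
qed

lemma runs_point:
  assumes s0: "ready s0" "fst s0 12 0 = i" "i < n" "fst s0 v 0 = c" and v: "v \<noteq> 21" and q: "qrep s0 q"
  shows "runs (point_prog v) s0 (tfor N 1) (\<lambda>s. frame {21} {3} s0 s \<and> qrep s (q(i := point_row c)))"
proof -
  let ?q = "\<lambda>b. q(i := \<lambda>a. if a < b then point_row c a else q i a)"
  have "runs (point_prog v) s0 (tfor N 1) (\<lambda>s. frame {21} {3} s0 s \<and> qrep s (?q k))"
    unfolding point_prog_def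
  proof (rule runs_For[where P = "\<lambda>b s. qrep s (?q b)"])
    fix b s assume b: "b < k" and f: "frame {21} {3} s0 s" and bv: "fst s 21 0 = b" and P: "qrep s (?q b)"
    have r: "ready s" by (rule ready_frame[OF s0(1) f]) auto
    have vs: "fst s 12 0 = i" "fst s v 0 = c" using frame_nat[OF f] s0 v by simp_all
    have cell: "nval (NAdd (NCell 6 (nvar 12)) (nvar 21)) s = i * k + b"
      using r vs bv s0 by (simp add: ready_def tables_def)
    have val: "rval (RNat (NSub (NConst 1) (NAdd (NSub (nvar 21) (nvar v)) (NSub (nvar v) (nvar 21))))) s = point_row c b"
      using vs bv by (auto simp: point_row_def)
    show "runs (RAssign 3 (NAdd (NCell 6 (nvar 12)) (nvar 21))
        (RNat (NSub (NConst 1) (NAdd (NSub (nvar 21) (nvar v)) (NSub (nvar v) (nvar 21)))))) s 1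
        (\<lambda>s'. frame ({21} - {21}) {3} s s' \<and> qrep s' (?q (Suc b)))"
    proof (rule runs_RAssign, unfold cell val, intro conjI)
      show "frame ({21} - {21}) {3} s (fst s, store (snd s) 3 (i * k + b) (point_row c b))"
        by (intro frame_store_real frame_refl) simp
      show "qrep (fst s, store (snd s) 3 (i * k + b) (point_row c b)) (?q (Suc b))"
        by (rule qrep_cong[OF qrep_store[OF P b refl, of "fst s" i "point_row c b"]]) (auto simp: less_Suc_eq)
    qed simp
  next
    show "nval k_par s' = k" if "frame {21} {3} s0 s'" for s'
      by (rule ready_pars, rule ready_frame[OF s0(1) that]) auto
  qed (use sizes q in \<open>auto intro: qrep_nat_store qrep_cong\<close>)
  then show ?thesis by (rule runs_mono) (auto intro: qrep_cong)
qed

definition qterm :: "(nat \<Rightarrow> nat \<Rightarrow> real) \<Rightarrow> nat \<Rightarrow> nat \<Rightarrow> nat \<Rightarrow> real" where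
  "qterm q c a b = (if bit c a b then
    (if ep1 c = ep2 c then of_bool (a = b) * (w c * q (ep1 c) a) else w c * (q (ep1 c) a * q (ep2 c) b)) else 0)"

definition qval :: "(nat \<Rightarrow> nat \<Rightarrow> real) \<Rightarrow> real" where
  "qval q = (\<Sum>c<C. \<Sum>a<k. \<Sum>b<k. qterm q c a b)"

lemma runs_term:
  assumes s: "ready s" "qrep s q" "fst s 17 0 = c" "c < C" "fst s 18 0 = a" "a < k" "fst s 19 0 = b" "b < k"
  shows "runs term_prog s 4 (\<lambda>s'. frame {} {4} s s' \<and> snd s' 4 0 = snd s 4 0 + qterm q c a b)"
proof -
  have v: "nval first_var s = ep1 c" "nval second_var s = ep2 c" "rval (RCell 0 (nvar 17)) s = w c"
    "nval (NCell 3 (NAdd (NAdd (NCell 8 (nvar 17)) (NCell 6 (nvar 18))) (nvar 19))) s = of_bool (bit c a b)"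
    using s by (auto simp: ready_def base_def tables_def)
  have q: "rval (RCell 3 (NAdd (NCell 6 first_var) (nvar 18))) s = q (ep1 c) a"
    "rval (RCell 3 (NAdd (NCell 6 second_var) (nvar 19))) s = q (ep2 c) b"
    using s ep[OF s(4)] by (auto simp: ready_def base_def tables_def qrep_def)
  \<comment> \<open>Three nested tests and one assignment.\<close>
  have e: "4 = Suc (Suc (Suc (Suc 0)))" by simp
  show ?thesis unfolding term_prog_def e
    apply (rule runs_Cond)
     apply (rule runs_Cond)
      apply (rule runs_Cond)
       apply (rule runs_RAssign)
        apply (unfold tval.simps tval_TEq rval.simps(3,5) v q)
        apply (simp_all add: qterm_def store_apply s frame_store_real[OF frame_refl] runs_Skip frame_refl)
     apply (rule runs_RAssign)
      apply (unfold rval.simps(3,5) v q)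
      apply (simp_all add: qterm_def store_apply s frame_store_real[OF frame_refl])
    done
qed

lemma runs_eval:
  assumes s0: "ready s0" "qrep s0 q"
  shows "runs eval_prog s0 (1 + tfor N (tfor N (tfor N 4)))
    (\<lambda>s. frame {17, 18, 19} {4} s0 s \<and> snd s 4 0 = qval q)"
  unfolding eval_prog_def
proof (intro runs_Seq runs_RAssign, unfold rval.simps nval.simps of_nat_0)
  let ?B = "For 19 k_par term_prog"
  let ?A = "For 18 k_par ?B" and ?t = "\<lambda>c. \<Sum>a<k. \<Sum>b<k. qterm q c a b"
  let ?s1 = "(fst s0, store (snd s0) 4 0 0)"
  have f1: "frame {} {4} s0 ?s1" by (intro frame_store_real frame_refl) simp
  have r1: "ready ?s1" by (rule ready_frame[OF s0(1) f1]) auto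
  have q1: "qrep ?s1 q" by (rule qrep_frame[OF s0(2) f1]) simp
  have "runs (For 17 C_par ?A) ?s1 (tfor N (tfor N (tfor N 4)))
    (\<lambda>s. frame {17, 18, 19} {4} ?s1 s \<and> snd s 4 0 = (\<Sum>c<C. ?t c))"
  proof (rule runs_For[where P = "\<lambda>C s. snd s 4 0 = (\<Sum>c<C. ?t c)"])
    fix c s assume c: "c < C" and f: "frame {17, 18, 19} {4} ?s1 s" and cv: "fst s 17 0 = c"
      and P: "snd s 4 0 = (\<Sum>c<c. ?t c)"
    have r: "ready s" by (rule ready_frame[OF r1 f]) auto
    have qs: "qrep s q" by (rule qrep_frame[OF q1 f]) simp
    have "runs ?A s (tfor N (tfor N 4))
      (\<lambda>s'. frame {18, 19} {4} s s' \<and> snd s' 4 0 = snd s 4 0 + ?t c)"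
    proof (rule runs_For[where P = "\<lambda>k' s'. snd s' 4 0 = snd s 4 0 + (\<Sum>a<k'. \<Sum>b<k. qterm q c a b)"])
      fix a s2 assume a: "a < k" and f2: "frame {18, 19} {4} s s2" and av: "fst s2 18 0 = a"
        and P2: "snd s2 4 0 = snd s 4 0 + (\<Sum>a<a. \<Sum>b<k. qterm q c a b)"
      have r2: "ready s2" by (rule ready_frame[OF r f2]) auto
      have q2: "qrep s2 q" by (rule qrep_frame[OF qs f2]) simp
      have "runs ?B s2 (tfor N 4)
        (\<lambda>s'. frame {19} {4} s2 s' \<and> snd s' 4 0 = snd s2 4 0 + (\<Sum>b<k. qterm q c a b))"
      proof (rule runs_For[where P = "\<lambda>k' s'. snd s' 4 0 = snd s2 4 0 + (\<Sum>b<k'. qterm q c a b)"])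
        fix b s3 assume b: "b < k" and f3: "frame {19} {4} s2 s3" and bv: "fst s3 19 0 = b"
          and P3: "snd s3 4 0 = snd s2 4 0 + (\<Sum>b<b. qterm q c a b)"
        have "runs term_prog s3 4 (\<lambda>s'. frame {} {4} s3 s' \<and> snd s' 4 0 = snd s3 4 0 + qterm q c a b)"
        proof (rule runs_term)
          show "ready s3" by (rule ready_frame[OF r2 f3]) auto
          show "qrep s3 q" by (rule qrep_frame[OF q2 f3]) simp
        qed (use frame_nat[OF f3] frame_nat[OF f2] av cv bv a b c in auto)
        then show "runs term_prog s3 4 (\<lambda>s'. frame ({19} - {19}) {4} s3 s' \<and> snd s' 4 0 = snd s2 4 0 + (\<Sum>b<Suc b. qterm q c a b))"
          by (rule runs_mono) (use P3 in auto)
      next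
        show "nval k_par s' = k" if "frame {19} {4} s2 s'" for s'
          by (rule ready_pars, rule ready_frame[OF r2 that]) auto
      qed (use sizes in auto)
      then show "runs ?B s2 (tfor N 4) (\<lambda>s'. frame ({18, 19} - {18}) {4} s2 s' \<and>
          snd s' 4 0 = snd s 4 0 + (\<Sum>a<Suc a. \<Sum>b<k. qterm q c a b))"
        by (rule runs_mono) (use P2 in \<open>auto elim: frame_mono\<close>)
    next
      show "nval k_par s' = k" if "frame {18, 19} {4} s s'" for s'
        by (rule ready_pars, rule ready_frame[OF r that]) auto
    qed (use sizes in auto)
    then show "runs ?A s (tfor N (tfor N 4))
      (\<lambda>s'. frame ({17, 18, 19} - {17}) {4} s s' \<and> snd s' 4 0 = (\<Sum>c<Suc c. ?t c))"
      by (rule runs_mono) (use P in \<open>auto elim: frame_mono\<close>)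
  next
    show "nval C_par s' = C" if "frame {17, 18, 19} {4} ?s1 s'" for s'
      by (rule ready_pars, rule ready_frame[OF r1 that]) auto
  qed (use sizes in \<open>auto simp: store_apply\<close>)
  then show "runs (For 17 C_par ?A) ?s1 (tfor N (tfor N (tfor N 4)))
    (\<lambda>s. frame {17, 18, 19} {4} s0 s \<and> snd s 4 0 = qval q)"
    by (rule runs_mono) (auto simp: qval_def intro: frame_trans[OF f1])
qed simp

end

section \<open>Greedy rounding and running time\<close>

text \<open>This and the following time bounds copy the nesting of the programs, so that
  polynomiality becomes closure under sums and products.\<close>

definition eval_time :: "nat \<Rightarrow> nat" where
  "eval_time N = 1 + tfor N (tfor N (tfor N 4))"

definition choose_time :: "nat \<Rightarrow> nat" where
  "choose_time N = tfor N (tfor N 1 + (eval_time N + Suc 2))"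

definition seed_time :: "nat \<Rightarrow> nat" where
  "seed_time N = tfor N (tfor N (1 + tfor N (1 + (tfor N 2 + 2))))
    + (tfor N (choose_time N + (tfor N 1 + 1)) + (eval_time N + Suc (1 + tfor N 1)))"

definition rounding_time :: "nat \<Rightarrow> nat" where
  "rounding_time N = tfor (2 * N) 1 + (tfor N 1 + (tfor N 1 + tfor N (seed_time N)))"

text \<open>All that the analysis of the program needs to know about the objective; it is later
  supplied by multilinearity of the rounding value.\<close>

locale rounding_objective = rounding_input +
  assumes row_best: "\<And>q i v. i < n \<Longrightarrow> (\<Sum>a<k. q i a) = 1 \<Longrightarrow> (\<And>a. a < k \<Longrightarrow> 0 \<le> q i a) \<Longrightarrow>
    (\<And>a. a < k \<Longrightarrow> qval (q(i := point_row a)) \<le> v) \<Longrightarrow> qval q \<le> v"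
begin

lemma qval_cong: assumes "\<And>i a. i < n \<Longrightarrow> a < k \<Longrightarrow> q i a = q' i a" shows "qval q = qval q'"
proof -
  have "qterm q c a b = qterm q' c a b" if "c < C" "a < k" "b < k" for c a b
    using ep[OF that(1)] that assms by (simp add: qterm_def)
  then show ?thesis by (simp add: qval_def)
qed

lemma runs_choose:
  assumes s0: "ready s0" "qrep s0 q" "fst s0 12 0 = i" "i < n"
  shows "runs choose_prog s0 (choose_time N) (\<lambda>s. frame {13, 17, 18, 19, 20, 21} {3, 4, 5} s0 s \<and>
    ((\<exists>y. qrep s (q(i := y))) \<and> fst s 20 0 < k \<and>
    (\<forall>a<k. qval (q(i := point_row a)) \<le> qval (q(i := point_row (fst s 20 0))))))"
proof -
  \<comment> \<open>Before the first letter the record is stale, hence the guard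
    \<open>0 < m\<close>. The row of \<open>i\<close> is scratch space during the search, hence the
    existential \<open>y\<close>.\<close>
  let ?P = "\<lambda>m s. (\<exists>y. qrep s (q(i := y))) \<and> (0 < m \<longrightarrow> fst s 20 0 < k \<and>
    snd s 5 0 = qval (q(i := point_row (fst s 20 0))) \<and> (\<forall>a<m. qval (q(i := point_row a)) \<le> snd s 5 0))"
  let ?W = "{13, 17, 18, 19, 20, 21} :: nat set" and ?V = "{3, 4, 5} :: nat set"
  have "runs choose_prog s0 (choose_time N) (\<lambda>s. frame ?W ?V s0 s \<and> ?P k s)"
    unfolding choose_prog_def choose_time_def
  proof (rule runs_For[where P = ?P])
    fix a s assume a: "a < k" and f: "frame ?W ?V s0 s" and av: "fst s 13 0 = a" and P: "?P a s"
    have r: "ready s" by (rule ready_frame[OF s0(1) f]) auto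
    have iv: "fst s 12 0 = i" using frame_nat[OF f] s0 by simp
    obtain y where y: "qrep s (q(i := y))" using P by blast
    let ?sel = "Cond (TOr (TEq (nvar 13) (NConst 0)) (RLess (rvar 5) (rvar 4)))
      (Seq (RAssign 5 (NConst 0) (rvar 4)) (NAssign 20 (NConst 0) (nvar 13))) Skip"
    let ?Q = "\<lambda>s'. frame (?W - {13}) ?V s s' \<and> ?P (Suc a) s'"
    show "runs (Seq (point_prog 13) (Seq eval_prog ?sel)) s (tfor N 1 + (eval_time N + Suc 2)) ?Q"
    proof (rule runs_Seq, rule runs_mono[OF runs_point[OF r iv s0(4) av _ y]])
      fix s1 assume "frame {21} {3} s s1 \<and> qrep s1 (q(i := y, i := point_row a))"
      then have f1: "frame {21} {3} s s1" and q1: "qrep s1 (q(i := point_row a))" by auto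
      have r1: "ready s1" by (rule ready_frame[OF r f1]) auto
      show "runs (Seq eval_prog ?sel) s1 (eval_time N + Suc 2) ?Q"
        unfolding eval_time_def
      proof (rule runs_Seq, rule runs_mono[OF runs_eval[OF r1 q1]])
        fix s2 assume s2: "frame {17, 18, 19} {4} s1 s2 \<and> snd s2 4 0 = qval (q(i := point_row a))"
        have f2: "frame {17, 18, 19, 21} {3, 4} s s2"
          by (rule frame_trans[OF f1 conjunct1[OF s2]]) auto
        have q2: "qrep s2 (q(i := point_row a))" by (rule qrep_frame[OF q1 conjunct1[OF s2]]) simp
        have v: "fst s2 13 0 = a" "fst s2 20 0 = fst s 20 0" "snd s2 5 0 = snd s 5 0" "snd s2 4 0 = qval (q(i := point_row a))"
          using frame_nat[OF f2] frame_real[OF f2] av s2 by simp_all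
        have fQ: "frame (?W - {13}) ?V s s2" by (rule frame_mono[OF f2]) auto
        show "runs ?sel s2 (Suc 2) ?Q"
        proof (rule runs_Cond)
          assume t: "tval (TOr (TEq (nvar 13) (NConst 0)) (RLess (rvar 5) (rvar 4))) s2"
          let ?s4 = "(store (fst s2) 20 0 a, store (snd s2) 5 0 (qval (q(i := point_row a))))"
          have f4: "frame (?W - {13}) ?V s ?s4"
            using frame_store_nat[OF frame_store_real[OF fQ]] by simp
          have q4: "qrep ?s4 (q(i := point_row a))" using q2 by (simp add: qrep_def store_apply)
          have "qval (q(i := point_row a')) \<le> qval (q(i := point_row a))" if "a' < Suc a" for a'
            using that t v P by (cases "a' = a") (force simp: less_Suc_eq)+
          then have "?P (Suc a) ?s4" using q4 a by (auto simp: store_apply)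
          with f4 have Q4: "?Q ?s4" by (rule conjI)
          have "runs (Seq (RAssign 5 (NConst 0) (rvar 4)) (NAssign 20 (NConst 0) (nvar 13))) s2 (1 + 1) ?Q"
            by (intro runs_Seq runs_RAssign runs_NAssign, unfold nval.simps rval.simps fst_conv snd_conv v(1,4))
              (rule Q4[unfolded fst_conv snd_conv], rule order_refl, rule order_refl)
          then show "runs (Seq (RAssign 5 (NConst 0) (rvar 4)) (NAssign 20 (NConst 0) (nvar 13))) s2 2 ?Q"
            by (simp only: one_add_one)
        next
          assume t: "\<not> tval (TOr (TEq (nvar 13) (NConst 0)) (RLess (rvar 5) (rvar 4))) s2"
          show "runs Skip s2 2 ?Q"
            by (rule runs_Skip) (use t v P fQ q2 in \<open>auto simp: less_Suc_eq\<close>)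
        qed
      qed simp
    qed simp_all
  next
    show "nval k_par s' = k" if "frame ?W ?V s0 s'" for s'
      by (rule ready_pars, rule ready_frame[OF s0(1) that]) auto
    show "?P 0 s0" using s0(2) by (auto intro!: exI[of _ "q i"])
  qed (use sizes in \<open>auto simp: store_apply intro: qrep_nat_store\<close>)
  then show ?thesis
    by (rule runs_mono) (use pos in auto)
qed

text \<open>Every listed pair is tried, also those of probability zero or with a set too large to
  admit another variable, and for these the computed table need not consist of probability vectors.
  The value guarantee is restricted to genuine distributions.\<close>

definition stochastic :: "(nat \<Rightarrow> nat \<Rightarrow> real) \<Rightarrow> bool" where
  "stochastic q \<longleftrightarrow> (\<forall>i<n. (\<Sum>a<k. q i a) = 1 \<and> (\<forall>a<k. 0 \<le> q i a))"

text \<open>The letters stay in range for any \<open>q\<close>, so the output is always an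
  assignment; only the comparison of values averages over a row and needs probability
  vectors.\<close>

lemma runs_greedy:
  assumes s0: "ready s0" "qrep s0 q"
  defines "Q \<equiv> \<lambda>m s j. if j < m then point_row (fst s 22 j) else q j"
  shows "runs greedy_prog s0 (tfor N (choose_time N + (tfor N 1 + 1)))
    (\<lambda>s. frame {12, 13, 17, 18, 19, 20, 21, 22} {3, 4, 5} s0 s \<and>
      ((\<forall>j<n. fst s 22 j < k) \<and> qrep s (Q n s) \<and> (stochastic q \<longrightarrow> qval q \<le> qval (Q n s))))"
proof -
  let ?W = "{12, 13, 17, 18, 19, 20, 21, 22} :: nat set" and ?V = "{3, 4, 5} :: nat set"
  let ?P = "\<lambda>m s. (\<forall>j<m. fst s 22 j < k) \<and> qrep s (Q m s) \<and> (stochastic q \<longrightarrow> qval q \<le> qval (Q m s))"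
  show ?thesis
    unfolding greedy_prog_def
  proof (rule runs_For[where P = ?P])
    fix i s assume i: "i < n" and f: "frame ?W ?V s0 s" and iv: "fst s 12 0 = i" and P: "?P i s"
    have r: "ready s" by (rule ready_frame[OF s0(1) f]) auto
    have qs: "qrep s (Q i s)" using P by blast
    let ?R = "\<lambda>s'. frame (?W - {12}) ?V s s' \<and> ?P (Suc i) s'"
    show "runs (Seq choose_prog (Seq (point_prog 20) (NAssign 22 (nvar 12) (nvar 20)))) s (choose_time N + (tfor N 1 + 1)) ?R"
    proof (rule runs_Seq, rule runs_mono[OF runs_choose[OF r qs iv i]])
      fix s1 :: state
      let ?c = "fst s1 20 0"
      assume s1: "frame {13, 17, 18, 19, 20, 21} {3, 4, 5} s s1 \<and> ((\<exists>y. qrep s1 ((Q i s)(i := y))) \<and> ?c < k \<and>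
        (\<forall>a<k. qval ((Q i s)(i := point_row a)) \<le> qval ((Q i s)(i := point_row ?c))))"
      then obtain y where f1: "frame {13, 17, 18, 19, 20, 21} {3, 4, 5} s s1" and q1: "qrep s1 ((Q i s)(i := y))"
        and c: "?c < k" and best: "\<And>a. a < k \<Longrightarrow> qval ((Q i s)(i := point_row a)) \<le> qval ((Q i s)(i := point_row ?c))"
        by auto
      have r1: "ready s1" by (rule ready_frame[OF r f1]) auto
      have i1: "fst s1 12 0 = i" using frame_nat[OF f1] iv by simp
      show "runs (Seq (point_prog 20) (NAssign 22 (nvar 12) (nvar 20))) s1 (tfor N 1 + 1) ?R"
      proof (rule runs_Seq, rule runs_mono[OF runs_point[OF r1 i1 i refl _ q1]])
        fix s2 assume s2: "frame {21} {3} s1 s2 \<and> qrep s2 ((Q i s)(i := y, i := point_row ?c))"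
        have f2: "frame (?W - {12}) ?V s s2" by (rule frame_trans[OF f1 conjunct1[OF s2]]) auto
        have v: "fst s2 12 0 = i" "fst s2 20 0 = ?c"
          using frame_nat[OF conjunct1[OF s2]] i1 by simp_all
        have f2': "frame {13, 17, 18, 19, 20, 21} {3, 4, 5} s s2" by (rule frame_trans[OF f1 conjunct1[OF s2]]) auto
        have x: "fst s2 22 = fst s 22" using frame_nat[OF f2'] by simp
        let ?s3 = "(store (fst s2) 22 i ?c, snd s2)"
        have Q3: "Q (Suc i) ?s3 = (Q i s)(i := point_row ?c)"
          by (auto simp: Q_def fun_eq_iff store_apply x less_Suc_eq)
        have "qval (Q i s) \<le> qval ((Q i s)(i := point_row ?c))" if "stochastic q"
        proof (rule row_best[of i "Q i s"])
          show "qval ((Q i s)(i := point_row a)) \<le> qval ((Q i s)(i := point_row ?c))" if "a < k" for a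
            by (rule best[OF that])
        qed (use that i in \<open>simp_all add: stochastic_def Q_def\<close>)
        then have "?P (Suc i) ?s3"
          unfolding Q3 using P s2 c by (auto simp: store_apply x less_Suc_eq intro: qrep_nat_store)
        moreover have "frame (?W - {12}) ?V s ?s3" using frame_store_nat[OF f2] by simp
        ultimately have R3: "?R ?s3" by blast
        show "runs (NAssign 22 (nvar 12) (nvar 20)) s2 1 ?R"
          by (intro runs_NAssign, unfold nval.simps v) (rule R3, rule order_refl)
      qed simp_all
    qed simp
  next
    show "nval n_par s' = n" if "frame ?W ?V s0 s'" for s'
      by (rule ready_pars, rule ready_frame[OF s0(1) that]) auto
    fix m s x
    have "Q m (store (fst s) 12 0 x, snd s) = Q m s" by (auto simp: Q_def store_apply fun_eq_iff)
    then show "?P m s \<Longrightarrow> ?P m (store (fst s) 12 0 x, snd s)"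
      by (simp add: store_apply qrep_nat_store)
  qed (use sizes s0 in \<open>simp_all add: Q_def\<close>)
qed

lemma runs_copy:
  assumes s0: "ready s0"
  shows "runs copy_prog s0 (tfor N 1) (\<lambda>s. frame {0, 23} {} s0 s \<and> (\<forall>j<n. fst s 0 j = fst s0 22 j))"
  unfolding copy_prog_def
proof (rule runs_For[where P = "\<lambda>n s. \<forall>j<n. fst s 0 j = fst s0 22 j"])
  fix i s assume f: "frame {0, 23} {} s0 s" and "fst s 23 0 = i" "\<forall>j<i. fst s 0 j = fst s0 22 j"
  then show "runs (NAssign 0 (nvar 23) (NCell 22 (nvar 23))) s 1
    (\<lambda>s'. frame ({0, 23} - {23}) {} s s' \<and> (\<forall>j<Suc i. fst s' 0 j = fst s0 22 j))"
    using frame_nat[OF f]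
    by (intro runs_NAssign) (auto simp: store_apply less_Suc_eq intro: frame_store_nat frame_refl)
next
  show "nval n_par s' = n" if "frame {0, 23} {} s0 s'" for s'
    by (rule ready_pars, rule ready_frame[OF s0(1) that]) auto
qed (use sizes in \<open>auto simp: store_apply\<close>)

definition scored :: "state \<Rightarrow> bool" where
  "scored s \<longleftrightarrow> (\<forall>j<n. fst s 0 j < k) \<and> snd s 6 0 = qval (\<lambda>j. point_row (fst s 0 j))"

lemma scored_frame: "scored s \<Longrightarrow> frame W V s s' \<Longrightarrow> 0 \<notin> W \<Longrightarrow> 6 \<notin> V \<Longrightarrow> scored s'"
  unfolding scored_def using frame_nat[of W V s s' 0] frame_real[of W V s s' 6] by simp

lemma runs_seed:
  assumes s0: "ready s0" "fst s0 11 0 = e" "e < E" and sc: "0 < e \<Longrightarrow> scored s0"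
  shows "runs seed_prog s0 (seed_time N)
    (\<lambda>s. frame {0, 12, 13, 14, 15, 16, 17, 18, 19, 20, 21, 22, 23} {3, 4, 5, 6} s0 s \<and> scored s \<and>
      (0 < e \<longrightarrow> snd s0 6 0 \<le> snd s 6 0) \<and> (stochastic (seed_marginal e) \<longrightarrow> qval (seed_marginal e) \<le> snd s 6 0))"
  (is "runs _ _ _ ?R")
  unfolding seed_prog_def seed_time_def
proof (rule runs_Seq, rule runs_mono[OF runs_extract[OF s0(1-3)]])
  let ?sel = "Cond (TOr (TEq (nvar 11) (NConst 0)) (RLess (rvar 6) (rvar 4)))
      (Seq (RAssign 6 (NConst 0) (rvar 4)) copy_prog) Skip"
  let ?W = "{12, 13, 14, 15, 16, 17, 18, 19, 20, 21, 22} :: nat set" and ?V = "{3, 4, 5} :: nat set"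
  fix s1 assume s1: "frame {12, 13, 14, 15, 16} {3} s0 s1 \<and> qrep s1 (seed_marginal e)"
  have r1: "ready s1" by (rule ready_frame[OF s0(1) conjunct1[OF s1]]) auto
  show "runs (Seq greedy_prog (Seq eval_prog ?sel)) s1
    (tfor N (choose_time N + (tfor N 1 + 1)) + (eval_time N + Suc (1 + tfor N 1))) ?R"
  proof (rule runs_Seq, rule runs_mono[OF runs_greedy[OF r1 conjunct2[OF s1]]])
    fix s2 :: state
    let ?q = "\<lambda>j. if j < n then point_row (fst s2 22 j) else seed_marginal e j"
    assume s2: "frame {12, 13, 17, 18, 19, 20, 21, 22} {3, 4, 5} s1 s2 \<and>
      ((\<forall>j<n. fst s2 22 j < k) \<and> qrep s2 ?q \<and> (stochastic (seed_marginal e) \<longrightarrow> qval (seed_marginal e) \<le> qval ?q))"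
    have f2: "frame ?W ?V s0 s2" by (rule frame_trans[OF conjunct1[OF s1] conjunct1[OF s2]]) auto
    have r2: "ready s2" by (rule ready_frame[OF s0(1) f2]) auto
    have q2: "qrep s2 ?q" using s2 by blast
    show "runs (Seq eval_prog ?sel) s2 (eval_time N + Suc (1 + tfor N 1)) ?R"
      unfolding eval_time_def
    proof (rule runs_Seq, rule runs_mono[OF runs_eval[OF r2 q2]])
      fix s3 assume s3: "frame {17, 18, 19} {4} s2 s3 \<and> snd s3 4 0 = qval ?q"
      have f3: "frame ?W ?V s0 s3" by (rule frame_trans[OF f2 conjunct1[OF s3]]) auto
      have r3: "ready s3" by (rule ready_frame[OF s0(1) f3]) auto
      have x: "fst s3 22 = fst s2 22" using frame_nat[OF conjunct1[OF s3]] by simp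
      have v: "fst s3 11 0 = e" "snd s3 6 0 = snd s0 6 0" "snd s3 4 0 = qval ?q"
        using frame_nat[OF f3] frame_real[OF f3] s0 s3 by simp_all
      show "runs ?sel s3 (Suc (1 + tfor N 1)) ?R"
      proof (rule runs_Cond)
        assume t: "tval (TOr (TEq (nvar 11) (NConst 0)) (RLess (rvar 6) (rvar 4))) s3"
        let ?s4 = "(fst s3, store (snd s3) 6 0 (qval ?q))"
        have f4: "frame {} {6} s3 ?s4" by (intro frame_store_real frame_refl) simp
        have r4: "ready ?s4" by (rule ready_frame[OF r3 f4]) auto
        show "runs (Seq (RAssign 6 (NConst 0) (rvar 4)) copy_prog) s3 (1 + tfor N 1) ?R"
        proof (intro runs_Seq runs_RAssign, unfold rval.simps nval.simps v)
          show "runs copy_prog ?s4 (tfor N 1) ?R"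
          proof (rule runs_mono[OF runs_copy[OF r4]])
            fix s assume s: "frame {0, 23} {} ?s4 s \<and> (\<forall>j<n. fst s 0 j = fst ?s4 22 j)"
            have "snd s 6 0 = qval ?q"
              using frame_real[OF conjunct1[OF s], of 6] by (simp add: store_apply)
            moreover have "qval ?q = qval (\<lambda>j. point_row (fst s 0 j))"
              using s by (intro qval_cong) (simp add: x)
            moreover have "frame ({0, 23} \<union> ?W) ({6} \<union> ?V) s0 s"
              by (rule frame_trans[OF frame_trans[OF f3 f4] conjunct1[OF s], of ?W "{6} \<union> ?V"]) auto
            ultimately show "?R s"
              using s s2 t v by (auto simp: scored_def x elim!: frame_mono)
          qed simp
        qed simp
      next
        assume t: "\<not> tval (TOr (TEq (nvar 11) (NConst 0)) (RLess (rvar 6) (rvar 4))) s3"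
        have "scored s3" by (rule scored_frame[OF sc f3]) (use t v in auto)
        then show "runs Skip s3 (1 + tfor N 1) ?R"
          by (intro runs_Skip) (use t v s2 in \<open>auto intro: frame_mono[OF f3]\<close>)
      qed
    qed simp
  qed simp
qed simp

lemma runs_rounding:
  assumes s0: "base s0" "fst s0 6 0 = 0" "fst s0 7 0 = 0" "fst s0 8 0 = 0"
  shows "runs rounding_prog s0 (rounding_time N)
    (\<lambda>s. scored s \<and> (\<forall>e<E. stochastic (seed_marginal e) \<longrightarrow> qval (seed_marginal e) \<le> snd s 6 0))"
  (is "runs _ _ _ ?R")
  unfolding rounding_prog_def rounding_time_def
proof (rule runs_Seq)
  have pars: "nval n_par s = n" "nval k_par s = k" "nval C_par s = C" "nval E_par s = E" if "base s" for s
    using that by (simp_all add: base_def)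
  have b: "base s" if "frame W {} s0 s" "W \<inter> {1, 2, 3, 4} = {}" for W s
    by (rule base_frame[OF s0(1) that]) simp
  have "runs (table_prog 6 (NAdd n_par k_par) k_par) s0 (tfor (2 * N) 1)
      (\<lambda>s. frame {10, 6} {} s0 s \<and> (\<forall>i\<le>n + k. fst s 6 i = i * k))"
    by (rule runs_table) (use sizes s0 pars b[of "{10, 6}"] in auto)
  then show "runs (table_prog 6 (NAdd n_par k_par) k_par) s0 (tfor (2 * N) 1)
    (\<lambda>s. runs (Seq (table_prog 7 E_par n_par) (Seq (table_prog 8 C_par (NCell 6 k_par)) (For 11 E_par seed_prog))) s
      (tfor N 1 + (tfor N 1 + tfor N (seed_time N))) ?R)"
  proof (rule runs_mono)
    fix s1 assume s1: "frame {10, 6} {} s0 s1 \<and> (\<forall>i\<le>n + k. fst s1 6 i = i * k)"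
    have b1: "base s" if "frame {10, 7} {} s1 s" for s
      by (rule b[of "{10, 6, 7}"], rule frame_trans[OF conjunct1[OF s1] that]) auto
    have "runs (table_prog 7 E_par n_par) s1 (tfor N 1)
      (\<lambda>s. frame {10, 7} {} s1 s \<and> (\<forall>e\<le>E. fst s 7 e = e * n))"
      by (rule runs_table) (use sizes s0 pars b1 frame_nat[OF conjunct1[OF s1], of 7] in auto)
    then show "runs (Seq (table_prog 7 E_par n_par) (Seq (table_prog 8 C_par (NCell 6 k_par)) (For 11 E_par seed_prog))) s1
      (tfor N 1 + (tfor N 1 + tfor N (seed_time N))) ?R"
    proof (intro runs_Seq, elim runs_mono)
      fix s2 assume s2: "frame {10, 7} {} s1 s2 \<and> (\<forall>e\<le>E. fst s2 7 e = e * n)"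
      have f2: "frame {10, 6, 7} {} s0 s2" by (rule frame_trans[OF conjunct1[OF s1] conjunct1[OF s2]]) auto
      have t6: "\<forall>i\<le>n + k. fst s2 6 i = i * k" using s1 frame_nat[OF conjunct1[OF s2], of 6] by simp
      have b2: "base s" if "frame {10, 8} {} s2 s" for s
        by (rule b[of "{10, 6, 7, 8}"], rule frame_trans[OF f2 that]) auto
      have "runs (table_prog 8 C_par (NCell 6 k_par)) s2 (tfor N 1)
        (\<lambda>s. frame {10, 8} {} s2 s \<and> (\<forall>c\<le>C. fst s 8 c = c * (k * k)))"
      proof (rule runs_table)
        fix s assume s: "frame {10, 8} {} s2 s"
        show "nval (NCell 6 k_par) s = k * k"
          using pars(2)[OF b2[OF s]] t6 frame_nat[OF s, of 6] by simp
        show "nval C_par s = C" by (rule pars[OF b2[OF s]])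
      qed (use sizes s0 frame_nat[OF f2, of 8] in auto)
      then show "runs (Seq (table_prog 8 C_par (NCell 6 k_par)) (For 11 E_par seed_prog)) s2
        (tfor N 1 + tfor N (seed_time N)) ?R"
      proof (intro runs_Seq, elim runs_mono)
        fix s3 assume s3: "frame {10, 8} {} s2 s3 \<and> (\<forall>c\<le>C. fst s3 8 c = c * (k * k))"
        have r3: "ready s3"
          using b2[OF conjunct1[OF s3]] s2 s3 t6 frame_nat[OF conjunct1[OF s3], of 6] frame_nat[OF conjunct1[OF s3], of 7]
          by (simp add: ready_def tables_def)
        let ?W = "{0, 11, 12, 13, 14, 15, 16, 17, 18, 19, 20, 21, 22, 23} :: nat set" and ?V = "{3, 4, 5, 6} :: nat set"
        let ?P = "\<lambda>m s. 0 < m \<longrightarrow> scored s \<and> (\<forall>e<m. stochastic (seed_marginal e) \<longrightarrow> qval (seed_marginal e) \<le> snd s 6 0)"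
        have "runs (For 11 E_par seed_prog) s3 (tfor N (seed_time N)) (\<lambda>s. frame ?W ?V s3 s \<and> ?P E s)"
        proof (rule runs_For[where P = ?P])
          fix e s assume e: "e < E" and f: "frame ?W ?V s3 s" and ev: "fst s 11 0 = e" and P: "?P e s"
          have r: "ready s" by (rule ready_frame[OF r3 f]) auto
          let ?S = "\<lambda>s'. frame {0, 12, 13, 14, 15, 16, 17, 18, 19, 20, 21, 22, 23} {3, 4, 5, 6} s s' \<and> scored s' \<and> (0 < e \<longrightarrow> snd s 6 0 \<le> snd s' 6 0) \<and> (stochastic (seed_marginal e) \<longrightarrow> qval (seed_marginal e) \<le> snd s' 6 0)"
          have "runs seed_prog s (seed_time N)
            ?S"
            by (rule runs_seed) (use r ev e P in auto)
          then show "runs seed_prog s (seed_time N) (\<lambda>s'. frame (?W - {11}) ?V s s' \<and> ?P (Suc e) s')"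
          proof (rule runs_mono)
            fix s' assume s': "?S s'"
            have "frame (?W - {11}) ?V s s'" by (rule frame_mono[OF conjunct1[OF s']]) auto
            moreover have "qval (seed_marginal e') \<le> snd s' 6 0" if "e' < Suc e" "stochastic (seed_marginal e')" for e'
              using that s' P by (cases "e' = e") (fastforce simp: less_Suc_eq)+
            ultimately show "frame (?W - {11}) ?V s s' \<and> ?P (Suc e) s'" using s' by blast
          qed simp
        next
          show "nval E_par s' = E" if "frame ?W ?V s3 s'" for s'
            by (rule ready_pars, rule ready_frame[OF r3 that]) auto
        qed (use sizes in \<open>auto simp: scored_def store_apply\<close>)
        then show "runs (For 11 E_par seed_prog) s3 (tfor N (seed_time N)) ?R"
          by (rule runs_mono) (use pos in auto)
      qed simp
    qed simp
  qed simp
qed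

end

section \<open>The encoded input\<close>

text \<open>Exact equality with a polynomial rather than a bound, so that closure under sums and
  products is immediate.\<close>

definition polynomial_time :: "(nat \<Rightarrow> nat) \<Rightarrow> bool" where
  "polynomial_time f \<longleftrightarrow> (\<exists>B :: nat poly. \<forall>N. poly B N = f N)"

lemma polynomial_time_const: "polynomial_time (\<lambda>_. c)"
  unfolding polynomial_time_def by (rule exI[of _ "[:c:]"]) simp

lemma polynomial_time_id: "polynomial_time (\<lambda>N. N)"
  unfolding polynomial_time_def by (rule exI[of _ "[:0, 1:]"]) simp

lemma polynomial_time_add: "polynomial_time f \<Longrightarrow> polynomial_time g \<Longrightarrow> polynomial_time (\<lambda>N. f N + g N)"
  unfolding polynomial_time_def by (metis poly_add)

lemma polynomial_time_mult: "polynomial_time f \<Longrightarrow> polynomial_time g \<Longrightarrow> polynomial_time (\<lambda>N. f N * g N)"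
  unfolding polynomial_time_def by (metis poly_mult)

lemma polynomial_time_rounding: "polynomial_time rounding_time"
  unfolding rounding_time_def[abs_def] seed_time_def choose_time_def eval_time_def tfor_def Suc_eq_plus1
  by (intro polynomial_time_add polynomial_time_mult polynomial_time_const polynomial_time_id)

section \<open>Positions in the flattened input arrays\<close>

lemma concat_map_nth:
  assumes "\<And>x. x \<in> set xs \<Longrightarrow> length (f x) = m" and "i < length xs" "j < m"
  shows "concat (map f xs) ! (i * m + j) = f (xs ! i) ! j"
  using assms
proof (induction xs arbitrary: i)
  case (Cons x xs)
  then show ?case by (cases i) (auto simp: nth_append)
qed simp

lemma length_concat_map:
  assumes "\<And>x. x \<in> set xs \<Longrightarrow> length (f x) = m"
  shows "length (concat (map f xs)) = length xs * m"
  using assms by (induction xs) auto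

lemma block_index_less: "i < p \<Longrightarrow> j < m \<Longrightarrow> i * m + j < p * (m :: nat)"
  by (metis (no_types, lifting) Suc_leI add_less_cancel_left mult_Suc add.commute mult_le_mono1 order_less_le_trans)

lemma length_predicate_bits: "length (predicate_bits k c) = k * k"
  by (cases c) (simp add: predicate_bits_def length_concat_map[where m = k])

lemma predicate_bits_nth:
  "a < k \<Longrightarrow> b < k \<Longrightarrow> predicate_bits k c ! (a * k + b) = of_bool ((a, b) \<in> snd (snd c))"
  by (cases c) (simp add: predicate_bits_def concat_map_nth[where m = k])

definition seed_entry :: "nat set \<times> (nat \<Rightarrow> nat) \<Rightarrow> nat \<Rightarrow> nat" where
  "seed_entry e l = (if l \<in> fst e then Suc (snd e l) else 0)"

lemma length_index_row: "length (index_row n e) = n"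
  by (cases e) (simp add: index_row_def)

lemma index_row_nth: "l < n \<Longrightarrow> index_row n e ! l = seed_entry e l"
  by (cases e) (simp add: index_row_def seed_entry_def)

text \<open>Shifting letters by one separates letter 0 from an absent variable, and extensionality
  fixes \<open>\<alpha>\<close> outside \<open>S\<close>. A row therefore determines its index pair,
  and the scan for a row finds the right one.\<close>

lemma seed_entry_inject:
  assumes "S \<subseteq> {..<n}" "\<alpha> \<in> assignments S k" "S' \<subseteq> {..<n}" "\<alpha>' \<in> assignments S' k"
    and eq: "\<And>l. l < n \<Longrightarrow> seed_entry (S, \<alpha>) l = seed_entry (S', \<alpha>') l"
  shows "S = S' \<and> \<alpha> = \<alpha>'"
proof
  show S: "S = S'"
    using assms(1,3) eq by (auto simp: seed_entry_def split: if_splits) (metis lessThan_iff subsetD nat.distinct(1))+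
  show "\<alpha> = \<alpha>'"
  proof
    fix l show "\<alpha> l = \<alpha>' l"
    proof (cases "l \<in> S")
      case True
      then show ?thesis using eq[of l] assms(1) S by (auto simp: seed_entry_def)
    next
      case False
      then show ?thesis using assms(2,4) S by (auto simp: assignments_def PiE_def extensional_def)
    qed
  qed
qed

locale encoded_relaxation = csp_relaxation +
  fixes cs :: "constraint list" and es :: "(nat set \<times> (nat \<Rightarrow> nat)) list"
  assumes cs: "lists_constraints I cs" and es: "lists_indices n k r es"
begin

abbreviation "inp \<equiv> encode n k r I L cs es"

text \<open>One number bounds every loop: \<open>n\<close> is the length of one listed row, and
  \<open>k\<close> is at most the length of one predicate table.\<close>

lemma sizes: "n \<le> input_size inp" "k \<le> input_size inp" "length es \<le> input_size inp" "length cs \<le> input_size inp"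
  and es_nonempty: "0 < length es"
proof -
  \<comment> \<open>The empty set with its only assignment is always listed.\<close>
  have "({}, \<lambda>_. undefined) \<in> set es"
    using es by (auto simp: lists_indices_def small_sets_def assignments_def)
  then show E: "0 < length es" by (cases es) auto
  have Cp: "0 < length cs" using cs set_pmf_not_empty[of I] by (auto simp: lists_constraints_def)
  have len: "length (concat (map (index_row n) es)) = length es * n"
    "length (concat (map (predicate_bits k) cs)) = length cs * (k * k)"
    by (rule length_concat_map; simp add: length_index_row length_predicate_bits)+
  have "n \<le> length es * n" using E by (cases "length es") auto
  moreover have "k \<le> length cs * (k * k)" using Cp k_pos by (cases "length cs") (auto intro: trans_le_add1)
  ultimately show "n \<le> input_size inp" "k \<le> input_size inp" "length es \<le> input_size inp" "length cs \<le> input_size inp"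
    by (simp_all only: input_size_def encode_def fst_conv snd_conv list.map sum_list.Cons len length_map)
qed

definition nth_bit :: "nat \<Rightarrow> nat \<Rightarrow> nat \<Rightarrow> bool" where
  "nth_bit c a b \<longleftrightarrow> (a, b) \<in> snd (snd (cs ! c))"

definition nth_pmf :: "nat \<Rightarrow> real" where
  "nth_pmf e = pmf (local_dist L (fst (es ! e))) (snd (es ! e))"

lemma nth_cs: "c < length cs \<Longrightarrow> cs ! c \<in> set_pmf I"
  using cs nth_mem[of c cs] unfolding lists_constraints_def by blast

lemma nth_cs_bounds:
  assumes "c < length cs"
  shows "fst (cs ! c) < n" "fst (snd (cs ! c)) < n" "snd (snd (cs ! c)) \<subseteq> {..<k} \<times> {..<k}"
  using set_I[OF nth_cs[OF assms], of "fst (cs ! c)" "fst (snd (cs ! c))" "snd (snd (cs ! c))"] by simp_all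

sublocale R: rounding_input n k "length es" "length cs" "input_size inp" "\<lambda>e. seed_entry (es ! e)" nth_bit
  "\<lambda>c. fst (cs ! c)" "\<lambda>c. fst (snd (cs ! c))" "\<lambda>c. pmf I (cs ! c)" nth_pmf
  by unfold_locales (use sizes es_nonempty k_pos nth_cs_bounds in auto)

text \<open>Sums over list positions and bit tables agree with the mathematical value because each
  constraint is listed exactly once.\<close>

lemma qval_eq: "R.qval q = rounding_value q"
proof -
  have "(\<Sum>a<k. \<Sum>b<k. R.qterm q c a b) = pmf I (cs ! c) * product_value q (cs ! c)" if c: "c < length cs" for c
  proof -
    obtain i j T where cc: "cs ! c = (i, j, T)" by (cases "cs ! c")
    have T: "T \<subseteq> {..<k} \<times> {..<k}" using nth_cs_bounds(3)[OF c] cc by simp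
    let ?f = "\<lambda>(a, b). if i = j then of_bool (a = b) * q i a else q i a * q j b"
    have "(\<Sum>a<k. \<Sum>b<k. R.qterm q c a b)
        = (\<Sum>x\<in>{..<k} \<times> {..<k}. pmf I (cs ! c) * (if x \<in> T then ?f x else 0))"
      unfolding sum.cartesian_product
      by (intro sum.cong refl) (auto simp: R.qterm_def nth_bit_def cc)
    also have "\<dots> = pmf I (cs ! c) * (\<Sum>x\<in>T. ?f x)"
      using T by (simp add: sum_distrib_left[symmetric] sum.If_cases Int_absorb1)
    finally show ?thesis by (simp add: product_value_def cc)
  qed
  then have "R.qval q = (\<Sum>c<length cs. pmf I (cs ! c) * product_value q (cs ! c))"
    by (simp add: R.qval_def)
  also have "\<dots> = (\<Sum>d\<in>set cs. pmf I d * product_value q d)"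
    using cs sum_list_distinct_conv_sum_set[of cs "\<lambda>d. pmf I d * product_value q d"]
    by (simp add: lists_constraints_def sum_list_sum_nth lessThan_atLeast0)
  finally show ?thesis using cs by (simp add: rounding_value_def lists_constraints_def)
qed

sublocale R: rounding_objective n k "length es" "length cs" "input_size inp" "\<lambda>e. seed_entry (es ! e)" nth_bit
  "\<lambda>c. fst (cs ! c)" "\<lambda>c. fst (snd (cs ! c))" "\<lambda>c. pmf I (cs ! c)" nth_pmf
  by unfold_locales (unfold qval_eq, rule rounding_value_le_best_row)

lemma base_initial: "R.base (initial_state inp)"
proof -
  have ep: "concat (map (\<lambda>(i, j, R). [i, j]) cs) ! (c * 2 + b) = (if b = 0 then fst (cs ! c) else fst (snd (cs ! c)))"
    "c * 2 + b < length (concat (map (\<lambda>(i, j, R). [i, j]) cs))"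
    if "c < length cs" "b < 2" for c b
    using that block_index_less[OF that]
    by (subst concat_map_nth[where m = 2] length_concat_map[where m = 2];
        auto split: prod.splits simp: less_2_cases_iff case_prod_unfold)+
  have bits: "concat (map (predicate_bits k) cs) ! (c * (k * k) + a * k + b) = of_bool (nth_bit c a b)"
    "c * (k * k) + a * k + b < length (concat (map (predicate_bits k) cs))"
    if "c < length cs" "a < k" "b < k" for c a b
  proof -
    have ab: "a * k + b < k * k" by (rule block_index_less[OF that(2,3)])
    show "concat (map (predicate_bits k) cs) ! (c * (k * k) + a * k + b) = of_bool (nth_bit c a b)"
      using concat_map_nth[of cs "predicate_bits k" "k * k" c "a * k + b"] that ab
      by (simp add: length_predicate_bits predicate_bits_nth nth_bit_def add.assoc)
    show "c * (k * k) + a * k + b < length (concat (map (predicate_bits k) cs))"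
      using block_index_less[OF that(1) ab] length_concat_map[of cs "predicate_bits k" "k * k"]
      by (simp add: length_predicate_bits add.assoc)
  qed
  have rows: "concat (map (index_row n) es) ! (e * n + l) = seed_entry (es ! e) l"
    "e * n + l < length (concat (map (index_row n) es))"
    if "e < length es" "l < n" for e l
    using concat_map_nth[of es "index_row n" n e l] length_concat_map[of es "index_row n" n] that
      block_index_less[OF that] by (simp_all add: length_index_row index_row_nth)
  have pars: "fst (initial_state inp) 1 0 = n" "fst (initial_state inp) 1 (Suc 0) = k"
    "fst (initial_state inp) 1 4 = length cs" "fst (initial_state inp) 1 5 = length es"
    by (simp_all add: initial_state_def load_def encode_def)
  have arrays:
    "i < length (concat (map (\<lambda>(i, j, R). [i, j]) cs)) \<Longrightarrow>
      fst (initial_state inp) 2 i = concat (map (\<lambda>(i, j, R). [i, j]) cs) ! i"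
    "i < length (concat (map (predicate_bits k) cs)) \<Longrightarrow>
      fst (initial_state inp) 3 i = concat (map (predicate_bits k) cs) ! i"
    "i < length (concat (map (index_row n) es)) \<Longrightarrow>
      fst (initial_state inp) 4 i = concat (map (index_row n) es) ! i"
    "i < length cs \<Longrightarrow> snd (initial_state inp) 0 i = pmf I (cs ! i)"
    "i < length es \<Longrightarrow> snd (initial_state inp) 1 i = nth_pmf i" for i
    by (simp_all add: initial_state_def load_def encode_def nth_pmf_def case_prod_unfold del: length_concat)
  have "fst (initial_state inp) 2 (c + c) = fst (cs ! c) \<and> fst (initial_state inp) 2 (Suc (c + c)) = fst (snd (cs ! c))"
    if "c < length cs" for c
    using ep[OF that, of 0] ep[OF that, of 1] arrays(1)[of "c + c"] arrays(1)[of "Suc (c + c)"]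
    by (simp add: mult_2_right del: length_concat)
  note endpoints = this
  show ?thesis
    unfolding R.base_def
  proof (intro conjI allI impI)
    show "fst (initial_state inp) 3 (c * (k * k) + a * k + b) = of_bool (nth_bit c a b)"
      if "c < length cs" "a < k" "b < k" for c a b
      by (rule trans[OF arrays(2)[OF bits(2)[OF that]] bits(1)[OF that]])
    show "fst (initial_state inp) 4 (e * n + l) = seed_entry (es ! e) l" if "e < length es" "l < n" for e l
      by (rule trans[OF arrays(3)[OF rows(2)[OF that]] rows(1)[OF that]])
  qed (use pars arrays(4,5) endpoints in auto)
qed

lemma initial_zero: "6 \<le> a \<Longrightarrow> fst (initial_state inp) a i = 0"
  by (simp add: initial_state_def load_def encode_def)

text \<open>The support consists of extensional functions, so the event is a single point up to
  probability zero, and its probability can be read off the input.\<close>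

lemma Z_eq_pmf: "T \<in> small_sets n r \<Longrightarrow> pr T {x. restrict x T = \<beta>} = pmf (local_dist L T) \<beta>"
proof -
  assume T: "T \<in> small_sets n r"
  have "restrict x T = x" if "x \<in> set_pmf (local_dist L T)" for x
    using support[OF T that] by (auto simp: assignments_def fun_eq_iff PiE_def extensional_def)
  then have "pr T {x. restrict x T = \<beta>} = pr T {\<beta>}"
    by (intro measure_prob_cong_0) (auto simp: set_pmf_iff)
  then show ?thesis by (simp add: measure_pmf_single)
qed

lemma nth_es: "e < length es \<Longrightarrow> es ! e = (S, \<alpha>) \<Longrightarrow> S \<in> small_sets n r \<and> \<alpha> \<in> assignments S k"
  using es nth_mem[of e es] by (auto simp: lists_indices_def)

text \<open>The index list has no repetitions and contains the extended pair, so the scan hits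
  exactly one row, whose entry is \<open>G S \<alpha> i a\<close>. If \<open>\<alpha>\<close>
  already gives \<open>i\<close> another letter, no row matches and \<open>G\<close> is
  zero.\<close>

lemma seed_marginal_eq:
  assumes e: "e < length es" "es ! e = (S, \<alpha>)" and S: "S \<in> seeds" and ia: "i < n" "a < k"
  shows "R.seed_marginal e i a = cp S \<alpha> i a"
proof -
  have \<alpha>: "\<alpha> \<in> assignments S k" using nth_es[OF e] by simp
  have Sn: "insert i S \<subseteq> {..<n}" using S ia by (auto simp: seeds_def)
  note T = seeds_small1[OF S ia(1)]
  note \<beta> = assignments_upd[OF \<alpha> ia(2), of i]
  have ok: "(\<forall>l<n. R.index_ok e i a f l) \<longleftrightarrow> es ! f = (insert i S, \<alpha>(i := a)) \<and> (i \<notin> S \<or> \<alpha> i = a)"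
    if f: "f < length es" for f
  proof
    assume ok: "\<forall>l<n. R.index_ok e i a f l"
    obtain S' \<alpha>' where f': "es ! f = (S', \<alpha>')" by (cases "es ! f")
    have "S' = insert i S \<and> \<alpha>' = \<alpha>(i := a)"
    proof (rule seed_entry_inject[OF _ _ Sn \<beta>])
      show "S' \<subseteq> {..<n}" "\<alpha>' \<in> assignments S' k" using nth_es[OF f f'] by (auto simp: small_sets_def)
      show "seed_entry (S', \<alpha>') l = seed_entry (insert i S, \<alpha>(i := a)) l" if "l < n" for l
        using ok that e(2) f' by (auto simp: R.index_ok_def seed_entry_def split: if_splits)
    qed
    moreover have "i \<notin> S \<or> \<alpha> i = a"
      using ok ia(1) e(2) by (auto simp: R.index_ok_def seed_entry_def split: if_splits)
    ultimately show "es ! f = (insert i S, \<alpha>(i := a)) \<and> (i \<notin> S \<or> \<alpha> i = a)" using f' by simp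
  next
    assume "es ! f = (insert i S, \<alpha>(i := a)) \<and> (i \<notin> S \<or> \<alpha> i = a)"
    then show "\<forall>l<n. R.index_ok e i a f l"
      using e(2) by (auto simp: R.index_ok_def seed_entry_def)
  qed
  have ZZ: "nth_pmf e = Z S \<alpha>"
    using Z_eq_pmf[OF seeds_small0[OF S]] by (simp add: nth_pmf_def e Z_def)
  show ?thesis
  proof (cases "i \<notin> S \<or> \<alpha> i = a")
    case True
    have "(insert i S, \<alpha>(i := a)) \<in> set es" using es T \<beta> by (auto simp: lists_indices_def)
    then obtain f0 where f0: "f0 < length es" "es ! f0 = (insert i S, \<alpha>(i := a))" by (auto simp: in_set_conv_nth)
    have dist: "distinct es" using es by (simp add: lists_indices_def)
    have "es ! f = (insert i S, \<alpha>(i := a)) \<longleftrightarrow> f = f0" if "f < length es" for f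
      using nth_eq_iff_index_eq[OF dist that f0(1)] f0(2) by simp
    then have "R.seed_marginal e i a = (\<Sum>f<length es. if f = f0 then nth_pmf f0 / nth_pmf e else 0)"
      unfolding R.seed_marginal_def
      by (intro sum.cong refl) (use ok True in auto)
    also have "\<dots> = nth_pmf f0 / nth_pmf e" using f0 by simp
    also have "nth_pmf f0 = G S \<alpha> i a"
      using Z_eq_pmf[OF T, of "\<alpha>(i := a)"] restrict_insert_eq_iff[OF \<alpha> True]
      by (simp add: nth_pmf_def f0 G_def)
    finally show ?thesis by (simp add: ZZ cp_def)
  next
    case False
    then have "{x. restrict x S = \<alpha> \<and> x i = a} = {}" by auto
    then have "G S \<alpha> i a = 0" unfolding G_def by (simp only: measure_empty)
    moreover have "R.seed_marginal e i a = 0"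
      unfolding R.seed_marginal_def by (rule sum.neutral) (use ok False in auto)
    ultimately show ?thesis by (simp add: cp_def)
  qed
qed

text \<open>The run is fixed before \<open>\<epsilon>\<close> is chosen: the final value dominates
  the product value of every listed pair that yields a distribution, and \<open>\<epsilon>\<close>
  only decides which pair to compare with.\<close>

lemma rounding_prog_correct:
  "\<exists>t s. exec rounding_prog (initial_state inp) t s \<and> t \<le> rounding_time (input_size inp) \<and>
    (\<forall>\<epsilon>>0. optimal_lasserre_solution n k r I L \<longrightarrow>
      real k * real (csp_threshold_rank n I ((\<epsilon> / real k) powr 3)) / \<epsilon> powr 3 \<le> real r \<longrightarrow>
      output_assignment n s \<in> assignments {..<n} k \<and>
      objective_value n k I - \<epsilon> < val I (output_assignment n s))"
proof -
  obtain t s where ex: "exec rounding_prog (initial_state inp) t s" "t \<le> rounding_time (input_size inp)"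
    and sc: "R.scored s"
    and best: "\<And>e. e < length es \<Longrightarrow> R.stochastic (R.seed_marginal e) \<Longrightarrow> R.qval (R.seed_marginal e) \<le> snd s 6 0"
    using R.runs_rounding[OF base_initial] initial_zero unfolding runs_def by auto
  have out: "output_assignment n s \<in> assignments {..<n} k"
    using sc by (auto simp: output_assignment_def assignments_def R.scored_def)
  have val: "val I (output_assignment n s) = snd s 6 0"
    using sc rounding_value_point_rows[of "\<lambda>j. point_row (fst s 0 j)" "output_assignment n s"]
    by (simp add: R.scored_def qval_eq output_assignment_def)
  have "objective_value n k I - \<epsilon> < val I (output_assignment n s)"
    if \<epsilon>: "0 < \<epsilon>" and opt: "optimal_lasserre_solution n k r I L"
      and r: "real k * real (csp_threshold_rank n I ((\<epsilon> / real k) powr 3)) / \<epsilon> powr 3 \<le> real r" for \<epsilon>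
  proof (cases "\<epsilon> \<le> 1")
    case True
    obtain S \<alpha> where S: "S \<in> seeds" "\<alpha> \<in> assignments S k" "0 < Z S \<alpha>"
      and lt: "lasserre_value I L - \<epsilon> < rounding_value (cp S \<alpha>)"
      using exists_good_seed[OF \<epsilon> True r] by blast
    have "(S, \<alpha>) \<in> set es" using es S seeds_small0[OF S(1)] by (auto simp: lists_indices_def)
    then obtain e where e: "e < length es" "es ! e = (S, \<alpha>)" by (auto simp: in_set_conv_nth)
    have "R.stochastic (R.seed_marginal e)"
      using cp_distribution[OF S] by (simp add: R.stochastic_def seed_marginal_eq[OF e S(1)])
    then have "R.qval (R.seed_marginal e) \<le> snd s 6 0" using best e(1) by blast
    moreover have "R.qval (R.seed_marginal e) = R.qval (cp S \<alpha>)"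
      by (rule R.qval_cong) (simp add: seed_marginal_eq[OF e S(1)])
    ultimately have "lasserre_value I L - \<epsilon> < val I (output_assignment n s)" using lt by (simp add: val qval_eq)
    \<comment> \<open>Optimality of the given solution enters here: its value is at least that of
      the best assignment.\<close>
    moreover have "objective_value n k I \<le> lasserre_value I L"
      using opt objective_value_le_sdpopt[of r] by (simp add: optimal_lasserre_solution_def)
    ultimately show ?thesis by simp
  next
    case False
    obtain x where "val I x = objective_value n k I" using objective_value_attained by blast
    then have "objective_value n k I \<le> 1" using val_bounds(2)[of x] by simp
    then show ?thesis using False val_bounds(1)[of "output_assignment n s"] by simp
  qed
  then show ?thesis using ex out by blast
qed

end

theorem theorem1p1:
  shows "\<exists>c::real. c > 0 \<and>
    (\<forall>(\<epsilon>::real) n k r I. \<epsilon> > 0 \<longrightarrow> max2csp n k I \<longrightarrow> regular_constraint_graph n I \<longrightarrow>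
       real r \<ge> real k * real (csp_threshold_rank n I ((\<epsilon> / real k) powr c)) / \<epsilon> powr c \<longrightarrow>
       sdpopt n k r I \<le> objective_value n k I + \<epsilon>) \<and>
    (\<exists>(P::prog) (B::nat poly). \<forall>n k r I L cs es.
       max2csp n k I \<longrightarrow> regular_constraint_graph n I \<longrightarrow> lasserre_solution n k r L \<longrightarrow>
       lists_constraints I cs \<longrightarrow> lists_indices n k r es \<longrightarrow>
       (\<exists>t s. exec P (initial_state (encode n k r I L cs es)) t s \<and>
          t \<le> poly B (input_size (encode n k r I L cs es)) \<and>
          (\<forall>\<epsilon>::real. \<epsilon> > 0 \<longrightarrow> optimal_lasserre_solution n k r I L \<longrightarrow>
             real r \<ge> real k * real (csp_threshold_rank n I ((\<epsilon> / real k) powr c)) / \<epsilon> powr c \<longrightarrow>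
             output_assignment n s \<in> assignments {..<n} k \<and>
             val I (output_assignment n s) > objective_value n k I - \<epsilon>)))"
proof -
  obtain B :: "nat poly" where B: "\<And>N. poly B N = rounding_time N"
    using polynomial_time_rounding unfolding polynomial_time_def by blast
  show ?thesis
  proof (intro exI[of _ "3 :: real"] exI[of _ rounding_prog] exI[of _ B] conjI allI impI)
    fix \<epsilon> :: real and n k r :: nat and I :: "constraint pmf"
    assume \<epsilon>: "\<epsilon> > 0" and I: "max2csp n k I" "regular_constraint_graph n I"
      and r: "real r \<ge> real k * real (csp_threshold_rank n I ((\<epsilon> / real k) powr 3)) / \<epsilon> powr 3"
    interpret regular_csp n k I by unfold_locales (use I in auto)
    show "sdpopt n k r I \<le> objective_value n k I + \<epsilon>"
    proof (rule sdpopt_le)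
      fix L assume L: "lasserre_solution n k r L"
      interpret csp_relaxation n k I r L by unfold_locales (rule L)
      show "lasserre_value I L \<le> objective_value n k I + \<epsilon>" by (rule lasserre_value_le_objective[OF \<epsilon> r])
    qed
  next
    fix n k r I L cs es
    assume h: "max2csp n k I" "regular_constraint_graph n I" "lasserre_solution n k r L"
      "lists_constraints I cs" "lists_indices n k r es"
    interpret encoded_relaxation n k I r L cs es by unfold_locales (use h in auto)
    show "\<exists>t s. exec rounding_prog (initial_state inp) t s \<and> t \<le> poly B (input_size inp) \<and>
      (\<forall>\<epsilon>::real. \<epsilon> > 0 \<longrightarrow> optimal_lasserre_solution n k r I L \<longrightarrow>
        real r \<ge> real k * real (csp_threshold_rank n I ((\<epsilon> / real k) powr 3)) / \<epsilon> powr 3 \<longrightarrow>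
        output_assignment n s \<in> assignments {..<n} k \<and>
        val I (output_assignment n s) > objective_value n k I - \<epsilon>)"
      using rounding_prog_correct unfolding B by blast
  qed simp
qed

end
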